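(* Let $K$ be an infinite field, let $m,n\ge 1$ be integers, and let $G=([n],E)$ be a graph. Let $X=(x_{ij})$ be the generic $m\times n$ matrix of variables and $S=K[X]$ with the $\mathbb{Z}^n$-grading $\deg x_{ij}=e_j$. Then the generalized binomial edge ideal $I_G(m)\subseteq S$ is Cartwright-Sturmfels. More precisely, let $>$ be a term order on $S$ satisfying $x_{1j}>x_{2j}>\cdots>x_{mj}$ for all $j\in[n]$. Then the $\mathbb{Z}^n$-graded generic initial ideal $\operatorname{gin}_>(I_G(m))$ is generated by the monomials $$\prod_{j\in A} x_{i_j j},$$ where $A$ ranges over the subsets $A\subseteq[n]$ such that the induced graph $G_A$ is connected, and $(i_j)_{j\in A}$ ranges over the families with $$i_j\in[m]\ \text{ for every } j\in A\quad\text{and}\quad \sum_{j\in A} i_j\le m(|A|-1).$$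
   Context: Notation: $[n]=\{1,\dots,n\}$, and $e_j$ is the $j$-th standard basis vector of $\mathbb{Z}^n$. A graph $G=([n],E)$ is undirected and simple: $E$ is a set of $2$-element subsets of $[n]$. For $A\subseteq[n]$, $G_A=(A,E_A)$ is the induced graph with $E_A=\{e\in E: e\subseteq A\}$. The generalized binomial edge ideal $I_G(m)$ is the ideal of $S$ generated by all $2$-minors of $X$ using columns $j,k$, as $\{j,k\}$ varies over $E$. The group $\mathrm{GL}_m(K)^n$ acts on $S$ by $\mathbb{Z}^n$-graded $K$-algebra automorphisms, the $j$-th factor acting linearly on the span of $x_{1j},\dots,x_{mj}$. For a $\mathbb{Z}^n$-graded ideal $I$ and a term order $>$, there is a non-empty Zariski open subset $U$ of this group on which $\operatorname{in}_>(gI)$ is constant; this common initial ideal is the $\mathbb{Z}^n$-graded generic initial ideal $\operatorname{gin}_>(I)$. Borel-fixed ideals are those fixed by the product of the subgroups of upper triangular matrices; a radical monomial ideal $J$ is Borel-fixed if and only if for all monomials $x_{ij}w\in J$ one has $x_{kj}w\in J$ for all $k<i$. The $\mathbb{Z}^n$-graded Hilbert series of a finitely generated $\mathbb{Z}^n$-graded module $M=\bigoplus_{a\in\mathbb{N}^n}M_a$ is $\sum_a(\dim_K M_a)Z^a\in\mathbb{Q}[[Z_1,\dots,Z_n]]$. A $\mathbb{Z}^n$-graded ideal $I$ of $S$ is Cartwright-Sturmfels (CS) if there exists a radical Borel-fixed monomial ideal $J$ of $S$ with the same $\mathbb{Z}^n$-graded Hilbert series as $I$. (Equivalently, $\operatorname{gin}_>(I)$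 is radical for a term order $>$ with $x_{1j}>x_{2j}>\cdots>x_{mj}$ for all $j$.) *)

theory Defs
  imports
    "HOL-Library.Poly_Mapping"
    "HOL-Library.FuncSet"
    "HOL-Algebra.Ideal"
    "Jordan_Normal_Form.Matrix"
begin

section \<open>Polynomial rings\<close>

text \<open>
  A monomial in variables from \<open>'v\<close> is its exponent vector, a polynomial is a finitely supported
  family of coefficients; addition and multiplication (convolution) come from
  \<open>HOL-Library.Poly_Mapping\<close>.
\<close>

type_synonym 'v monom = "'v \<Rightarrow>\<^sub>0 nat"
type_synonym ('v, 'a) mpol = "'v monom \<Rightarrow>\<^sub>0 'a"

definition Monoms :: "'v set \<Rightarrow> 'v monom set" where
  "Monoms V = {t. Poly_Mapping.keys t \<subseteq> V}"

definition Polys :: "'v set \<Rightarrow> ('v, 'a::zero) mpol set" where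
  "Polys V = {p. Poly_Mapping.keys p \<subseteq> Monoms V}"

definition Const :: "'a \<Rightarrow> ('v, 'a::zero) mpol" where
  "Const c = Poly_Mapping.single 0 c"

definition monomial :: "'v monom \<Rightarrow> ('v, 'a::zero_neq_one) mpol" where
  "monomial t = Poly_Mapping.single t 1"

definition Var :: "'v \<Rightarrow> ('v, 'a::zero_neq_one) mpol" where
  "Var v = monomial (Poly_Mapping.single v 1)"

text \<open>Evaluation at the point \<open>f\<close>, where \<open>c\<close> embeds the coefficients into the target ring.\<close>

definition peval :: "('a \<Rightarrow> 'r) \<Rightarrow> ('v \<Rightarrow> 'r) \<Rightarrow> ('v, 'a::zero) mpol \<Rightarrow> 'r::comm_ring_1" where
  "peval c f p = (\<Sum>t\<in>Poly_Mapping.keys p. c (Poly_Mapping.lookup p t) *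
     (\<Prod>v\<in>Poly_Mapping.keys t. f v ^ Poly_Mapping.lookup t v))"


section \<open>The polynomial ring of the generic matrix\<close>

text \<open>The pair \<open>(i, j)\<close> stands for the variable in row \<open>i\<close> and column \<open>j\<close>, counted from 1.\<close>

type_synonym 'k pol = "(nat \<times> nat, 'k) mpol"

definition matrix_vars :: "nat \<Rightarrow> nat \<Rightarrow> (nat \<times> nat) set" where
  "matrix_vars m n = {1..m} \<times> {1..n}"

abbreviation X :: "nat \<Rightarrow> nat \<Rightarrow> 'k::field pol" where
  "X i j \<equiv> Var (i, j)"

definition S_ring :: "nat \<Rightarrow> nat \<Rightarrow> 'k::field pol ring" where
  "S_ring m n = \<lparr>carrier = Polys (matrix_vars m n), monoid.mult = (*), one = 1, zero = 0, add = (+)\<rparr>"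


section \<open>Grading and Hilbert series\<close>

text \<open>
  The degree of \<open>X i j\<close> is the basis vector \<open>e\<^sub>j\<close>. All degrees that occur lie in
  \<open>\<nat>\<^sup>n\<close>, so exponent vectors with natural entries suffice.
\<close>

definition multideg :: "(nat \<times> nat) monom \<Rightarrow> (nat \<Rightarrow>\<^sub>0 nat)" where
  "multideg t = (\<Sum>v\<in>Poly_Mapping.keys t. Poly_Mapping.single (snd v) (Poly_Mapping.lookup t v))"

definition hom_component :: "(nat \<Rightarrow>\<^sub>0 nat) \<Rightarrow> 'k::field pol \<Rightarrow> 'k pol" where
  "hom_component a p = (\<Sum>t | t \<in> Poly_Mapping.keys p \<and> multideg t = a.
     Poly_Mapping.single t (Poly_Mapping.lookup p t))"

definition graded_ideal :: "nat \<Rightarrow> nat \<Rightarrow> 'k::field pol set \<Rightarrow> bool" where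
  "graded_ideal m n I \<longleftrightarrow> ideal I (S_ring m n) \<and> (\<forall>p\<in>I. \<forall>a. hom_component a p \<in> I)"

definition graded_piece :: "'k::field pol set \<Rightarrow> (nat \<Rightarrow>\<^sub>0 nat) \<Rightarrow> 'k pol set" where
  "graded_piece I a = {p \<in> I. \<forall>t\<in>Poly_Mapping.keys p. multideg t = a}"

definition pol_scale :: "'k \<Rightarrow> 'k::field pol \<Rightarrow> 'k pol" where
  "pol_scale c p = Const c * p"

global_interpretation pol_vs: vector_space pol_scale
  by standard
    (simp_all add: pol_scale_def Const_def single_add distrib_left distrib_right
      mult_single flip: mult.assoc)

text \<open>A formal power series in \<open>Z\<^sub>1, \<dots>, Z\<^sub>n\<close> is given by its coefficient function.\<close>

definition hilbert_series :: "'k::field pol set \<Rightarrow> (nat \<Rightarrow>\<^sub>0 nat) \<Rightarrow> rat" where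
  "hilbert_series I = (\<lambda>a. of_nat (pol_vs.dim (graded_piece I a)))"


section \<open>The action of \<open>GL\<^sub>m(K)\<^sup>n\<close>\<close>

definition GL :: "nat \<Rightarrow> 'k::field mat set" where
  "GL m = {A \<in> carrier_mat m m. invertible_mat A}"

definition GL_prod :: "nat \<Rightarrow> nat \<Rightarrow> (nat \<Rightarrow> 'k::field mat) set" where
  "GL_prod m n = (\<Pi>\<^sub>E j\<in>{1..n}. GL m)"

definition Borel_prod :: "nat \<Rightarrow> nat \<Rightarrow> (nat \<Rightarrow> 'k::field mat) set" where
  "Borel_prod m n = (\<Pi>\<^sub>E j\<in>{1..n}. {A \<in> GL m. upper_triangular A})"

text \<open>
  Left action: \<open>g j\<close> is the matrix of the induced map on the span of \<open>X 1 j, \<dots>, X m j\<close>, with the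
  image of \<open>X i j\<close> in its \<open>i\<close>-th column, so that upper triangular matrices send \<open>X i j\<close> into the
  span of the \<open>X k j\<close> with \<open>k \<le> i\<close>. The entries of a \<open>mat\<close> are indexed from 0.
\<close>

definition act :: "nat \<Rightarrow> (nat \<Rightarrow> 'k::field mat) \<Rightarrow> 'k pol \<Rightarrow> 'k pol" where
  "act m g = peval Const (\<lambda>(i, j). \<Sum>k=1..m. Const (g j $$ (k - 1, i - 1)) * X k j)"

text \<open>
  The subspace topology from the affine space of \<open>n\<close>-tuples of matrices. The variable
  \<open>(j, i, k)\<close> is the coordinate \<open>(i, k)\<close> of the \<open>j\<close>-th matrix, counted from 1.
\<close>

definition zariski_open :: "nat \<Rightarrow> nat \<Rightarrow> (nat \<Rightarrow> 'k::field mat) set \<Rightarrow> bool" where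
  "zariski_open m n U \<longleftrightarrow> (\<exists>P :: (nat \<times> nat \<times> nat, 'k) mpol set.
     P \<subseteq> Polys ({1..n} \<times> {1..m} \<times> {1..m}) \<and>
     U = {g \<in> GL_prod m n. \<exists>p\<in>P. peval id (\<lambda>(j, i, k). g j $$ (i - 1, k - 1)) p \<noteq> 0})"


section \<open>Initial ideals\<close>

text \<open>\<open>(s, t) \<in> r\<close> means that \<open>s\<close> is less than or equal to \<open>t\<close>.\<close>

definition term_order :: "nat \<Rightarrow> nat \<Rightarrow> (nat \<times> nat) monom rel \<Rightarrow> bool" where
  "term_order m n r \<longleftrightarrow>
     linear_order_on (Monoms (matrix_vars m n)) r \<and>
     (\<forall>t\<in>Monoms (matrix_vars m n). (0, t) \<in> r) \<and>
     (\<forall>s t. \<forall>u\<in>Monoms (matrix_vars m n). (s, t) \<in> r \<longrightarrow> (s + u, t + u) \<in> r)"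

definition lead_monom :: "(nat \<times> nat) monom rel \<Rightarrow> 'k::field pol \<Rightarrow> (nat \<times> nat) monom" where
  "lead_monom r p = (THE t. t \<in> Poly_Mapping.keys p \<and> (\<forall>s\<in>Poly_Mapping.keys p. (s, t) \<in> r))"

definition initial_ideal ::
    "nat \<Rightarrow> nat \<Rightarrow> (nat \<times> nat) monom rel \<Rightarrow> 'k::field pol set \<Rightarrow> 'k pol set" where
  "initial_ideal m n r I = Idl\<^bsub>S_ring m n\<^esub> {monomial (lead_monom r p) |p. p \<in> I \<and> p \<noteq> 0}"

text \<open>
  Over an infinite field two non-empty open subsets of \<open>GL_prod m n\<close> meet, so at most one \<open>J\<close>
  satisfies this for given \<open>I\<close>.
\<close>

definition is_gin ::
    "nat \<Rightarrow> nat \<Rightarrow> (nat \<times> nat) monom rel \<Rightarrow> 'k::field pol set \<Rightarrow> 'k pol set \<Rightarrow> bool" where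
  "is_gin m n r I J \<longleftrightarrow>
     (\<exists>U. zariski_open m n U \<and> U \<noteq> {} \<and> (\<forall>g\<in>U. initial_ideal m n r (act m g ` I) = J))"


section \<open>Cartwright-Sturmfels ideals\<close>

definition monomial_ideal :: "nat \<Rightarrow> nat \<Rightarrow> 'k::field pol set \<Rightarrow> bool" where
  "monomial_ideal m n J \<longleftrightarrow>
     (\<exists>M \<subseteq> Monoms (matrix_vars m n). J = Idl\<^bsub>S_ring m n\<^esub> (monomial ` M))"

definition radical_ideal :: "nat \<Rightarrow> nat \<Rightarrow> 'k::field pol set \<Rightarrow> bool" where
  "radical_ideal m n J \<longleftrightarrow> ideal J (S_ring m n) \<and>
     (\<forall>p\<in>carrier (S_ring m n). \<forall>k::nat. p ^ k \<in> J \<longrightarrow> p \<in> J)"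

definition borel_fixed :: "nat \<Rightarrow> nat \<Rightarrow> 'k::field pol set \<Rightarrow> bool" where
  "borel_fixed m n J \<longleftrightarrow> (\<forall>g\<in>Borel_prod m n. act m g ` J = J)"

definition cartwright_sturmfels :: "nat \<Rightarrow> nat \<Rightarrow> 'k::field pol set \<Rightarrow> bool" where
  "cartwright_sturmfels m n I \<longleftrightarrow> graded_ideal m n I \<and>
     (\<exists>J :: 'k pol set. monomial_ideal m n J \<and> radical_ideal m n J \<and> borel_fixed m n J \<and>
       hilbert_series J = hilbert_series I)"


section \<open>Graphs and generalized binomial edge ideals\<close>

definition simple_graph :: "nat set \<Rightarrow> nat set set \<Rightarrow> bool" where
  "simple_graph V E \<longleftrightarrow> (\<forall>e\<in>E. e \<subseteq> V \<and> card e = 2)"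

definition induced_edges :: "nat set set \<Rightarrow> nat set \<Rightarrow> nat set set" where
  "induced_edges E A = {e \<in> E. e \<subseteq> A}"

text \<open>The graph without vertices does not count as connected.\<close>

definition connected_graph :: "nat set \<Rightarrow> nat set set \<Rightarrow> bool" where
  "connected_graph V E \<longleftrightarrow> V \<noteq> {} \<and> (\<forall>u\<in>V. \<forall>v\<in>V. (u, v) \<in> {(a, b). {a, b} \<in> E}\<^sup>*)"

definition binomial_edge_ideal :: "nat \<Rightarrow> nat \<Rightarrow> nat set set \<Rightarrow> 'k::field pol set" where
  "binomial_edge_ideal m n E = Idl\<^bsub>S_ring m n\<^esub>
     {X a j * X b k - X a k * X b j |a b j k. 1 \<le> a \<and> a < b \<and> b \<le> m \<and> {j, k} \<in> E}"

definition gin_generators :: "nat \<Rightarrow> nat \<Rightarrow> nat set set \<Rightarrow> 'k::field pol set" where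
  "gin_generators m n E =
     {\<Prod>j\<in>A. X (i j) j |A i. A \<subseteq> {1..n} \<and> connected_graph A (induced_edges E A) \<and>
        (\<forall>j\<in>A. i j \<in> {1..m}) \<and> (\<Sum>j\<in>A. int (i j)) \<le> int m * (int (card A) - 1)}"

end

theory Submission
  imports Defs "HOL-Library.Product_Lexorder" "HOL-Combinatorics.Permutations"
    "Jordan_Normal_Form.Determinant"
begin

text \<open>
  Let \<open>I\<close> be the binomial edge ideal and \<open>J\<close> the proposed monomial ideal. A polynomial of degree \<open>a\<close> in
  \<open>I\<close> is killed by the substitution that merges the columns of each component of the graph induced
  on the support of \<open>a\<close>. The monomials of degree \<open>a\<close> outside \<open>J\<close> inject into the fibres of this
  substitution, whence \<open>dim I\<^sub>a \<le> dim J\<^sub>a\<close>. It remains to see that the initial ideal of \<open>g I\<close> contains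
  \<open>J\<close> for general \<open>g\<close>.

  For a connected \<open>A\<close> and rows \<open>i\<^sub>j\<close> with sum at most \<open>m (|A| - 1)\<close>, put
  \<open>h\<^sub>j = adj (g\<^sub>j)\<close>. There are at least \<open>m\<close> pairs \<open>(l, i)\<close> with \<open>l \<in> A\<close> and \<open>i > i\<^sub>l\<close>, so for general
  \<open>g\<close> the corresponding columns of the \<open>h\<^sub>l\<close> span \<open>K\<^sup>m\<close>, and column \<open>i\<^sub>j\<close> of \<open>h\<^sub>j\<close> is a sum over
  \<open>l \<in> A\<close> of vectors \<open>F\<^sub>j\<^sub>l\<close> in the span of the columns \<open>i > i\<^sub>l\<close> of \<open>h\<^sub>l\<close>. The matrix with entries
  \<open>\<delta>\<^sub>j\<^sub>l h\<^sub>j e\<^sub>i - F\<^sub>j\<^sub>l\<close> (where \<open>i = i\<^sub>j\<close>), each read as a linear form in the variables of column \<open>l\<close>,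
  has rows that add up to zero once the columns are merged. Hence its determinant lies in \<open>I\<close>. Applying
  \<open>g\<close> turns it into an element of \<open>g I\<close> whose monomials use in every column \<open>l\<close> a row
  \<open>i \<ge> i\<^sub>l\<close>, with equality throughout for the leading one.
\<close>

section \<open>Evaluation and monomials\<close>

text \<open>The bound \<open>m (|A| - 1)\<close> says that the numbers \<open>m - i_j\<close> add up
  to at least \<open>m\<close>, and both halves of the argument turn on it. If it holds, there are
  enough vectors strictly below the rows \<open>i_j\<close> to span \<open>K^m\<close>. If it fails
  for the topmost entries of every component of the support, then each column of a component can be
  moved up by the sum of \<open>m - i_l\<close> over the earlier columns \<open>l\<close> without
  leaving the matrix, and afterwards no column reaches below the top row of an earlier one; this
  makes the merged monomial decodable. The halves meet by a count in each degree:
  \<open>act m g\<close> preserves dimensions, and a finite-dimensional space of polynomials has as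
  many leading monomials as its dimension, so that \<open>J_a\<close> among the leading monomials of
  \<open>(g I)_a\<close> and \<open>dim I_a \<le> dim J_a\<close> force equality. Merging columns
  gives a necessary condition for membership in \<open>I\<close> in every degree. A sufficient one
  is used for the determinants alone: their degree is squarefree with connected support, and there
  swaps along paths generate all permutations of the rows.\<close>

lemma sum_single_lookup: "(\<Sum>t\<in>Poly_Mapping.keys p. Poly_Mapping.single t (Poly_Mapping.lookup p t)) = p"
  by (rule poly_mapping_eqI)
    (simp add: lookup_sum lookup_single when_def sum.delta in_keys_iff)

lemma poly_mapping_single_induct [case_names single add]:
  fixes p :: "'a \<Rightarrow>\<^sub>0 'b::comm_monoid_add"
  assumes single: "\<And>t a. P (Poly_Mapping.single t a)"
    and add: "\<And>p q. P p \<Longrightarrow> P q \<Longrightarrow> P (p + q)"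
  shows "P p"
proof -
  have "P (\<Sum>t\<in>T. Poly_Mapping.single t (Poly_Mapping.lookup p t))" for T
    using single[of _ 0] by (induction T rule: infinite_finite_induct) (simp_all add: single add)
  from this[of "Poly_Mapping.keys p"] show ?thesis
    by (simp add: sum_single_lookup)
qed

section \<open>Evaluation of monomials and polynomials\<close>

definition mev :: "('v \<Rightarrow> 'r) \<Rightarrow> 'v monom \<Rightarrow> 'r::comm_ring_1" where
  "mev f t = (\<Prod>v\<in>Poly_Mapping.keys t. f v ^ Poly_Mapping.lookup t v)"

lemma mev_superset:
  assumes "finite T" "Poly_Mapping.keys t \<subseteq> T"
  shows "mev f t = (\<Prod>v\<in>T. f v ^ Poly_Mapping.lookup t v)"
  unfolding mev_def
  by (rule prod.mono_neutral_left) (use assms in \<open>auto simp: in_keys_iff\<close>)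

lemma mev_zero [simp]: "mev f 0 = 1"
  by (simp add: mev_def)

lemma mev_single [simp]: "mev f (Poly_Mapping.single v k) = f v ^ k"
  by (simp add: mev_def)

lemma mev_add: "mev f (s + t) = mev f s * mev f t"
proof -
  let ?T = "Poly_Mapping.keys s \<union> Poly_Mapping.keys t"
  have "mev f (s + t) = (\<Prod>v\<in>?T. f v ^ Poly_Mapping.lookup (s + t) v)"
    by (rule mev_superset) (use Poly_Mapping.keys_add[of s t] in auto)
  also have "\<dots> = (\<Prod>v\<in>?T. f v ^ Poly_Mapping.lookup s v) * (\<Prod>v\<in>?T. f v ^ Poly_Mapping.lookup t v)"
    by (simp add: lookup_add power_add prod.distrib)
  also have "\<dots> = mev f s * mev f t"
    by (simp add: mev_superset[of ?T])
  finally show ?thesis .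
qed

lemma mev_sum: "mev f (\<Sum>x\<in>B. t x) = (\<Prod>x\<in>B. mev f (t x))"
  by (induction B rule: infinite_finite_induct) (simp_all add: mev_add)

lemma peval_superset:
  assumes "finite T" "Poly_Mapping.keys p \<subseteq> T" "c 0 = 0"
  shows "peval c f p = (\<Sum>t\<in>T. c (Poly_Mapping.lookup p t) * mev f t)"
  unfolding peval_def mev_def
  by (rule sum.mono_neutral_left) (use assms in \<open>auto simp: in_keys_iff\<close>)

lemma peval_single:
  assumes "c 0 = 0"
  shows "peval c f (Poly_Mapping.single t a) = c a * mev f t"
  using assms by (auto simp: peval_def mev_def)

lemma peval_add:
  assumes "c 0 = 0" "\<And>a b. c (a + b) = c a + c b"
  shows "peval c f (p + q) = peval c f p + peval c f q"
proof -
  let ?T = "Poly_Mapping.keys p \<union> Poly_Mapping.keys q"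
  have "peval c f (p + q) = (\<Sum>t\<in>?T. c (Poly_Mapping.lookup (p + q) t) * mev f t)"
    by (rule peval_superset) (use Poly_Mapping.keys_add[of p q] assms in auto)
  also have "\<dots> = peval c f p + peval c f q"
    by (simp add: lookup_add assms(2) distrib_right sum.distrib peval_superset[of ?T] assms(1))
  finally show ?thesis .
qed

lemma peval_mult:
  assumes c: "comm_ring_hom c"
  shows "peval c f (p * q) = peval c f p * peval c f q"
proof -
  interpret c: comm_ring_hom c by fact
  note padd = peval_add[of c, OF c.hom_zero c.hom_add]
  note sing = peval_single[of c, OF c.hom_zero]
  have single_mult: "peval c f (Poly_Mapping.single s a * q) = c a * mev f s * peval c f q" for s a
  proof (induction q rule: poly_mapping_single_induct)
    case (single t b)
    then show ?case by (simp add: mult_single sing mev_add c.hom_mult)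
  next
    case (add g h)
    then show ?case by (simp add: distrib_left padd)
  qed
  show ?thesis
  proof (induction p rule: poly_mapping_single_induct)
    case (single t b)
    then show ?case by (simp add: single_mult sing)
  next
    case (add g h)
    then show ?case by (simp add: distrib_right padd)
  qed
qed

lemma peval_hom:
  assumes c: "comm_ring_hom c"
  shows "comm_ring_hom (peval c f)"
proof -
  interpret c: comm_ring_hom c by fact
  have "peval c f 1 = 1"
    using peval_single[of c f 0 1] by simp
  moreover have "peval c f 0 = 0"
    by (simp add: peval_def)
  ultimately show ?thesis
    by unfold_locales (simp_all add: peval_add c.hom_add peval_mult[OF c])
qed

lemma comm_ring_hom_Const: "comm_ring_hom (Const :: 'a::comm_ring_1 \<Rightarrow> ('v, 'a) mpol)"
  by unfold_locales (simp_all add: Const_def single_add mult_single)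

lemma comm_ring_hom_id: "comm_ring_hom (id :: 'a::comm_ring_1 \<Rightarrow> 'a)"
  by unfold_locales simp_all

lemma peval_Const:
  assumes "comm_ring_hom c"
  shows "peval c f (Const a) = c a"
proof -
  interpret c: comm_ring_hom c by fact
  show ?thesis by (simp add: Const_def peval_single)
qed

lemma peval_monomial:
  assumes "comm_ring_hom c"
  shows "peval c f (monomial t) = mev f t"
proof -
  interpret c: comm_ring_hom c by fact
  show ?thesis by (simp add: monomial_def peval_single)
qed

lemma peval_Var:
  assumes "comm_ring_hom c"
  shows "peval c f (Var v) = f v"
  using assms by (simp add: Var_def peval_monomial)

lemma hom_peval:
  assumes "comm_ring_hom H"
  shows "H (peval c f p) = peval (H \<circ> c) (H \<circ> f) p"
proof -
  interpret H: comm_ring_hom H by fact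
  show ?thesis by (simp add: peval_def H.hom_sum H.hom_mult H.hom_prod H.hom_power)
qed

section \<open>Monomials as polynomials\<close>

lemma Const_mult_monomial: "Const a * monomial t = Poly_Mapping.single t a"
  for a :: "'a::comm_ring_1"
  by (simp add: Const_def monomial_def mult_single)

lemma monomial_add: "monomial (s + t) = monomial s * (monomial t :: ('v, 'a::comm_ring_1) mpol)"
  by (simp add: monomial_def mult_single)

lemma monomial_zero [simp]: "monomial 0 = 1"
  by (simp add: monomial_def)

lemma monomial_sum: "monomial (\<Sum>x\<in>B. t x) = (\<Prod>x\<in>B. (monomial (t x) :: ('v, 'a::comm_ring_1) mpol))"
  by (induction B rule: infinite_finite_induct) (simp_all add: monomial_add)

lemma monomial_power: "monomial t ^ k = (monomial (\<Sum>_\<in>{..<k}. t) :: ('v, 'a::comm_ring_1) mpol)"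
  by (simp add: monomial_sum)

lemma keys_monomial [simp]: "Poly_Mapping.keys (monomial t :: ('v, 'a::comm_ring_1) mpol) = {t}"
  by (simp add: monomial_def)

lemma lookup_monomial: "Poly_Mapping.lookup (monomial t :: ('v, 'a::comm_ring_1) mpol) s = (if s = t then 1 else 0)"
  by (simp add: monomial_def lookup_single when_def)

lemma mev_Var: "mev Var t = (monomial t :: ('v, 'a::comm_ring_1) mpol)"
proof -
  have single: "Poly_Mapping.single v k = (\<Sum>_\<in>{..<k}. Poly_Mapping.single v 1)" for v :: 'v and k :: nat
    by (rule poly_mapping_eqI) (simp add: lookup_sum lookup_single when_def)
  have "mev Var t = (\<Prod>v\<in>Poly_Mapping.keys t. (monomial (Poly_Mapping.single v (Poly_Mapping.lookup t v)) :: ('v, 'a) mpol))"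
    unfolding mev_def
  proof (rule prod.cong[OF refl])
    fix v
    show "(Var v :: ('v, 'a) mpol) ^ Poly_Mapping.lookup t v =
      monomial (Poly_Mapping.single v (Poly_Mapping.lookup t v))"
      by (subst single) (simp only: Var_def monomial_power)
  qed
  also have "\<dots> = monomial t"
    by (simp add: monomial_sum[symmetric] sum_single_lookup)
  finally show ?thesis .
qed

lemma peval_Const_Var: "peval Const Var p = (p :: ('v, 'a::comm_ring_1) mpol)"
  unfolding peval_def mev_def[symmetric]
  by (simp add: mev_Var Const_mult_monomial sum_single_lookup)

lemma peval_cong:
  assumes "p \<in> Polys V" "\<And>v. v \<in> V \<Longrightarrow> f v = f' v"
  shows "peval c f p = peval c f' p"
  unfolding peval_def
  by (intro sum.cong prod.cong refl arg_cong2[where f="(*)"] arg_cong2[where f="(^)"])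
    (use assms in \<open>force simp: Polys_def Monoms_def\<close>)

text \<open>What the substitution of \<open>h v\<close> for \<open>v\<close> does to exponents. The
  multidegree, the row content of a monomial, the column shift and the merging of columns are all
  instances.\<close>

definition push_forward :: "('v \<Rightarrow> 'w) \<Rightarrow> 'v monom \<Rightarrow> 'w monom" where
  "push_forward h t = (\<Sum>v\<in>Poly_Mapping.keys t. Poly_Mapping.single (h v) (Poly_Mapping.lookup t v))"

lemma push_forward_superset:
  assumes "finite T" "Poly_Mapping.keys t \<subseteq> T"
  shows "push_forward h t = (\<Sum>v\<in>T. Poly_Mapping.single (h v) (Poly_Mapping.lookup t v))"
  unfolding push_forward_def
  by (rule sum.mono_neutral_left) (use assms in \<open>auto simp: in_keys_iff\<close>)

lemma push_forward_zero [simp]: "push_forward h 0 = 0"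
  by (simp add: push_forward_def)

lemma push_forward_single [simp]: "push_forward h (Poly_Mapping.single v k) = Poly_Mapping.single (h v) k"
  by (simp add: push_forward_def)

lemma push_forward_add: "push_forward h (s + t) = push_forward h s + push_forward h t"
proof -
  let ?T = "Poly_Mapping.keys s \<union> Poly_Mapping.keys t"
  have "push_forward h (s + t) = (\<Sum>v\<in>?T. Poly_Mapping.single (h v) (Poly_Mapping.lookup (s + t) v))"
    by (rule push_forward_superset) (use Poly_Mapping.keys_add[of s t] in auto)
  also have "\<dots> = push_forward h s + push_forward h t"
    by (simp add: lookup_add single_add sum.distrib push_forward_superset[of ?T])
  finally show ?thesis .
qed

lemma push_forward_sum: "push_forward h (\<Sum>x\<in>B. t x) = (\<Sum>x\<in>B. push_forward h (t x))"
  by (induction B rule: infinite_finite_induct) (simp_all add: push_forward_add)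

lemma lookup_push_forward:
  assumes "finite T" "Poly_Mapping.keys t \<subseteq> T"
  shows "Poly_Mapping.lookup (push_forward h t) w = (\<Sum>v | v \<in> T \<and> h v = w. Poly_Mapping.lookup t v)"
  by (simp add: push_forward_superset[OF assms] lookup_sum lookup_single when_def
      sum.inter_filter[symmetric] assms(1))

lemma push_forward_compose: "push_forward h (push_forward h' t) = push_forward (h \<circ> h') t"
  by (simp add: push_forward_def[of h' t] push_forward_def[of "h \<circ> h'"] push_forward_sum)

text \<open>Only the variables that occur in \<open>t\<close> are constrained, because some of the
  substitutions below send all other variables to 0.\<close>

lemma mev_Var_comp:
  assumes "\<And>v. v \<in> Poly_Mapping.keys t \<Longrightarrow> f v = Var (h v)"
  shows "mev f t = (monomial (push_forward h t) :: ('w, 'a::comm_ring_1) mpol)"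
proof -
  have "mev f t = (\<Prod>v\<in>Poly_Mapping.keys t. (Var (h v) :: ('w, 'a) mpol) ^ Poly_Mapping.lookup t v)"
    unfolding mev_def by (intro prod.cong refl) (simp add: assms)
  also have "\<dots> = (\<Prod>v\<in>Poly_Mapping.keys t. mev Var (Poly_Mapping.single (h v) (Poly_Mapping.lookup t v)))"
    by simp
  also have "\<dots> = mev Var (push_forward h t)"
    by (simp only: push_forward_def mev_sum)
  finally show ?thesis by (simp add: mev_Var)
qed

lemma multideg_eq: "multideg = push_forward snd"
  by (simp add: fun_eq_iff multideg_def push_forward_def)

section \<open>Monomials and polynomials in a fixed set of variables\<close>

lemma Monoms_zero [simp]: "0 \<in> Monoms V"
  by (simp add: Monoms_def)

lemma Monoms_single: "v \<in> V \<Longrightarrow> Poly_Mapping.single v k \<in> Monoms V"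
  by (simp add: Monoms_def)

lemma Monoms_add: "s \<in> Monoms V \<Longrightarrow> t \<in> Monoms V \<Longrightarrow> s + t \<in> Monoms V"
  using Poly_Mapping.keys_add[of s t] by (auto simp: Monoms_def)

lemma Monoms_sum: "(\<And>x. x \<in> B \<Longrightarrow> t x \<in> Monoms V) \<Longrightarrow> (\<Sum>x\<in>B. t x) \<in> Monoms V"
  by (induction B rule: infinite_finite_induct) (simp_all add: Monoms_add)

lemma Polys_zero [simp]: "0 \<in> Polys V"
  by (simp add: Polys_def)

lemma Polys_Const [simp]: "Const a \<in> Polys V"
  by (simp add: Polys_def Const_def)

lemma Polys_one [simp]: "(1 :: ('v, 'a::comm_ring_1) mpol) \<in> Polys V"
  by (simp add: Polys_def)

lemma Polys_monomial: "t \<in> Monoms V \<Longrightarrow> (monomial t :: ('v, 'a::comm_ring_1) mpol) \<in> Polys V"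
  by (simp add: Polys_def)

lemma Polys_Var: "v \<in> V \<Longrightarrow> (Var v :: ('v, 'a::comm_ring_1) mpol) \<in> Polys V"
  by (simp add: Var_def Polys_monomial Monoms_single)

lemma Polys_add: "p \<in> Polys V \<Longrightarrow> q \<in> Polys V \<Longrightarrow> p + q \<in> Polys V"
  using Poly_Mapping.keys_add[of p q] by (auto simp: Polys_def)

lemma keys_uminus: "Poly_Mapping.keys (- p) = Poly_Mapping.keys (p :: 'v \<Rightarrow>\<^sub>0 'a::ab_group_add)"
  by (auto simp: in_keys_iff)

lemma Polys_uminus: "p \<in> Polys V \<Longrightarrow> - p \<in> Polys V"
  for p :: "('v, 'a::comm_ring_1) mpol"
  by (simp add: Polys_def keys_uminus)

lemma Polys_diff: "p \<in> Polys V \<Longrightarrow> q \<in> Polys V \<Longrightarrow> p - q \<in> Polys V"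
  for p :: "('v, 'a::comm_ring_1) mpol"
  using Polys_add[of p V "- q"] Polys_uminus[of q V] by simp

lemma Polys_mult: "p \<in> Polys V \<Longrightarrow> q \<in> Polys V \<Longrightarrow> p * q \<in> Polys V"
  for p :: "('v, 'a::comm_ring_1) mpol"
  using keys_mult[of p q] by (fastforce simp: Polys_def intro: Monoms_add)

lemma Polys_sum: "(\<And>x. x \<in> B \<Longrightarrow> p x \<in> Polys V) \<Longrightarrow> (\<Sum>x\<in>B. p x) \<in> Polys V"
  by (induction B rule: infinite_finite_induct) (simp_all add: Polys_add)

lemma Polys_prod: "(\<And>x. x \<in> B \<Longrightarrow> p x \<in> Polys V) \<Longrightarrow> (\<Prod>x\<in>B. p x) \<in> Polys V"
  for p :: "'i \<Rightarrow> ('v, 'a::comm_ring_1) mpol"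
  by (induction B rule: infinite_finite_induct) (simp_all add: Polys_mult)

lemma Polys_power: "p \<in> Polys V \<Longrightarrow> p ^ k \<in> Polys V"
  for p :: "('v, 'a::comm_ring_1) mpol"
  by (induction k) (simp_all add: Polys_mult)

lemma peval_in_Polys:
  assumes "p \<in> Polys V" "\<And>v. v \<in> V \<Longrightarrow> f v \<in> Polys W"
  shows "peval Const f p \<in> (Polys W :: ('w, 'a::comm_ring_1) mpol set)"
  unfolding peval_def
  by (intro Polys_sum Polys_mult Polys_prod Polys_power Polys_Const assms(2))
    (use assms(1) in \<open>auto simp: Polys_def Monoms_def\<close>)

section \<open>Coefficients and spans of monomials\<close>

lemma lookup_Const_mult: "Poly_Mapping.lookup (Const c * p) t = c * Poly_Mapping.lookup p t"
  for c :: "'a::comm_ring_1"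
proof (induction p rule: poly_mapping_single_induct)
  case (single s a)
  then show ?case by (simp add: Const_def mult_single lookup_single when_def)
next
  case (add p q)
  then show ?case by (simp add: distrib_left lookup_add)
qed

lemma lookup_pol_scale: "Poly_Mapping.lookup (pol_scale c p) t = c * Poly_Mapping.lookup p t"
  by (simp add: pol_scale_def lookup_Const_mult)

lemma pol_scale_monomial: "pol_scale c (monomial t) = Poly_Mapping.single t c"
  by (simp add: pol_scale_def Const_mult_monomial)

lemma sum_pol_scale_monomial:
  "(\<Sum>t\<in>Poly_Mapping.keys p. pol_scale (Poly_Mapping.lookup p t) (monomial t)) = p"
  by (simp add: pol_scale_monomial sum_single_lookup)

lemma keys_subset_span_monomials:
  "Poly_Mapping.keys p \<subseteq> M \<Longrightarrow> p \<in> pol_vs.span (monomial ` M)"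
  by (subst sum_pol_scale_monomial[of p, symmetric])
    (intro pol_vs.span_sum pol_vs.span_scale pol_vs.span_base, auto)

lemma subspace_keys: "pol_vs.subspace {p. Poly_Mapping.keys p \<subseteq> M}"
  unfolding pol_vs.subspace_def
proof safe
  fix c :: 'a and p :: "'a pol" and t
  assume "Poly_Mapping.keys p \<subseteq> M" "t \<in> Poly_Mapping.keys (pol_scale c p)"
  then show "t \<in> M" by (auto simp: in_keys_iff lookup_pol_scale)
next
  fix p q :: "'a pol" and t
  assume "Poly_Mapping.keys p \<subseteq> M" "Poly_Mapping.keys q \<subseteq> M" "t \<in> Poly_Mapping.keys (p + q)"
  then show "t \<in> M" using Poly_Mapping.keys_add[of p q] by blast
qed simp

lemma span_monomials: "pol_vs.span (monomial ` M) = {p :: 'k::field pol. Poly_Mapping.keys p \<subseteq> M}"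
proof
  show "pol_vs.span (monomial ` M) \<subseteq> {p :: 'k pol. Poly_Mapping.keys p \<subseteq> M}"
    by (rule pol_vs.span_minimal[OF _ subspace_keys]) auto
qed (auto intro: keys_subset_span_monomials)

section \<open>Ideals of the ring of the generic matrix\<close>

lemma S_ring_simps [simp]:
  "carrier (S_ring m n) = Polys (matrix_vars m n)"
  "x \<otimes>\<^bsub>S_ring m n\<^esub> y = x * y"
  "x \<oplus>\<^bsub>S_ring m n\<^esub> y = x + y"
  "\<zero>\<^bsub>S_ring m n\<^esub> = 0"
  "\<one>\<^bsub>S_ring m n\<^esub> = 1"
  by (simp_all add: S_ring_def)

lemma cring_S_ring: "cring (S_ring m n)"
proof (rule cringI)
  show "abelian_group (S_ring m n)"
  proof (rule abelian_groupI)
    fix x assume "x \<in> carrier (S_ring m n)"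
    then show "\<exists>y\<in>carrier (S_ring m n). y \<oplus>\<^bsub>S_ring m n\<^esub> x = \<zero>\<^bsub>S_ring m n\<^esub>"
      by (intro bexI[of _ "- x"]) (simp_all add: Polys_uminus)
  qed (simp_all add: Polys_add ac_simps)
  show "comm_monoid (S_ring m n)"
    by (rule comm_monoidI) (simp_all add: Polys_mult ac_simps)
qed (simp_all add: distrib_right)

text \<open>Multiplication by the constant -1 supplies the additive inverses, so closure under sums
  and multiples suffices.\<close>

lemma ideal_S_ring_iff:
  "ideal I (S_ring m n) \<longleftrightarrow> I \<subseteq> Polys (matrix_vars m n) \<and> 0 \<in> I \<and> (\<forall>p\<in>I. \<forall>q\<in>I. p + q \<in> I) \<and>
     (\<forall>p\<in>I. \<forall>q\<in>Polys (matrix_vars m n). q * p \<in> I)"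
proof
  assume "ideal I (S_ring m n)"
  then interpret ideal I "S_ring m n" .
  show "I \<subseteq> Polys (matrix_vars m n) \<and> 0 \<in> I \<and> (\<forall>p\<in>I. \<forall>q\<in>I. p + q \<in> I) \<and>
     (\<forall>p\<in>I. \<forall>q\<in>Polys (matrix_vars m n). q * p \<in> I)"
    using a_subset additive_subgroup.zero_closed[OF is_additive_subgroup]
      additive_subgroup.a_closed[OF is_additive_subgroup] I_l_closed by auto
next
  interpret S: cring "S_ring m n" by (rule cring_S_ring)
  assume *: "I \<subseteq> Polys (matrix_vars m n) \<and> 0 \<in> I \<and> (\<forall>p\<in>I. \<forall>q\<in>I. p + q \<in> I) \<and>
     (\<forall>p\<in>I. \<forall>q\<in>Polys (matrix_vars m n). q * p \<in> I)"
  show "ideal I (S_ring m n)"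
  proof (rule idealI)
    show "subgroup I (add_monoid (S_ring m n))"
    proof (rule subgroup.intro)
      fix x assume x: "x \<in> I"
      then have "- x = \<ominus>\<^bsub>S_ring m n\<^esub> x"
        using * by (intro S.minus_equality[symmetric]) (auto simp: Polys_uminus)
      moreover have "- x \<in> I"
        using * x by (metis Polys_one Polys_uminus mult_minus1)
      ultimately show "inv\<^bsub>add_monoid (S_ring m n)\<^esub> x \<in> I"
        by (simp add: a_inv_def)
    qed (use * in auto)
  qed (use * S.ring_axioms in \<open>auto simp: mult.commute\<close>)
qed

lemma ideal_subspace:
  assumes "ideal I (S_ring m n)"
  shows "pol_vs.subspace I"
  using assms by (auto simp: ideal_S_ring_iff pol_vs.subspace_def pol_scale_def)

text \<open>A spanning set over \<open>K\<close> of the ideal generated by \<open>G\<close>. Linear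
  claims about an ideal can thus be proved by span induction.\<close>

definition mult_gens :: "nat \<Rightarrow> nat \<Rightarrow> 'k::field pol set \<Rightarrow> 'k pol set" where
  "mult_gens m n G = {monomial w * g |w g. w \<in> Monoms (matrix_vars m n) \<and> g \<in> G}"

lemma span_mult_gens_ideal:
  assumes "G \<subseteq> Polys (matrix_vars m n)"
  shows "ideal (pol_vs.span (mult_gens m n G)) (S_ring m n)"
proof -
  let ?V = "matrix_vars m n"
  have "mult_gens m n G \<subseteq> {p. Poly_Mapping.keys p \<subseteq> Monoms ?V}"
  proof (clarsimp simp: mult_gens_def)
    fix w g t assume "w \<in> Monoms ?V" "g \<in> G" "t \<in> Poly_Mapping.keys (monomial w * g :: 'a pol)"
    then show "t \<in> Monoms ?V"
      using assms Polys_mult[OF Polys_monomial[of w ?V], of g] by (auto simp: Polys_def)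
  qed
  then have sub: "pol_vs.span (mult_gens m n G) \<subseteq> Polys ?V"
    unfolding Polys_def by (rule pol_vs.span_minimal[OF _ subspace_keys])
  have mult: "Poly_Mapping.single t c * p \<in> pol_vs.span (mult_gens m n G)"
    if t: "t \<in> Monoms ?V" and p: "p \<in> pol_vs.span (mult_gens m n G)" for t c p
    using p
  proof (induction rule: pol_vs.span_induct)
    case base
    have "Poly_Mapping.single t c * pol_scale b p = pol_scale b (Poly_Mapping.single t c * p)" for b p
      by (simp add: pol_scale_def mult.left_commute)
    then show ?case
      by (simp add: pol_vs.subspace_def distrib_left pol_vs.span_zero pol_vs.span_add pol_vs.span_scale)
  next
    case (step p)
    then obtain w g where "p = monomial w * g" "w \<in> Monoms ?V" "g \<in> G"
      by (auto simp: mult_gens_def)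
    moreover have "Poly_Mapping.single t c * (monomial w * g) = pol_scale c (monomial (t + w) * g)"
      by (simp add: pol_scale_def monomial_add Const_mult_monomial[symmetric] mult.assoc)
    moreover have "monomial (t + w) * g \<in> mult_gens m n G"
      using calculation Monoms_add[OF t] unfolding mult_gens_def by blast
    ultimately show ?case
      by (simp add: pol_vs.span_scale pol_vs.span_base)
  qed
  have "q * p \<in> pol_vs.span (mult_gens m n G)"
    if q: "q \<in> Polys ?V" and p: "p \<in> pol_vs.span (mult_gens m n G)" for q p
  proof -
    have "q * p = (\<Sum>t\<in>Poly_Mapping.keys q. Poly_Mapping.single t (Poly_Mapping.lookup q t) * p)"
      by (simp add: sum_distrib_right[symmetric] sum_single_lookup)
    then show ?thesis
      using q by (auto simp: Polys_def intro!: pol_vs.span_sum mult[OF _ p])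
  qed
  then show ?thesis
    using sub by (auto simp: ideal_S_ring_iff pol_vs.span_zero pol_vs.span_add)
qed

lemma genideal_eq_span:
  assumes "G \<subseteq> Polys (matrix_vars m n)"
  shows "Idl\<^bsub>S_ring m n\<^esub> G = pol_vs.span (mult_gens m n G)"
proof
  interpret S: cring "S_ring m n" by (rule cring_S_ring)
  have "G \<subseteq> pol_vs.span (mult_gens m n G)"
  proof
    fix g assume "g \<in> G"
    then have "monomial 0 * g \<in> mult_gens m n G"
      unfolding mult_gens_def using Monoms_zero by blast
    then show "g \<in> pol_vs.span (mult_gens m n G)"
      by (simp add: pol_vs.span_base)
  qed
  then show "Idl\<^bsub>S_ring m n\<^esub> G \<subseteq> pol_vs.span (mult_gens m n G)"
    by (rule S.genideal_minimal[OF span_mult_gens_ideal[OF assms]])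
  have G: "G \<subseteq> carrier (S_ring m n)" using assms by simp
  note idl = S.genideal_ideal[OF G]
  show "pol_vs.span (mult_gens m n G) \<subseteq> Idl\<^bsub>S_ring m n\<^esub> G"
  proof (rule pol_vs.span_minimal[OF _ ideal_subspace[OF idl]])
    show "mult_gens m n G \<subseteq> Idl\<^bsub>S_ring m n\<^esub> G"
      using idl S.genideal_self[OF G] Polys_monomial
      unfolding mult_gens_def ideal_S_ring_iff by blast
  qed
qed

lemma genideal_S_ring_ideal:
  assumes "G \<subseteq> Polys (matrix_vars m n)"
  shows "ideal (Idl\<^bsub>S_ring m n\<^esub> G) (S_ring m n)"
  by (simp add: genideal_eq_span[OF assms] span_mult_gens_ideal[OF assms])

lemma genideal_S_ring_superset:
  assumes "G \<subseteq> Polys (matrix_vars m n)"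
  shows "G \<subseteq> Idl\<^bsub>S_ring m n\<^esub> G"
  using ring.genideal_self[OF cring.axioms(1)[OF cring_S_ring], of G] assms by simp

definition monom_multiples :: "nat \<Rightarrow> nat \<Rightarrow> (nat \<times> nat) monom set \<Rightarrow> (nat \<times> nat) monom set" where
  "monom_multiples m n M = {w + s |w s. w \<in> Monoms (matrix_vars m n) \<and> s \<in> M}"

text \<open>Monomial multiples of monomials are monomials, so the ideal is a span of monomials and
  membership is decided monomial by monomial.\<close>

lemma genideal_monomials:
  assumes "M \<subseteq> Monoms (matrix_vars m n)"
  shows "Idl\<^bsub>S_ring m n\<^esub> (monomial ` M) = {p :: 'k::field pol. Poly_Mapping.keys p \<subseteq> monom_multiples m n M}"
proof -
  have "mult_gens m n (monomial ` M :: 'k pol set) = monomial ` monom_multiples m n M"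
  proof (rule Set.set_eqI, rule iffI)
    fix p :: "'k pol" assume "p \<in> mult_gens m n (monomial ` M)"
    then obtain w s where "p = monomial (w + s)" "w \<in> Monoms (matrix_vars m n)" "s \<in> M"
      by (auto simp: mult_gens_def monomial_add)
    then show "p \<in> monomial ` monom_multiples m n M"
      unfolding monom_multiples_def by blast
  next
    fix p :: "'k pol" assume "p \<in> monomial ` monom_multiples m n M"
    then obtain w s where "p = monomial w * monomial s" "w \<in> Monoms (matrix_vars m n)" "s \<in> M"
      by (auto simp: monom_multiples_def monomial_add)
    then show "p \<in> mult_gens m n (monomial ` M)"
      unfolding mult_gens_def by blast
  qed
  then show ?thesis
    using assms by (subst genideal_eq_span) (auto simp: span_monomials intro: Polys_monomial)
qed

section \<open>Homogeneous components\<close>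

lemma multideg_add: "multideg (s + t) = multideg s + multideg t"
  by (simp add: multideg_eq push_forward_add)

lemma multideg_single [simp]: "multideg (Poly_Mapping.single v k) = Poly_Mapping.single (snd v) k"
  by (simp add: multideg_eq)

lemma multideg_sum: "multideg (\<Sum>x\<in>B. t x) = (\<Sum>x\<in>B. multideg (t x))"
  by (simp add: multideg_eq push_forward_sum)

definition homogeneous :: "(nat \<Rightarrow>\<^sub>0 nat) \<Rightarrow> 'k::field pol set" where
  "homogeneous a = {p. Poly_Mapping.keys p \<subseteq> {t. multideg t = a}}"

lemma subspace_homogeneous: "pol_vs.subspace (homogeneous a)"
  unfolding homogeneous_def by (rule subspace_keys)

lemma graded_piece_eq: "graded_piece I a = I \<inter> homogeneous a"
  by (auto simp: graded_piece_def homogeneous_def)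

lemma homogeneous_mult: "p \<in> homogeneous a \<Longrightarrow> q \<in> homogeneous b \<Longrightarrow> p * q \<in> homogeneous (a + b)"
proof -
  assume "p \<in> homogeneous a" "q \<in> homogeneous b"
  then have "multideg (s + t) = a + b" if "s \<in> Poly_Mapping.keys p" "t \<in> Poly_Mapping.keys q" for s t
    using that by (auto simp: homogeneous_def multideg_add)
  then show ?thesis
    using keys_mult[of p q] by (auto simp: homogeneous_def)
qed

lemma homogeneous_monomial: "monomial t \<in> homogeneous (multideg t)"
  by (simp add: homogeneous_def)

lemma homogeneous_one: "1 \<in> homogeneous 0"
  using homogeneous_monomial[of 0] by (simp add: multideg_eq)

lemma homogeneous_power_single:
  "p \<in> homogeneous (Poly_Mapping.single j 1) \<Longrightarrow> p ^ k \<in> homogeneous (Poly_Mapping.single j k)"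
proof (induction k)
  case (Suc k)
  then have "p * p ^ k \<in> homogeneous (Poly_Mapping.single j 1 + Poly_Mapping.single j k)"
    by (intro homogeneous_mult) auto
  then show ?case by (simp add: single_add[symmetric])
qed (simp add: homogeneous_one)

lemma homogeneous_prod:
  assumes "\<And>x. x \<in> B \<Longrightarrow> p x \<in> homogeneous (a x)"
  shows "(\<Prod>x\<in>B. p x) \<in> homogeneous (\<Sum>x\<in>B. a x)"
  using assms
  by (induction B rule: infinite_finite_induct) (simp_all add: homogeneous_one homogeneous_mult)

lemma lookup_hom_component:
  "Poly_Mapping.lookup (hom_component a p) t = (if multideg t = a then Poly_Mapping.lookup p t else 0)"
  by (simp add: hom_component_def lookup_sum lookup_single when_def in_keys_iff)

lemma keys_hom_component: "Poly_Mapping.keys (hom_component a p) = {t \<in> Poly_Mapping.keys p. multideg t = a}"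
  by (auto simp: in_keys_iff lookup_hom_component split: if_splits)

lemma hom_component_homogeneous: "hom_component a p \<in> homogeneous a"
  by (auto simp: homogeneous_def keys_hom_component)

lemma hom_component_zero [simp]: "hom_component a 0 = 0"
  by (rule poly_mapping_eqI) (simp add: lookup_hom_component)

lemma hom_component_add: "hom_component a (p + q) = hom_component a p + hom_component a q"
  by (rule poly_mapping_eqI) (simp add: lookup_hom_component lookup_add)

lemma hom_component_scale: "hom_component a (pol_scale c p) = pol_scale c (hom_component a p)"
  by (rule poly_mapping_eqI) (simp add: lookup_hom_component lookup_pol_scale)

lemma hom_component_of_homogeneous:
  assumes "p \<in> homogeneous b"
  shows "hom_component a p = (if a = b then p else 0)"
proof (rule poly_mapping_eqI)
  fix t
  have "Poly_Mapping.lookup p t = 0" if "multideg t \<noteq> b"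
    using assms that by (auto simp: homogeneous_def in_keys_iff)
  then show "Poly_Mapping.lookup (hom_component a p) t = Poly_Mapping.lookup (if a = b then p else 0) t"
    by (auto simp: lookup_hom_component)
qed

text \<open>Taking a component is linear, so it is enough to look at the spanning products
  \<open>monomial w * g\<close>; these are homogeneous, and their components are themselves or
  0.\<close>

lemma graded_ideal_genideal:
  assumes "G \<subseteq> Polys (matrix_vars m n)" "\<And>g. g \<in> G \<Longrightarrow> \<exists>b. g \<in> homogeneous b"
  shows "graded_ideal m n (Idl\<^bsub>S_ring m n\<^esub> G)"
proof -
  have "hom_component a p \<in> pol_vs.span (mult_gens m n G)"
    if "p \<in> pol_vs.span (mult_gens m n G)" for a p
    using that
  proof (induction rule: pol_vs.span_induct)
    case base
    show ?case
      by (simp add: pol_vs.subspace_def hom_component_add hom_component_scale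
          pol_vs.span_zero pol_vs.span_add pol_vs.span_scale)
  next
    case (step p)
    then obtain w g where p: "p = monomial w * g" "g \<in> G"
      by (auto simp: mult_gens_def)
    with assms(2) obtain b where "g \<in> homogeneous b" by blast
    then have "p \<in> homogeneous (multideg w + b)"
      unfolding p(1) by (intro homogeneous_mult homogeneous_monomial)
    then show ?case
      using step by (auto simp: hom_component_of_homogeneous intro: pol_vs.span_base pol_vs.span_zero)
  qed
  then show ?thesis
    using genideal_S_ring_ideal[OF assms(1)]
    by (auto simp: graded_ideal_def genideal_eq_span[OF assms(1)])
qed

section \<open>The action of the group\<close>

text \<open>Linear forms in the variables of column \<open>j\<close>, with coefficients indexed by
  rows from 1. The group acts on the coefficient vector by the matrix \<open>g j\<close>, see
  \<open>act_linform\<close>.\<close>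

definition linform :: "nat \<Rightarrow> (nat \<Rightarrow> 'k) \<Rightarrow> nat \<Rightarrow> 'k::field pol" where
  "linform m v j = (\<Sum>k=1..m. Const (v k) * X k j)"

lemma linform_cong: "(\<And>k. 1 \<le> k \<Longrightarrow> k \<le> m \<Longrightarrow> v k = v' k) \<Longrightarrow> linform m v j = linform m v' j"
  unfolding linform_def by (intro sum.cong) auto

lemma linform_unit: "1 \<le> i \<Longrightarrow> i \<le> m \<Longrightarrow> linform m (\<lambda>k. if k = i then c else 0) j = Const c * X i j"
proof -
  have "Const (if k = i then c else 0) * X k j = (if k = i then Const c * X i j else 0)" for k
    by (simp add: Const_def)
  then show "1 \<le> i \<Longrightarrow> i \<le> m \<Longrightarrow> ?thesis"
    by (simp add: linform_def)
qed

lemma act_hom: "comm_ring_hom (act m g)"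
  unfolding act_def by (rule peval_hom[OF comm_ring_hom_Const])

lemma act_Const: "act m g (Const c) = Const c"
  by (simp add: act_def peval_Const[OF comm_ring_hom_Const])

lemma act_X: "act m g (X i j) = linform m (\<lambda>k. g j $$ (k - 1, i - 1)) j"
  by (simp add: act_def peval_Var[OF comm_ring_hom_Const] linform_def)

lemma act_linform:
  "act m g (linform m v j) = linform m (\<lambda>l. \<Sum>k=1..m. g j $$ (l - 1, k - 1) * v k) j"
proof -
  interpret A: comm_ring_hom "act m g" by (rule act_hom)
  interpret C: comm_ring_hom "Const :: 'a \<Rightarrow> 'a pol" by (rule comm_ring_hom_Const)
  have "act m g (linform m v j) = (\<Sum>k=1..m. \<Sum>l=1..m. Const (v k) * (Const (g j $$ (l - 1, k - 1)) * X l j))"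
    unfolding linform_def[of m v]
    by (simp add: A.hom_sum A.hom_mult act_Const act_X linform_def sum_distrib_left)
  also have "\<dots> = (\<Sum>l=1..m. \<Sum>k=1..m. Const (v k) * (Const (g j $$ (l - 1, k - 1)) * X l j))"
    by (rule sum.swap)
  finally show ?thesis
    by (simp add: linform_def C.hom_sum C.hom_mult sum_distrib_right sum_distrib_left mult_ac)
qed

lemma act_add: "act m g (p + q) = act m g p + act m g q"
proof -
  interpret A: comm_ring_hom "act m g" by (rule act_hom)
  show ?thesis by (rule A.hom_add)
qed

lemma act_mult: "act m g (p * q) = act m g p * act m g q"
proof -
  interpret A: comm_ring_hom "act m g" by (rule act_hom)
  show ?thesis by (rule A.hom_mult)
qed

lemma act_zero [simp]: "act m g 0 = 0"
proof -
  interpret A: comm_ring_hom "act m g" by (rule act_hom)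
  show ?thesis by (rule A.hom_zero)
qed

lemma act_scale: "act m g (pol_scale c p) = pol_scale c (act m g p)"
  by (simp add: pol_scale_def act_mult act_Const)

lemma act_single: "act m g (Poly_Mapping.single t c) = pol_scale c (act m g (monomial t))"
  by (simp add: act_scale[symmetric] pol_scale_monomial)

lemma linform_in_Polys: "j \<in> {1..n} \<Longrightarrow> linform m v j \<in> Polys (matrix_vars m n)"
  unfolding linform_def
  by (intro Polys_sum Polys_mult Polys_Const Polys_Var) (auto simp: matrix_vars_def)

lemma act_in_Polys:
  assumes "p \<in> Polys (matrix_vars m n)"
  shows "act m g p \<in> Polys (matrix_vars m n)"
  unfolding act_def
proof (rule peval_in_Polys[OF assms])
  fix v assume v: "v \<in> matrix_vars m n"
  obtain i j where "v = (i, j)" by force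
  with v linform_in_Polys[of j n m "\<lambda>k. g j $$ (k - 1, i - 1)"]
  show "(case v of (i, j) \<Rightarrow> \<Sum>k = 1..m. Const (g j $$ (k - 1, i - 1)) * X k j) \<in> Polys (matrix_vars m n)"
    by (auto simp: linform_def matrix_vars_def)
qed

lemma linform_homogeneous: "linform m v j \<in> homogeneous (Poly_Mapping.single j 1)"
  unfolding linform_def
proof (intro pol_vs.subspace_sum[OF subspace_homogeneous])
  fix k
  show "Const (v k) * X k j \<in> homogeneous (Poly_Mapping.single j 1)"
    using pol_vs.subspace_scale[OF subspace_homogeneous, of "X k j" "Poly_Mapping.single j 1" "v k"]
      homogeneous_monomial[of "Poly_Mapping.single (k, j) 1"]
    by (simp add: pol_scale_def Var_def)
qed

lemma act_monomial_homogeneous: "act m g (monomial t) \<in> homogeneous (multideg t)"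
proof -
  have "act m g (monomial t) = mev (\<lambda>(i, j). linform m (\<lambda>k. g j $$ (k - 1, i - 1)) j) t"
    by (simp add: act_def peval_monomial[OF comm_ring_hom_Const] linform_def)
  also have "\<dots> \<in> homogeneous (multideg t)"
    unfolding mev_def multideg_def
    by (intro homogeneous_prod homogeneous_power_single) (auto intro: linform_homogeneous[simplified])
  finally show ?thesis .
qed

text \<open>The \<open>j\<close>-th factor mixes variables of column \<open>j\<close> only, so a
  monomial goes to a polynomial that is homogeneous of the same multidegree.\<close>

lemma act_hom_component: "act m g (hom_component a p) = hom_component a (act m g p)"
proof (induction p rule: poly_mapping_single_induct)
  case (single t c)
  have "Poly_Mapping.single t c \<in> homogeneous (multideg t)"
    by (auto simp: homogeneous_def)
  moreover have "act m g (Poly_Mapping.single t c) \<in> homogeneous (multideg t)"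
    unfolding act_single
    by (intro pol_vs.subspace_scale[OF subspace_homogeneous] act_monomial_homogeneous)
  ultimately show ?case
    by (auto simp: hom_component_of_homogeneous)
next
  case (add p q)
  then show ?case by (simp add: hom_component_add act_add)
qed

lemma homogeneous_iff: "p \<in> homogeneous a \<longleftrightarrow> hom_component a p = p"
  using hom_component_homogeneous[of a p] hom_component_of_homogeneous[of p a a] by auto

lemma act_homogeneous: "p \<in> homogeneous a \<Longrightarrow> act m g p \<in> homogeneous a"
  by (simp add: homogeneous_iff act_hom_component[symmetric])

lemma sum_pred_shift: "(\<Sum>k=1..m. f (k - 1)) = (\<Sum>k<m. f k)" for m :: nat
  by (rule sum.reindex_bij_witness[of _ Suc "\<lambda>k. k - 1"]) auto

lemma index_mult_mat_pred:
  assumes "A \<in> carrier_mat m m" "B \<in> carrier_mat m m" "l \<in> {1..m}" "i \<in> {1..m}"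
  shows "(A * B) $$ (l - 1, i - 1) = (\<Sum>k=1..m. A $$ (l - 1, k - 1) * B $$ (k - 1, i - 1))"
proof -
  have "l - 1 < m" "i - 1 < m" using assms by auto
  then show ?thesis
    using assms sum_pred_shift[of "\<lambda>k. A $$ (l - 1, k) * B $$ (k, i - 1)" m]
    by (simp add: scalar_prod_def atLeast0LessThan del: One_nat_def)
qed

text \<open>The composite is again a substitution fixing the constants, and on variables it is given
  by the products \<open>g j * h j\<close>.\<close>

lemma act_inverse:
  assumes "\<And>j. j \<in> {1..n} \<Longrightarrow> g j \<in> carrier_mat m m \<and> h j \<in> carrier_mat m m \<and> g j * h j = 1\<^sub>m m"
    and p: "p \<in> Polys (matrix_vars m n)"
  shows "act m g (act m h p) = p"
proof -
  have "act m g (act m h p) = peval (act m g \<circ> Const) (act m g \<circ> (\<lambda>(i, j). \<Sum>k=1..m. Const (h j $$ (k - 1, i - 1)) * X k j)) p"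
    unfolding act_def[of m h] by (rule hom_peval[OF act_hom])
  also have "act m g \<circ> Const = Const"
    by (simp add: fun_eq_iff act_Const)
  also have "peval Const (act m g \<circ> (\<lambda>(i, j). \<Sum>k=1..m. Const (h j $$ (k - 1, i - 1)) * X k j)) p = peval Const Var p"
  proof (rule peval_cong[OF p])
    fix v assume v: "v \<in> matrix_vars m n"
    obtain i j where [simp]: "v = (i, j)" by force
    from v have ij: "i \<in> {1..m}" "j \<in> {1..n}" by (auto simp: matrix_vars_def)
    have "(act m g \<circ> (\<lambda>(i, j). \<Sum>k=1..m. Const (h j $$ (k - 1, i - 1)) * X k j)) v
        = act m g (linform m (\<lambda>k. h j $$ (k - 1, i - 1)) j)"
      by (simp add: linform_def)
    also have "\<dots> = linform m (\<lambda>l. (g j * h j) $$ (l - 1, i - 1)) j"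
      unfolding act_linform
      by (rule linform_cong) (subst index_mult_mat_pred, use assms(1)[OF ij(2)] ij in auto)
    also have "\<dots> = linform m (\<lambda>l. if l = i then 1 else 0) j"
      by (rule linform_cong) (use assms(1)[OF ij(2)] ij in auto)
    also have "\<dots> = Const 1 * X i j"
      using ij by (intro linform_unit) auto
    finally show "(act m g \<circ> (\<lambda>(i, j). \<Sum>k=1..m. Const (h j $$ (k - 1, i - 1)) * X k j)) v = Var v"
      by (simp add: Const_def)
  qed
  finally show ?thesis by (simp add: peval_Const_Var)
qed

text \<open>Both orders are recorded, each in the shape in which \<open>act_inverse\<close> takes
  it.\<close>

lemma GL_prod_inverse:
  assumes "g \<in> GL_prod m n"
  obtains h where "h \<in> GL_prod m n"
    "\<And>j. j \<in> {1..n} \<Longrightarrow> g j \<in> carrier_mat m m \<and> h j \<in> carrier_mat m m \<and> g j * h j = 1\<^sub>m m"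
    "\<And>j. j \<in> {1..n} \<Longrightarrow> h j \<in> carrier_mat m m \<and> g j \<in> carrier_mat m m \<and> h j * g j = 1\<^sub>m m"
proof -
  have "\<exists>B. B \<in> GL m \<and> g j \<in> carrier_mat m m \<and> g j * B = 1\<^sub>m m \<and> B * g j = 1\<^sub>m m" if "j \<in> {1..n}" for j
  proof -
    have g: "g j \<in> carrier_mat m m" "invertible_mat (g j)"
      using assms that by (auto simp: GL_prod_def GL_def)
    then obtain B where B: "inverts_mat (g j) B" "inverts_mat B (g j)"
      by (auto simp: invertible_mat_def)
    then have 1: "g j * B = 1\<^sub>m m" "B * g j = 1\<^sub>m (dim_row B)"
      using g by (auto simp: inverts_mat_def)
    have "dim_col B = m" "dim_row B = m"
      using arg_cong[OF 1(1), of dim_col] arg_cong[OF 1(2), of dim_col] g by auto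
    then show ?thesis
      using 1 B g by (intro exI[of _ B]) (auto simp: GL_def invertible_mat_def)
  qed
  then obtain h where h: "\<And>j. j \<in> {1..n} \<Longrightarrow> h j \<in> GL m \<and> g j \<in> carrier_mat m m \<and> g j * h j = 1\<^sub>m m \<and> h j * g j = 1\<^sub>m m"
    by metis
  show ?thesis
    by (rule that[of "restrict h {1..n}"]) (use h in \<open>auto simp: GL_prod_def GL_def\<close>)
qed

lemma inj_on_act:
  assumes "g \<in> GL_prod m n"
  shows "inj_on (act m g) (Polys (matrix_vars m n))"
proof -
  obtain h where "h \<in> GL_prod m n"
    "\<And>j. j \<in> {1..n} \<Longrightarrow> h j \<in> carrier_mat m m \<and> g j \<in> carrier_mat m m \<and> h j * g j = 1\<^sub>m m"
    using GL_prod_inverse[OF assms] by blast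
  then show ?thesis
    by (intro inj_on_inverseI[of _ "act m h"] act_inverse) auto
qed

lemma graded_ideal_act:
  fixes I :: "'k::field pol set"
  assumes g: "g \<in> GL_prod m n" and I: "graded_ideal m n I"
  shows "graded_ideal m n (act m g ` I)"
proof -
  obtain h where h: "h \<in> GL_prod m n"
    "\<And>j. j \<in> {1..n} \<Longrightarrow> g j \<in> carrier_mat m m \<and> h j \<in> carrier_mat m m \<and> g j * h j = 1\<^sub>m m"
    using GL_prod_inverse[OF g] by blast
  have "ideal (act m g ` I) (S_ring m n)"
    unfolding ideal_S_ring_iff
  proof safe
    fix p assume "p \<in> I"
    then show "act m g p \<in> Polys (matrix_vars m n)"
      using I by (auto simp: graded_ideal_def ideal_S_ring_iff intro: act_in_Polys)
  next
    show "0 \<in> act m g ` I"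
      using I by (auto simp: graded_ideal_def ideal_S_ring_iff intro!: image_eqI[of _ _ 0])
  next
    fix p q assume "p \<in> I" "q \<in> I"
    then show "act m g p + act m g q \<in> act m g ` I"
      using I by (auto simp: graded_ideal_def ideal_S_ring_iff act_add[symmetric])
  next
    fix p q :: "'k pol" assume p: "p \<in> I" and q: "q \<in> Polys (matrix_vars m n)"
    \<comment> \<open>The multiplier \<open>q\<close> is itself the image of
      \<open>act m h q\<close>, so it can be moved under the action.\<close>
    have "q * act m g p = act m g (act m h q * p)"
      by (simp only: act_mult act_inverse[OF h(2) q])
    then show "q * act m g p \<in> act m g ` I"
      using I p act_in_Polys[OF q, of h] by (auto simp: graded_ideal_def ideal_S_ring_iff)
  qed
  then show ?thesis
    using I by (auto simp: graded_ideal_def act_hom_component[symmetric])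
qed

section \<open>Leading monomials and dimensions\<close>

lemma finite_linear_order_greatest:
  assumes r: "linear_order_on M r" and "finite T" "T \<noteq> {}" "T \<subseteq> M"
  shows "\<exists>t\<in>T. \<forall>s\<in>T. (s, t) \<in> r"
  using assms(2-4)
proof (induction T rule: finite_ne_induct)
  case (singleton x)
  then show ?case using r by (auto simp: order_on_defs refl_on_def)
next
  case (insert x F)
  then obtain t where t: "t \<in> F" "\<forall>s\<in>F. (s, t) \<in> r" by auto
  have "(x, t) \<in> r \<or> (t, x) \<in> r"
    using r insert.prems t(1) insert.hyps by (auto simp: order_on_defs total_on_def refl_on_def)
  moreover have "(x, x) \<in> r" using r insert.prems by (auto simp: order_on_defs refl_on_def)
  moreover have "trans r" using r by (simp add: order_on_defs)
  ultimately show ?case using t by (auto dest: transD)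
qed

lemma lead_monom_eqI:
  assumes "antisym r" "t \<in> Poly_Mapping.keys p" "\<And>s. s \<in> Poly_Mapping.keys p \<Longrightarrow> (s, t) \<in> r"
  shows "lead_monom r p = t"
  unfolding lead_monom_def
  by (rule the_equality) (use assms in \<open>auto dest: antisymD\<close>)

lemma lead_monom_greatest:
  assumes r: "linear_order_on M r" and p: "Poly_Mapping.keys p \<subseteq> M" "p \<noteq> 0"
  shows lead_monom_in_keys: "lead_monom r p \<in> Poly_Mapping.keys p"
    and lead_monom_ge: "s \<in> Poly_Mapping.keys p \<Longrightarrow> (s, lead_monom r p) \<in> r"
proof -
  have "Poly_Mapping.keys p \<noteq> {}" using p(2) by simp
  then obtain t where t: "t \<in> Poly_Mapping.keys p" "\<forall>s\<in>Poly_Mapping.keys p. (s, t) \<in> r"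
    using finite_linear_order_greatest[OF r finite_keys _ p(1)] by blast
  moreover have "antisym r" using r by (simp add: order_on_defs)
  ultimately have "lead_monom r p = t" by (intro lead_monom_eqI) auto
  with t show "lead_monom r p \<in> Poly_Mapping.keys p"
    "s \<in> Poly_Mapping.keys p \<Longrightarrow> (s, lead_monom r p) \<in> r" by auto
qed

definition leads :: "(nat \<times> nat) monom rel \<Rightarrow> 'k::field pol set \<Rightarrow> (nat \<times> nat) monom set" where
  "leads r W = {lead_monom r p |p. p \<in> W \<and> p \<noteq> 0}"

lemma leadsI: "p \<in> W \<Longrightarrow> p \<noteq> 0 \<Longrightarrow> lead_monom r p = t \<Longrightarrow> t \<in> leads r W"
  by (auto simp: leads_def)

lemma leads_subset:
  assumes "linear_order_on M r" "T \<subseteq> M" "W \<subseteq> {p. Poly_Mapping.keys p \<subseteq> T}"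
  shows "leads r W \<subseteq> T"
proof
  fix t assume "t \<in> leads r W"
  then obtain p where "p \<in> W" "p \<noteq> 0" "t = lead_monom r p" by (auto simp: leads_def)
  then show "t \<in> T" using lead_monom_in_keys[OF assms(1), of p] assms(2,3) by auto
qed

text \<open>An echelon basis: choosing one element \<open>b t\<close> for each leading monomial
  \<open>t\<close> gives an independent family, and repeated cancellation of leading terms shows
  that it spans.\<close>

lemma card_leads_eq_dim:
  fixes W :: "'k::field pol set"
  assumes r: "linear_order_on M r" and T: "T \<subseteq> M" "finite T"
    and W: "pol_vs.subspace W" "W \<subseteq> {p. Poly_Mapping.keys p \<subseteq> T}"
  shows "card (leads r W) = pol_vs.dim W"
proof -
  have anti: "antisym r" using r by (simp add: order_on_defs)
  have keysM: "Poly_Mapping.keys p \<subseteq> M" if "p \<in> W" for p using that W(2) T(1) by auto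
  note lead_in = lead_monom_in_keys[OF r keysM] and lead_ge = lead_monom_ge[OF r keysM]
  let ?L = "leads r W"
  have fin: "finite ?L" using leads_subset[OF r T(1) W(2)] T(2) by (rule finite_subset)
  have "\<forall>t\<in>?L. \<exists>p. p \<in> W \<and> p \<noteq> 0 \<and> lead_monom r p = t" by (auto simp: leads_def)
  then obtain b where b: "\<And>t. t \<in> ?L \<Longrightarrow> b t \<in> W \<and> b t \<noteq> 0 \<and> lead_monom r (b t) = t"
    by metis
  have inj: "inj_on b ?L" by (rule inj_onI) (use b in metis)
  have indep: "pol_vs.independent (b ` ?L)"
  proof (rule pol_vs.independent_if_scalars_zero)
    show "finite (b ` ?L)" using fin by simp
    fix f x assume sum0: "(\<Sum>x\<in>b ` ?L. pol_scale (f x) x) = 0" and x: "x \<in> b ` ?L"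
    show "f x = 0"
    proof (rule ccontr)
      assume "f x \<noteq> 0"
      let ?Z = "{t \<in> ?L. f (b t) \<noteq> 0}"
      have "?Z \<noteq> {}" "finite ?Z" "?Z \<subseteq> M"
        using x \<open>f x \<noteq> 0\<close> fin leads_subset[OF r T(1) W(2)] T(1) by auto
      then obtain t where t: "t \<in> ?Z" "\<forall>s\<in>?Z. (s, t) \<in> r"
        using finite_linear_order_greatest[OF r] by blast
      \<comment> \<open>Here \<open>t\<close> is the greatest leading monomial that carries a
        nonzero coefficient. No other summand can contain \<open>t\<close>, so the coefficient of
        \<open>t\<close> in the relation comes from \<open>b t\<close> alone.\<close>
      have other: "f (b s) * Poly_Mapping.lookup (b s) t = 0" if s: "s \<in> ?L" "s \<noteq> t" for s
      proof (rule ccontr)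
        assume "f (b s) * Poly_Mapping.lookup (b s) t \<noteq> 0"
        then have "s \<in> ?Z" "t \<in> Poly_Mapping.keys (b s)" using s by (auto simp: in_keys_iff)
        then have "(s, t) \<in> r" "(t, s) \<in> r" using t(2) lead_ge[of "b s" t] b[OF s(1)] by auto
        then show False using anti s(2) by (auto dest: antisymD)
      qed
      have rest: "(\<Sum>s\<in>?L - {t}. f (b s) * Poly_Mapping.lookup (b s) t) = 0"
      proof (rule sum.neutral, rule ballI)
        fix s assume "s \<in> ?L - {t}"
        then show "f (b s) * Poly_Mapping.lookup (b s) t = 0" by (intro other) auto
      qed
      have "0 = Poly_Mapping.lookup (\<Sum>s\<in>?L. pol_scale (f (b s)) (b s)) t"
        using sum0 by (simp add: sum.reindex[OF inj])
      also have "\<dots> = (\<Sum>s\<in>?L. f (b s) * Poly_Mapping.lookup (b s) t)"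
        by (simp add: lookup_sum lookup_pol_scale)
      also have "\<dots> = f (b t) * Poly_Mapping.lookup (b t) t"
        using t(1) fin rest by (simp add: sum.remove[of ?L t])
      finally show False
        using t(1) b[of t] lead_in[of "b t"] by (auto simp: in_keys_iff)
    qed
  qed
  have "p \<in> pol_vs.span (b ` ?L)" if "p \<in> W" for p
    using that
  \<comment> \<open>The measure counts the monomials of the finite set \<open>T\<close> up to the
    leading one; subtracting a multiple of \<open>b t\<close> strictly lowers it.\<close>
  proof (induction "card {s \<in> T. (s, lead_monom r p) \<in> r}" arbitrary: p rule: less_induct)
    case less
    show ?case
    proof (cases "p = 0")
      case False
      define t where "t = lead_monom r p"
      define c where "c = Poly_Mapping.lookup p t / Poly_Mapping.lookup (b t) t"
      define q where "q = p - pol_scale c (b t)"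
      have t: "t \<in> ?L" using False less.prems by (auto simp: t_def leads_def)
      note bt = b[OF t]
      have nz: "Poly_Mapping.lookup (b t) t \<noteq> 0"
        using lead_in[of "b t"] bt by (auto simp: in_keys_iff)
      have q: "q \<in> W" unfolding q_def
        using W(1) less.prems bt by (intro pol_vs.subspace_diff pol_vs.subspace_scale) auto
      have "Poly_Mapping.lookup q t = 0"
        using nz by (simp add: q_def lookup_minus lookup_pol_scale c_def)
      then have tq: "t \<notin> Poly_Mapping.keys q" by (simp add: in_keys_iff)
      have "q \<in> pol_vs.span (b ` ?L)"
      proof (cases "q = 0")
        case True
        then show ?thesis by (simp add: pol_vs.span_zero)
      next
        case q0: False
        let ?u = "lead_monom r q"
        have u: "?u \<in> Poly_Mapping.keys q" using lead_in[OF q q0] .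
        then have "?u \<in> Poly_Mapping.keys p \<or> ?u \<in> Poly_Mapping.keys (b t)"
          by (auto simp: q_def in_keys_iff lookup_minus lookup_pol_scale)
        then have ut: "(?u, t) \<in> r"
          using lead_ge[OF less.prems False] lead_ge[of "b t"] bt by (auto simp: t_def)
        have "?u \<noteq> t" using u tq by auto
        then have "(t, ?u) \<notin> r" using ut anti by (auto dest: antisymD)
        moreover have "t \<in> T" using t leads_subset[OF r T(1) W(2)] by auto
        moreover have "(t, t) \<in> r" using \<open>t \<in> T\<close> T(1) r by (auto simp: order_on_defs refl_on_def)
        moreover have "trans r" using r by (simp add: order_on_defs)
        ultimately have "{s \<in> T. (s, ?u) \<in> r} \<subset> {s \<in> T. (s, t) \<in> r}"
          using ut by (auto dest: transD)
        then have "card {s \<in> T. (s, ?u) \<in> r} < card {s \<in> T. (s, t) \<in> r}"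
          using T(2) by (intro psubset_card_mono) auto
        then show ?thesis using less.hyps[of q] q by (simp add: t_def)
      qed
      moreover have "p = q + pol_scale c (b t)" by (simp add: q_def)
      ultimately show ?thesis
        using t by (simp add: pol_vs.span_add pol_vs.span_scale pol_vs.span_base)
    qed (simp add: pol_vs.span_zero)
  qed
  then have "pol_vs.dim W = card (b ` ?L)"
    using b indep by (intro pol_vs.dim_unique[of "b ` ?L"]) auto
  then show ?thesis by (simp add: card_image[OF inj])
qed

text \<open>The least element of a fibre of \<open>h\<close> is never leading, since the coefficients over each fibre
  cancel.\<close>

lemma card_leads_fibres:
  fixes W :: "'k::field pol set"
  assumes r: "linear_order_on M r" and T: "T \<subseteq> M" "finite T"
    and W: "W \<subseteq> {p. Poly_Mapping.keys p \<subseteq> T}"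
    and fib: "\<And>p y. p \<in> W \<Longrightarrow> (\<Sum>t | t \<in> Poly_Mapping.keys p \<and> h t = y. Poly_Mapping.lookup p t) = 0"
  shows "card (leads r W) + card (h ` T) \<le> card T"
proof -
  have anti: "antisym r" using r by (simp add: order_on_defs)
  have r': "linear_order_on M (r\<inverse>)" using r by simp
  have "\<exists>t\<in>{t \<in> T. h t = y}. \<forall>s\<in>{t \<in> T. h t = y}. (s, t) \<in> r\<inverse>" if "y \<in> h ` T" for y
    by (rule finite_linear_order_greatest[OF r']) (use that T in auto)
  then obtain l where l: "\<And>y. y \<in> h ` T \<Longrightarrow> l y \<in> T \<and> h (l y) = y \<and> (\<forall>s\<in>T. h s = y \<longrightarrow> (l y, s) \<in> r)"
    by (simp add: Bex_def) metis
  have inj: "inj_on l (h ` T)" by (rule inj_onI) (use l in metis)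
  have "leads r W \<inter> l ` h ` T = {}"
  proof (rule ccontr)
    assume "leads r W \<inter> l ` h ` T \<noteq> {}"
    then obtain p y where p: "p \<in> W" "p \<noteq> 0" and y: "y \<in> h ` T" and eq: "lead_monom r p = l y"
      unfolding leads_def by force
    have keys: "Poly_Mapping.keys p \<subseteq> T" using p(1) W by auto
    then have keysM: "Poly_Mapping.keys p \<subseteq> M" using T(1) by auto
    have ly: "l y \<in> Poly_Mapping.keys p" using lead_monom_in_keys[OF r keysM p(2)] eq by simp
    have "{t. t \<in> Poly_Mapping.keys p \<and> h t = y} = {l y}"
    proof safe
      fix t assume t: "t \<in> Poly_Mapping.keys p" "y = h t"
      have "(t, l y) \<in> r" using lead_monom_ge[OF r keysM p(2) t(1)] eq by simp
      moreover have "(l y, t) \<in> r" using l[OF y] t keys by auto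
      ultimately show "t = l (h t)" using anti t(2) by (auto dest: antisymD)
    qed (use ly l[OF y] in auto)
    with fib[OF p(1), of y] ly show False by (simp add: in_keys_iff)
  qed
  moreover have "leads r W \<union> l ` h ` T \<subseteq> T" using leads_subset[OF r T(1) W] l by auto
  ultimately have "card (leads r W) + card (l ` h ` T) \<le> card T"
    using T(2) by (metis card_Un_disjoint card_mono finite_Un finite_subset)
  then show ?thesis by (simp add: card_image[OF inj])
qed

lemma dim_act:
  fixes W :: "'k::field pol set"
  assumes g: "g \<in> GL_prod m n" and W: "pol_vs.subspace W" "W \<subseteq> Polys (matrix_vars m n)"
  shows "pol_vs.dim (act m g ` W) = pol_vs.dim W"
proof -
  interpret A: Vector_Spaces.linear pol_scale pol_scale "act m g :: 'k pol \<Rightarrow> 'k pol"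
    by unfold_locales (simp_all add: act_add act_scale)
  obtain B where B: "B \<subseteq> W" "pol_vs.independent B" "W \<subseteq> pol_vs.span B" "card B = pol_vs.dim W"
    using pol_vs.basis_exists by blast
  have "pol_vs.span B \<subseteq> W" using B(1) W(1) by (rule pol_vs.span_minimal)
  with B(3) have span: "pol_vs.span B = W" by auto
  have inj: "inj_on (act m g) W" using inj_on_act[OF g] W(2) by (rule inj_on_subset)
  have "pol_vs.independent (act m g ` B)"
    using A.independent_injective_image[OF B(2)] inj span by simp
  then have "card (act m g ` B) = pol_vs.dim (act m g ` W)"
    using B(1) by (intro pol_vs.basis_card_eq_dim) (auto simp: A.span_image span)
  then show ?thesis using B(1,4) card_image[OF inj_on_subset[OF inj B(1)]] by simp
qed

lemma graded_piece_act:
  fixes I :: "'k::field pol set"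
  assumes g: "g \<in> GL_prod m n" and I: "I \<subseteq> Polys (matrix_vars m n)"
  shows "graded_piece (act m g ` I) a = act m g ` graded_piece I a"
proof -
  obtain h where h: "h \<in> GL_prod m n"
    "\<And>j. j \<in> {1..n} \<Longrightarrow> h j \<in> carrier_mat m m \<and> g j \<in> carrier_mat m m \<and> h j * g j = 1\<^sub>m m"
    using GL_prod_inverse[OF g] by blast
  have "p \<in> homogeneous a" if "p \<in> I" "act m g p \<in> homogeneous a" for p
    using act_homogeneous[OF that(2), where m = m and g = h] act_inverse[OF h(2), where p = p] that(1) I by auto
  then show ?thesis
    by (auto simp: graded_piece_eq intro: act_homogeneous)
qed

section \<open>Counting standard monomials\<close>

definition adjacent :: "nat set set \<Rightarrow> nat set \<Rightarrow> (nat \<times> nat) set" where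
  "adjacent E A = {(a, b). {a, b} \<in> induced_edges E A}"

definition component :: "nat set set \<Rightarrow> nat set \<Rightarrow> nat \<Rightarrow> nat set" where
  "component E A j = {k. (j, k) \<in> (adjacent E A)\<^sup>*}"

lemma sym_adjacent: "sym (adjacent E A)"
  by (auto simp: sym_def adjacent_def insert_commute)

lemma adjacent_rtrancl_sym: "(a, b) \<in> (adjacent E A)\<^sup>* \<Longrightarrow> (b, a) \<in> (adjacent E A)\<^sup>*"
  using sym_rtrancl[OF sym_adjacent] by (auto dest: symD)

lemma component_refl: "j \<in> component E A j"
  by (simp add: component_def)

lemma component_eq: "k \<in> component E A j \<Longrightarrow> component E A k = component E A j"
  by (auto simp: component_def dest: adjacent_rtrancl_sym intro: rtrancl_trans)

lemma component_eq_iff: "component E A k = component E A j \<longleftrightarrow> k \<in> component E A j"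
  using component_eq component_refl by blast

lemma component_subset:
  assumes "j \<in> A"
  shows "component E A j \<subseteq> A"
proof
  fix k assume "k \<in> component E A j"
  then have "(j, k) \<in> (adjacent E A)\<^sup>*" by (simp add: component_def)
  then show "k \<in> A"
    by (induction) (use assms in \<open>auto simp: adjacent_def induced_edges_def\<close>)
qed

text \<open>Every vertex on a path starting at \<open>j\<close> lies in the component, so the path
  survives in the graph induced on the component.\<close>

lemma connected_component:
  assumes "j \<in> A"
  shows "connected_graph (component E A j) (induced_edges E (component E A j))"
proof -
  let ?C = "component E A j"
  have path: "(j, k) \<in> (adjacent E ?C)\<^sup>*" if "k \<in> ?C" for k
  proof -
    have "(j, k) \<in> (adjacent E A)\<^sup>*" using that by (simp add: component_def)
    then show ?thesis
    proof (induction rule: rtrancl_induct)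
      case (step y z)
      then have "y \<in> ?C" "z \<in> ?C" by (auto simp: component_def)
      then have "(y, z) \<in> adjacent E ?C"
        using step.hyps(2) by (auto simp: adjacent_def induced_edges_def)
      with step.IH show ?case by (rule rtrancl_into_rtrancl)
    qed simp
  qed
  have "(u, v) \<in> (adjacent E ?C)\<^sup>*" if "u \<in> ?C" "v \<in> ?C" for u v
    using path[OF that(1), THEN adjacent_rtrancl_sym] path[OF that(2)] by (rule rtrancl_trans)
  then show ?thesis
    using component_refl[of j E A] by (auto simp: connected_graph_def adjacent_def)
qed

section \<open>Monomials of a fixed multidegree\<close>

definition monoms_of_degree :: "nat \<Rightarrow> nat \<Rightarrow> (nat \<Rightarrow>\<^sub>0 nat) \<Rightarrow> (nat \<times> nat) monom set" where
  "monoms_of_degree m n a = {t \<in> Monoms (matrix_vars m n). multideg t = a}"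

lemma lookup_multideg:
  assumes "t \<in> Monoms (matrix_vars m n)" "j \<in> {1..n}"
  shows "Poly_Mapping.lookup (multideg t) j = (\<Sum>i=1..m. Poly_Mapping.lookup t (i, j))"
proof -
  have "Poly_Mapping.lookup (multideg t) j =
      (\<Sum>v | v \<in> matrix_vars m n \<and> snd v = j. Poly_Mapping.lookup t v)"
    unfolding multideg_eq by (rule lookup_push_forward) (use assms in \<open>auto simp: Monoms_def matrix_vars_def\<close>)
  also have "{v. v \<in> matrix_vars m n \<and> snd v = j} = (\<lambda>i. (i, j)) ` {1..m}"
    using assms(2) by (auto simp: matrix_vars_def)
  also have "(\<Sum>v\<in>(\<lambda>i. (i, j)) ` {1..m}. Poly_Mapping.lookup t v) = (\<Sum>i=1..m. Poly_Mapping.lookup t (i, j))"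
    by (subst sum.reindex) (auto simp: inj_on_def)
  finally show ?thesis .
qed

lemma keys_multideg:
  assumes "(i, j) \<in> Poly_Mapping.keys t"
  shows "j \<in> Poly_Mapping.keys (multideg t)"
proof -
  have "Poly_Mapping.lookup t (i, j) \<le> (\<Sum>v | v \<in> Poly_Mapping.keys t \<and> snd v = j. Poly_Mapping.lookup t v)"
    by (rule member_le_sum) (use assms in auto)
  also have "\<dots> = Poly_Mapping.lookup (multideg t) j"
    unfolding multideg_eq by (rule lookup_push_forward[symmetric]) auto
  finally show ?thesis using assms by (auto simp: in_keys_iff)
qed

lemma keys_multideg_obtain:
  assumes "j \<in> Poly_Mapping.keys (multideg t)"
  obtains i where "(i, j) \<in> Poly_Mapping.keys t"
proof -
  have "Poly_Mapping.lookup (multideg t) j = (\<Sum>v | v \<in> Poly_Mapping.keys t \<and> snd v = j. Poly_Mapping.lookup t v)"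
    unfolding multideg_eq by (rule lookup_push_forward) auto
  also have "\<dots> \<noteq> 0" using assms calculation by (simp add: in_keys_iff)
  ultimately obtain v where "v \<in> Poly_Mapping.keys t" "snd v = j"
    by (metis (mono_tags, lifting) mem_Collect_eq sum.neutral)
  then show ?thesis using that[of "fst v"] by auto
qed

lemma finite_monoms_of_degree: "finite (monoms_of_degree m n a)"
proof -
  let ?N = "\<Sum>j\<in>Poly_Mapping.keys a. Poly_Mapping.lookup a j"
  have "Poly_Mapping.lookup ` monoms_of_degree m n a
      \<subseteq> {f. \<forall>v. (v \<in> matrix_vars m n \<longrightarrow> f v \<in> {..?N}) \<and> (v \<notin> matrix_vars m n \<longrightarrow> f v = 0)}"
  proof (rule image_subsetI, rule CollectI, intro allI conjI impI)
    fix t v assume t: "t \<in> monoms_of_degree m n a" and v: "v \<in> matrix_vars m n"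
    obtain i j where [simp]: "v = (i, j)" by force
    have ij: "(i, j) \<in> matrix_vars m n" using v by simp
    have "Poly_Mapping.lookup t (i, j) \<le> ?N"
    proof (cases "Poly_Mapping.lookup t (i, j) = 0")
      case False
      then have "j \<in> Poly_Mapping.keys a"
        using t keys_multideg[of i j t] by (simp add: monoms_of_degree_def in_keys_iff)
      have "Poly_Mapping.lookup t (i, j) \<le> (\<Sum>i=1..m. Poly_Mapping.lookup t (i, j))"
        using member_le_sum[of i "{1..m}" "\<lambda>i. Poly_Mapping.lookup t (i, j)"] ij
        by (simp add: matrix_vars_def)
      also have "\<dots> = Poly_Mapping.lookup a j"
        using t ij lookup_multideg[of t m n j] by (simp add: monoms_of_degree_def matrix_vars_def)
      also have "\<dots> \<le> ?N"
        using member_le_sum[of j "Poly_Mapping.keys a" "Poly_Mapping.lookup a"] \<open>j \<in> Poly_Mapping.keys a\<close>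
        by simp
      finally show ?thesis .
    qed simp
    then show "Poly_Mapping.lookup t v \<in> {..?N}" by simp
  next
    fix t v assume "t \<in> monoms_of_degree m n a" "v \<notin> matrix_vars m n"
    then have "v \<notin> Poly_Mapping.keys t" unfolding monoms_of_degree_def Monoms_def by blast
    then show "Poly_Mapping.lookup t v = 0" by (simp add: in_keys_iff)
  qed
  moreover have "finite {f. \<forall>v. (v \<in> matrix_vars m n \<longrightarrow> f v \<in> {..?N}) \<and> (v \<notin> matrix_vars m n \<longrightarrow> f v = 0)}"
    by (intro finite_set_of_finite_funs finite_atMost) (simp add: matrix_vars_def)
  ultimately have "finite (Poly_Mapping.lookup ` monoms_of_degree m n a)"
    by (rule finite_subset)
  then show ?thesis
    by (rule finite_imageD) (rule inj_onI, simp add: lookup_inject)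
qed

section \<open>Shifting the columns of a component\<close>

definition top_row :: "(nat \<times> nat) monom \<Rightarrow> nat \<Rightarrow> nat" where
  "top_row t j = Min {i. (i, j) \<in> Poly_Mapping.keys t}"

lemma finite_rows: "finite {i. (i, j) \<in> Poly_Mapping.keys t}"
  by (rule finite_subset[of _ "fst ` Poly_Mapping.keys t"]) (auto intro: rev_image_eqI)

lemma top_row_in:
  assumes "j \<in> Poly_Mapping.keys (multideg t)"
  shows "(top_row t j, j) \<in> Poly_Mapping.keys t"
proof -
  obtain i where "(i, j) \<in> Poly_Mapping.keys t" using keys_multideg_obtain[OF assms] .
  then have "top_row t j \<in> {i. (i, j) \<in> Poly_Mapping.keys t}"
    unfolding top_row_def using finite_rows by (intro Min_in) auto
  then show ?thesis by simp
qed

lemma top_row_le: "(i, j) \<in> Poly_Mapping.keys t \<Longrightarrow> top_row t j \<le> i"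
  unfolding top_row_def using finite_rows by (intro Min_le) auto

text \<open>Moving column \<open>j\<close> up by \<open>offset\<close> rows makes the rows used by the columns of a component,
  taken from left to right, weakly decreasing, so that they can be recovered from their union.\<close>

definition offset :: "nat \<Rightarrow> nat set set \<Rightarrow> nat set \<Rightarrow> (nat \<times> nat) monom \<Rightarrow> nat \<Rightarrow> nat" where
  "offset m E A t j = (\<Sum>l | l \<in> component E A j \<and> l < j. m - top_row t l)"

text \<open>For a component \<open>C\<close> the inequality says that the top rows add up to more
  than \<open>m (|C| - 1)\<close>: the product of the topmost entries of \<open>C\<close> just fails
  to be a generator of \<open>J\<close>. Only whole components of the support are tested.\<close>

definition standard_monoms :: "nat \<Rightarrow> nat \<Rightarrow> nat set set \<Rightarrow> (nat \<Rightarrow>\<^sub>0 nat) \<Rightarrow> (nat \<times> nat) monom set" where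
  "standard_monoms m n E a = {t \<in> monoms_of_degree m n a.
     \<forall>j\<in>Poly_Mapping.keys a. (\<Sum>l\<in>component E (Poly_Mapping.keys a) j. m - top_row t l) < m}"

lemma offset_add_le:
  assumes "j \<in> A" "finite A"
  shows "offset m E A t j + (m - top_row t j) \<le> (\<Sum>l\<in>component E A j. m - top_row t l)"
proof -
  have fin: "finite (component E A j)" using component_subset[OF assms(1)] assms(2) by (rule finite_subset)
  have "offset m E A t j + (m - top_row t j) = (\<Sum>l\<in>insert j {l \<in> component E A j. l < j}. m - top_row t l)"
    unfolding offset_def using fin by (subst sum.insert) auto
  also have "\<dots> \<le> (\<Sum>l\<in>component E A j. m - top_row t l)"
    by (rule sum_mono2) (use fin component_refl in auto)
  finally show ?thesis .
qed

text \<open>After the shift, column \<open>k\<close> lies in rows up to \<open>m - offset k\<close>,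
  and column \<open>j\<close> starts at row \<open>top_row t j - offset j\<close>. The inequality
  puts the former bound at or above the latter row, which is the ordering of the shifted
  columns.\<close>

lemma offset_mono:
  assumes "j \<in> A" "finite A" "k \<in> component E A j" "j < k"
  shows "offset m E A t j + (m - top_row t j) \<le> offset m E A t k"
proof -
  have fin: "finite (component E A j)" using component_subset[OF assms(1)] assms(2) by (rule finite_subset)
  have "offset m E A t j + (m - top_row t j) = (\<Sum>l\<in>insert j {l \<in> component E A j. l < j}. m - top_row t l)"
    unfolding offset_def using fin by (subst sum.insert) auto
  also have "\<dots> \<le> (\<Sum>l\<in>{l \<in> component E A j. l < k}. m - top_row t l)"
    by (rule sum_mono2) (use fin component_refl assms(4) in auto)
  also have "\<dots> = offset m E A t k"
    by (simp add: offset_def component_eq[OF assms(3)])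
  finally show ?thesis .
qed

text \<open>Hence the subtraction in \<open>column_shift\<close> is never truncated, and shifted
  entries stay in rows from 1 on. This is where standardness enters.\<close>

lemma offset_less_row:
  assumes t: "t \<in> standard_monoms m n E a" and ij: "(i, j) \<in> Poly_Mapping.keys t"
  shows "offset m E (Poly_Mapping.keys a) t j < i"
proof -
  have a: "multideg t = a" and tm: "t \<in> Monoms (matrix_vars m n)"
    using t by (auto simp: standard_monoms_def monoms_of_degree_def)
  have j: "j \<in> Poly_Mapping.keys a" using keys_multideg[OF ij] a by simp
  have "offset m E (Poly_Mapping.keys a) t j + (m - top_row t j) < m"
    using offset_add_le[OF j finite_keys, of m E t] t j by (force simp: standard_monoms_def)
  moreover have "top_row t j \<le> i" using top_row_le[OF ij] .
  ultimately show ?thesis by linarith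
qed

definition column_shift :: "nat \<Rightarrow> nat set set \<Rightarrow> nat set \<Rightarrow> (nat \<times> nat) monom \<Rightarrow> (nat \<times> nat) monom" where
  "column_shift m E A t = push_forward (\<lambda>(i, j). (i - offset m E A t j, j)) t"

text \<open>The effect on exponents of identifying the columns of each component; its fibres are
  those along which coefficients of elements of the ideal cancel.\<close>

definition merge_columns :: "nat set set \<Rightarrow> nat set \<Rightarrow> (nat \<times> nat) monom \<Rightarrow> (nat \<times> nat set) monom" where
  "merge_columns E A = push_forward (\<lambda>(i, j). (i, component E A j))"

lemma push_forward_in_Monoms:
  assumes "\<And>v. v \<in> Poly_Mapping.keys t \<Longrightarrow> h v \<in> V"
  shows "push_forward h t \<in> Monoms V"
  unfolding push_forward_def by (intro Monoms_sum Monoms_single assms)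

lemma column_shift_degree:
  assumes t: "t \<in> standard_monoms m n E a"
  shows "column_shift m E (Poly_Mapping.keys a) t \<in> monoms_of_degree m n a"
proof -
  have a: "multideg t = a" and tm: "t \<in> Monoms (matrix_vars m n)"
    using t by (auto simp: standard_monoms_def monoms_of_degree_def)
  have "multideg (column_shift m E (Poly_Mapping.keys a) t) = push_forward snd t"
    by (simp add: column_shift_def multideg_eq push_forward_compose comp_def case_prod_beta)
  moreover have "column_shift m E (Poly_Mapping.keys a) t \<in> Monoms (matrix_vars m n)"
    unfolding column_shift_def
  proof (rule push_forward_in_Monoms)
    fix v assume v: "v \<in> Poly_Mapping.keys t"
    obtain i j where [simp]: "v = (i, j)" by force
    have "(i, j) \<in> matrix_vars m n" using v tm by (auto simp: Monoms_def)
    then show "(case v of (i, j) \<Rightarrow> (i - offset m E (Poly_Mapping.keys a) t j, j)) \<in> matrix_vars m n"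
      using offset_less_row[OF t, of i j] v by (auto simp: matrix_vars_def)
  qed
  ultimately show ?thesis using a by (simp add: monoms_of_degree_def multideg_eq)
qed

text \<open>Degree of \<open>t\<close> in the entries of column \<open>j\<close> from row
  \<open>c\<close> downwards. Tails are used in place of single exponents because a column can be
  cut out of a merged tail by a minimum.\<close>

definition column_tail :: "nat \<Rightarrow> (nat \<times> nat) monom \<Rightarrow> nat \<Rightarrow> nat \<Rightarrow> nat" where
  "column_tail m t j c = (\<Sum>i=c..m. Poly_Mapping.lookup t (i, j))"

lemma lookup_eq_column_tail:
  assumes "i \<le> m"
  shows "Poly_Mapping.lookup t (i, j) + column_tail m t j (Suc i) = column_tail m t j i"
  unfolding column_tail_def by (rule sum.atLeast_Suc_atMost[OF assms, symmetric])

lemma column_tail_le: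
  assumes "t \<in> monoms_of_degree m n a" "j \<in> {1..n}" "1 \<le> c"
  shows "column_tail m t j c \<le> Poly_Mapping.lookup a j"
proof -
  have "column_tail m t j c \<le> (\<Sum>i=1..m. Poly_Mapping.lookup t (i, j))"
    unfolding column_tail_def by (rule sum_mono2) (use assms(3) in auto)
  then show ?thesis using assms lookup_multideg[of t m n j] by (auto simp: monoms_of_degree_def)
qed

lemma column_tail_full:
  assumes "t \<in> monoms_of_degree m n a" "j \<in> {1..n}" "1 \<le> c" "c \<le> top_row t j"
  shows "column_tail m t j c = Poly_Mapping.lookup a j"
proof -
  have "column_tail m t j c = (\<Sum>i=1..m. Poly_Mapping.lookup t (i, j))"
    unfolding column_tail_def
  proof (rule sum.mono_neutral_left)
    show "\<forall>i\<in>{1..m} - {c..m}. Poly_Mapping.lookup t (i, j) = 0"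
      using top_row_le[of _ j t] assms(4) by (force simp: in_keys_iff)
  qed (use assms(3) in auto)
  then show ?thesis using assms lookup_multideg[of t m n j] by (auto simp: monoms_of_degree_def)
qed

lemma column_tail_zero:
  assumes "m < c"
  shows "column_tail m t j c = 0"
  using assms by (simp add: column_tail_def)

text \<open>An entry in row \<open>i\<close> of column \<open>l\<close> lands in row
  \<open>i - offset l\<close>, so it is counted from row \<open>c\<close> on exactly if
  \<open>i\<close> is at least \<open>c + offset l\<close>.\<close>

lemma merge_shift_tail:
  assumes t: "t \<in> standard_monoms m n E a" and j: "j \<in> Poly_Mapping.keys a" and c: "1 \<le> c"
  defines "A \<equiv> Poly_Mapping.keys a"
  shows "(\<Sum>i=c..m. Poly_Mapping.lookup (merge_columns E A (column_shift m E A t)) (i, component E A j))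
    = (\<Sum>l\<in>component E A j. column_tail m t l (c + offset m E A t l))"
proof -
  let ?C = "component E A j" and ?o = "offset m E A t"
  have a: "multideg t = a" and tm: "Poly_Mapping.keys t \<subseteq> matrix_vars m n"
    using t by (auto simp: standard_monoms_def monoms_of_degree_def Monoms_def)
  have fin: "finite ?C" using component_subset[OF j, of E] unfolding A_def by (rule finite_subset) simp
  have eq: "merge_columns E A (column_shift m E A t) = push_forward (\<lambda>(i, l). (i - ?o l, component E A l)) t"
    by (simp add: merge_columns_def column_shift_def push_forward_compose comp_def case_prod_unfold)
  have "(\<Sum>i=c..m. Poly_Mapping.lookup (merge_columns E A (column_shift m E A t)) (i, ?C))
      = (\<Sum>i\<in>{c..m}. \<Sum>v\<in>{v \<in> Poly_Mapping.keys t. (\<lambda>(i, l). (i - ?o l, component E A l)) v = (i, ?C)}. Poly_Mapping.lookup t v)"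
    unfolding eq by (intro sum.cong refl) (simp add: lookup_push_forward[OF finite_keys subset_refl])
  also have "\<dots> = (\<Sum>v\<in>(\<Union>i\<in>{c..m}. {v \<in> Poly_Mapping.keys t. (\<lambda>(i, l). (i - ?o l, component E A l)) v = (i, ?C)}). Poly_Mapping.lookup t v)"
    by (rule sum.UNION_disjoint[symmetric]) auto
  also have "(\<Union>i\<in>{c..m}. {v \<in> Poly_Mapping.keys t. (\<lambda>(i, l). (i - ?o l, component E A l)) v = (i, ?C)})
      = {v \<in> Poly_Mapping.keys t. snd v \<in> ?C \<and> c + ?o (snd v) \<le> fst v}" (is "?L = ?R")
  proof (rule Set.set_eqI, rule iffI)
    fix v assume v: "v \<in> ?L"
    obtain i l where [simp]: "v = (i, l)" by force
    from v have "(i, l) \<in> Poly_Mapping.keys t" "c \<le> i - ?o l" "component E A l = ?C" by auto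
    \<comment> \<open>As \<open>c\<close> is at least 1, the natural subtraction in
      \<open>c \<le> i - ?o l\<close> cannot have been truncated.\<close>
    then show "v \<in> ?R" using c by (simp add: component_eq_iff)
  next
    fix v assume v: "v \<in> ?R"
    obtain i l where [simp]: "v = (i, l)" by force
    have "i \<le> m" using v tm by (auto simp: matrix_vars_def)
    then have "i - ?o l \<in> {c..m}" using v by auto
    moreover have "component E A l = ?C" using v by (simp add: component_eq_iff)
    ultimately show "v \<in> ?L" using v by auto
  qed
  \<comment> \<open>Passing to all pairs of a column of the component and a row in range adds only
    variables with exponent 0.\<close>
  also have "(\<Sum>v\<in>?R. Poly_Mapping.lookup t v) = (\<Sum>v\<in>(\<lambda>(l, i). (i, l)) ` (SIGMA l:?C. {c + ?o l..m}). Poly_Mapping.lookup t v)"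
  proof (rule sum.mono_neutral_left)
    show "finite ((\<lambda>(l, i). (i, l)) ` (SIGMA l:?C. {c + ?o l..m}))" using fin by auto
    show "?R \<subseteq> (\<lambda>(l, i). (i, l)) ` (SIGMA l:?C. {c + ?o l..m})"
      using tm by (force simp: matrix_vars_def)
    show "\<forall>v\<in>(\<lambda>(l, i). (i, l)) ` (SIGMA l:?C. {c + ?o l..m}) - ?R. Poly_Mapping.lookup t v = 0"
      by (auto simp: in_keys_iff)
  qed
  also have "\<dots> = (\<Sum>(l, i)\<in>(SIGMA l:?C. {c + ?o l..m}). Poly_Mapping.lookup t (i, l))"
    by (subst sum.reindex) (auto simp: inj_on_def case_prod_beta intro!: sum.cong)
  also have "\<dots> = (\<Sum>l\<in>?C. column_tail m t l (c + ?o l))"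
    unfolding column_tail_def using fin by (subst sum.Sigma) auto
  finally show ?thesis .
qed

text \<open>If the threshold is at or above the top entry of column \<open>j\<close>, the whole
  column is counted and the sum is at least its degree. Otherwise the later columns, shifted past
  it, contribute nothing, and the sum is the tail of column \<open>j\<close> alone.\<close>

lemma column_tail_min:
  assumes t: "t \<in> standard_monoms m n E a" and j: "j \<in> Poly_Mapping.keys a" "j \<in> {1..n}" and c: "1 \<le> c"
  defines "A \<equiv> Poly_Mapping.keys a"
  shows "column_tail m t j (c + offset m E A t j) = min (Poly_Mapping.lookup a j)
    (\<Sum>l\<in>{l \<in> component E A j. j \<le> l}. column_tail m t l (c + offset m E A t l))"
proof -
  let ?C = "component E A j" and ?o = "offset m E A t"
  have td: "t \<in> monoms_of_degree m n a" using t by (simp add: standard_monoms_def)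
  then have a: "multideg t = a" by (simp add: monoms_of_degree_def)
  have jA: "j \<in> A" using j by (simp add: A_def)
  have finA: "finite A" by (simp add: A_def)
  have fin: "finite ?C" using component_subset[OF jA] finA by (rule finite_subset)
  have "{l \<in> ?C. j \<le> l} = insert j {l \<in> ?C. j < l}"
    using component_refl[of j E A] by auto
  then have split: "(\<Sum>l\<in>{l \<in> ?C. j \<le> l}. column_tail m t l (c + ?o l))
      = column_tail m t j (c + ?o j) + (\<Sum>l\<in>{l \<in> ?C. j < l}. column_tail m t l (c + ?o l))"
    using fin by simp
  have le: "column_tail m t j (c + ?o j) \<le> Poly_Mapping.lookup a j"
    using column_tail_le[OF td j(2), of "c + ?o j"] c by simp
  show ?thesis
  proof (cases "c + ?o j \<le> top_row t j")
    case True
    then have "column_tail m t j (c + ?o j) = Poly_Mapping.lookup a j"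
      using column_tail_full[OF td j(2), of "c + ?o j"] c by simp
    with split show ?thesis by simp
  next
    case False
    have "(\<Sum>l\<in>{l \<in> ?C. j < l}. column_tail m t l (c + ?o l)) = 0"
    proof (rule sum.neutral, safe)
      fix l assume l: "l \<in> ?C" "j < l"
      have "m - top_row t j + ?o j \<le> ?o l"
        using offset_mono[OF jA finA l, of m t] by simp
      then have "m < c + ?o l" using False by linarith
      then show "column_tail m t l (c + ?o l) = 0" by (rule column_tail_zero)
    qed
    with split le show ?thesis by simp
  qed
qed

text \<open>Decoding from left to right within a component. The columns before \<open>j\<close>
  determine the offset of \<open>j\<close> and their own share of the merged tails. Subtracting this
  share and taking the minimum with the degree of column \<open>j\<close> leaves its tails, whose
  differences are the exponents.\<close>

lemma merge_shift_inj_on: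
  assumes keys: "Poly_Mapping.keys a \<subseteq> {1..n}"
  defines "A \<equiv> Poly_Mapping.keys a"
  shows "inj_on (\<lambda>t. merge_columns E A (column_shift m E A t)) (standard_monoms m n E a)"
proof (rule inj_onI)
  fix t u assume t: "t \<in> standard_monoms m n E a" and u: "u \<in> standard_monoms m n E a"
    and eq: "merge_columns E A (column_shift m E A t) = merge_columns E A (column_shift m E A u)"
  have mdeg: "multideg t = a" "multideg u = a" and
    M: "Poly_Mapping.keys t \<subseteq> matrix_vars m n" "Poly_Mapping.keys u \<subseteq> matrix_vars m n"
    using t u by (auto simp: standard_monoms_def monoms_of_degree_def Monoms_def)
  have col: "\<forall>i. Poly_Mapping.lookup t (i, j) = Poly_Mapping.lookup u (i, j)" if "j \<in> A" for j
    using that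
  proof (induction j rule: less_induct)
    case (less j)
    let ?C = "component E A j"
    have jn: "j \<in> {1..n}" "j \<in> Poly_Mapping.keys a" using less.prems keys by (auto simp: A_def)
    have finA: "finite A" by (simp add: A_def)
    have fin: "finite ?C" using component_subset[OF less.prems] finA by (rule finite_subset)
    have IH: "Poly_Mapping.lookup t (i, l) = Poly_Mapping.lookup u (i, l)" if "l \<in> ?C" "l < j" for i l
      using less.IH[OF that(2)] component_subset[OF less.prems, of E] that(1) by auto
    then have top: "top_row t l = top_row u l" if "l \<in> ?C" "l < j" for l
      using that by (simp add: top_row_def in_keys_iff)
    \<comment> \<open>The offset of a column up to \<open>j\<close> involves the top rows of columns
      before \<open>j\<close> only, where the two monomials agree by induction.\<close>
    have off: "offset m E A t l = offset m E A u l" if "l \<in> ?C" "l \<le> j" for l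
      unfolding offset_def component_eq[OF that(1)]
      by (rule sum.cong) (use top that(2) in auto)
    let ?o = "offset m E A t j"
    have tail: "column_tail m t j (c + ?o) = column_tail m u j (c + ?o)" if c: "1 \<le> c" for c
    proof -
      have "{l \<in> ?C. l < j} \<inter> {l \<in> ?C. j \<le> l} = {}" "{l \<in> ?C. l < j} \<union> {l \<in> ?C. j \<le> l} = ?C"
        by auto
      then have split: "(\<Sum>l\<in>?C. f l) = (\<Sum>l\<in>{l \<in> ?C. l < j}. f l) + (\<Sum>l\<in>{l \<in> ?C. j \<le> l}. f l)" for f :: "nat \<Rightarrow> nat"
        using sum.union_disjoint[of "{l \<in> ?C. l < j}" "{l \<in> ?C. j \<le> l}" f] fin by simp
      have "(\<Sum>l\<in>?C. column_tail m t l (c + offset m E A t l)) = (\<Sum>l\<in>?C. column_tail m u l (c + offset m E A u l))"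
        using merge_shift_tail[OF t jn(2) c] merge_shift_tail[OF u jn(2) c] eq by (simp add: A_def)
      moreover have "(\<Sum>l\<in>{l \<in> ?C. l < j}. column_tail m t l (c + offset m E A t l)) = (\<Sum>l\<in>{l \<in> ?C. l < j}. column_tail m u l (c + offset m E A u l))"
        by (rule sum.cong) (auto simp: column_tail_def off IH)
      ultimately have "(\<Sum>l\<in>{l \<in> ?C. j \<le> l}. column_tail m t l (c + offset m E A t l)) = (\<Sum>l\<in>{l \<in> ?C. j \<le> l}. column_tail m u l (c + offset m E A u l))"
        by (simp add: split)
      then show ?thesis
        using column_tail_min[OF t jn(2,1) c] column_tail_min[OF u jn(2,1) c] off[of j] component_refl[of j E A]
        by (simp add: A_def)
    qed
    show ?case
    proof
      fix i
      \<comment> \<open>The tails recovered above start below the offset; the rows up to the offset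
        are empty in a standard monomial.\<close>
      have low: "Poly_Mapping.lookup t (i, j) = 0" "Poly_Mapping.lookup u (i, j) = 0" if "i \<le> ?o"
        using offset_less_row[OF t, of i j] offset_less_row[OF u, of i j] off[of j] component_refl[of j E A] that
        by (auto simp: A_def in_keys_iff)
      have high: "Poly_Mapping.lookup t (i, j) = 0" "Poly_Mapping.lookup u (i, j) = 0" if "m < i"
        using M that by (auto simp: in_keys_iff matrix_vars_def)
      consider "i \<le> ?o" | "m < i" | "?o < i" "i \<le> m" by linarith
      then show "Poly_Mapping.lookup t (i, j) = Poly_Mapping.lookup u (i, j)"
      proof cases
        case 3
        then have "column_tail m t j i = column_tail m u j i" "column_tail m t j (Suc i) = column_tail m u j (Suc i)"
          using tail[of "i - ?o"] tail[of "Suc i - ?o"] by auto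
        then show ?thesis
          using lookup_eq_column_tail[OF 3(2), of t j] lookup_eq_column_tail[OF 3(2), of u j] by simp
      qed (simp_all add: low high)
    qed
  qed
  show "t = u"
  proof (rule poly_mapping_eqI)
    fix v :: "nat \<times> nat"
    obtain i j where [simp]: "v = (i, j)" by force
    show "Poly_Mapping.lookup t v = Poly_Mapping.lookup u v"
    proof (cases "j \<in> A")
      case False
      then have "(i, j) \<notin> Poly_Mapping.keys t" "(i, j) \<notin> Poly_Mapping.keys u"
        using keys_multideg[of i j t] keys_multideg[of i j u] mdeg by (auto simp: A_def)
      then show ?thesis by (simp add: in_keys_iff)
    qed (use col in simp)
  qed
qed

lemma card_standard_monoms_le:
  assumes keys: "Poly_Mapping.keys a \<subseteq> {1..n}"
  shows "card (standard_monoms m n E a) \<le> card (merge_columns E (Poly_Mapping.keys a) ` monoms_of_degree m n a)"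
proof (rule card_inj_on_le[OF merge_shift_inj_on[OF keys]])
  show "(\<lambda>t. merge_columns E (Poly_Mapping.keys a) (column_shift m E (Poly_Mapping.keys a) t)) ` standard_monoms m n E a
    \<subseteq> merge_columns E (Poly_Mapping.keys a) ` monoms_of_degree m n a"
    using column_shift_degree by blast
qed (simp add: finite_monoms_of_degree)

section \<open>Membership in the binomial edge ideal\<close>

definition column_monom :: "nat set \<Rightarrow> (nat \<Rightarrow> nat) \<Rightarrow> (nat \<times> nat) monom" where
  "column_monom A i = (\<Sum>j\<in>A. Poly_Mapping.single (i j, j) 1)"

lemma prod_X: "(\<Prod>j\<in>A. X (i j) j) = monomial (column_monom A i)"
  by (simp add: column_monom_def monomial_sum Var_def)

lemma column_monom_cong: "(\<And>j. j \<in> A \<Longrightarrow> i j = i' j) \<Longrightarrow> column_monom A i = column_monom A i'"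
  unfolding column_monom_def by (rule sum.cong) auto

lemma lookup_column_monom:
  assumes "finite A"
  shows "Poly_Mapping.lookup (column_monom A i) (a, j) = (if j \<in> A \<and> i j = a then 1 else 0)"
proof -
  have "Poly_Mapping.lookup (column_monom A i) (a, j) = (\<Sum>l\<in>A. if l = j then (if i j = a then 1 else 0) else 0)"
    unfolding column_monom_def lookup_sum by (rule sum.cong) (auto simp: lookup_single when_def)
  then show ?thesis using assms by (simp add: sum.delta)
qed

lemma column_monom_in_Monoms:
  assumes "A \<subseteq> {1..n}" "\<And>j. j \<in> A \<Longrightarrow> i j \<in> {1..m}"
  shows "column_monom A i \<in> Monoms (matrix_vars m n)"
  unfolding column_monom_def
  by (intro Monoms_sum Monoms_single) (use assms in \<open>auto simp: matrix_vars_def\<close>)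

section \<open>Minors of edges and permutations of rows\<close>

abbreviation minors :: "nat \<Rightarrow> nat set set \<Rightarrow> 'k::field pol set" where
  "minors m E \<equiv> {X a j * X b k - X a k * X b j |a b j k. 1 \<le> a \<and> a < b \<and> b \<le> m \<and> {j, k} \<in> E}"

lemma simple_graph_edge:
  assumes "simple_graph V E" "{j, k} \<in> E"
  shows "j \<in> V" "k \<in> V" "j \<noteq> k"
  using assms by (auto simp: simple_graph_def)

lemma minors_in_Polys:
  assumes "simple_graph {1..n} E"
  shows "minors m E \<subseteq> Polys (matrix_vars m n)"
proof clarify
  fix a b j k :: nat assume "1 \<le> a" "a < b" "b \<le> m" "{j, k} \<in> E"
  with simple_graph_edge[OF assms] show "X a j * X b k - X a k * X b j \<in> Polys (matrix_vars m n)"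
    by (intro Polys_diff Polys_mult Polys_Var) (auto simp: matrix_vars_def)
qed

lemma ideal_binomial_edge_ideal:
  assumes "simple_graph {1..n} E"
  shows "ideal (binomial_edge_ideal m n E) (S_ring m n)"
  unfolding binomial_edge_ideal_def by (rule genideal_S_ring_ideal[OF minors_in_Polys[OF assms]])

lemma graded_binomial_edge_ideal:
  assumes "simple_graph {1..n} E"
  shows "graded_ideal m n (binomial_edge_ideal m n E)"
  unfolding binomial_edge_ideal_def
proof (rule graded_ideal_genideal[OF minors_in_Polys[OF assms]])
  fix g :: "'a pol" assume "g \<in> minors m E"
  then obtain a b j k :: nat where g: "g = X a j * X b k - X a k * X b j" by auto
  have X: "X a j \<in> homogeneous (Poly_Mapping.single j 1)" for a j
    using homogeneous_monomial[of "Poly_Mapping.single (a, j) 1"] by (simp add: Var_def)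
  have "X a k * X b j \<in> homogeneous (Poly_Mapping.single j 1 + Poly_Mapping.single k 1)"
    using homogeneous_mult[OF X X, of a k b j] by (simp add: add.commute)
  then have "g \<in> homogeneous (Poly_Mapping.single j 1 + Poly_Mapping.single k 1)"
    unfolding g by (intro pol_vs.subspace_diff[OF subspace_homogeneous] homogeneous_mult[OF X X])
  then show "\<exists>b. g \<in> homogeneous b" ..
qed

lemma minor_in_binomial_edge_ideal:
  assumes G: "simple_graph {1..n} E" and e: "{j, k} \<in> E" and a: "a \<in> {1..m}" "b \<in> {1..m}"
  shows "X a j * X b k - X b j * X a k \<in> (binomial_edge_ideal m n E :: 'a::field pol set)"
proof -
  have sub: "pol_vs.subspace (binomial_edge_ideal m n E :: 'a pol set)"
    using ideal_binomial_edge_ideal[OF G] by (rule ideal_subspace)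
  have lt: "X a j * X b k - X b j * X a k \<in> (binomial_edge_ideal m n E :: 'a pol set)"
    if "1 \<le> a" "a < b" "b \<le> m" for a b :: nat
  proof -
    have "X a j * X b k - X a k * X b j \<in> (minors m E :: 'a pol set)"
      using that e by blast
    then have "X a j * X b k - X a k * X b j \<in> (binomial_edge_ideal m n E :: 'a pol set)"
      using genideal_S_ring_superset[OF minors_in_Polys[OF G]]
      unfolding binomial_edge_ideal_def by blast
    then show ?thesis by (simp add: mult.commute[of "X a k"])
  qed
  consider "a < b" | "a = b" | "b < a" by linarith
  then show ?thesis
  proof cases
    case 1
    then show ?thesis using lt[of a b] a by auto
  next
    case 2
    then show ?thesis using pol_vs.subspace_0[OF sub] by simp
  next
    case 3
    then have "- (X b j * X a k - X a j * X b k) \<in> (binomial_edge_ideal m n E :: 'a pol set)"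
      using lt[of b a] a by (intro pol_vs.subspace_neg[OF sub]) auto
    then show ?thesis by simp
  qed
qed

text \<open>The difference is the part of the monomial outside columns \<open>j\<close> and
  \<open>k\<close> times a minor of the edge.\<close>

lemma swap_edge_in_ideal:
  assumes G: "simple_graph {1..n} E" and A: "A \<subseteq> {1..n}" and jk: "j \<in> A" "k \<in> A" "{j, k} \<in> E"
    and i: "\<forall>l\<in>A. i l \<in> {1..m}"
  shows "monomial (column_monom A i) - monomial (column_monom A (i \<circ> Transposition.transpose j k))
    \<in> (binomial_edge_ideal m n E :: 'a::field pol set)"
proof -
  let ?B = "A - {j, k}"
  have "j \<noteq> k" using simple_graph_edge[OF G jk(3)] by simp
  have fin: "finite A" using A by (rule finite_subset) simp
  have split: "column_monom A f = Poly_Mapping.single (f j, j) 1 + Poly_Mapping.single (f k, k) 1 + column_monom ?B f" for f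
  proof -
    have "A = insert j (insert k ?B)" using jk by auto
    then have "column_monom A f = (\<Sum>l\<in>insert j (insert k ?B). Poly_Mapping.single (f l, l) 1)"
      by (simp add: column_monom_def)
    then show ?thesis
      using fin \<open>j \<noteq> k\<close> by (simp add: column_monom_def add.assoc)
  qed
  have "column_monom ?B (i \<circ> Transposition.transpose j k) = column_monom ?B i"
    by (rule column_monom_cong) (auto simp: transpose_def)
  then have "monomial (column_monom A i) - monomial (column_monom A (i \<circ> Transposition.transpose j k))
    = (monomial (column_monom ?B i) :: 'a pol) * (X (i j) j * X (i k) k - X (i k) j * X (i j) k)"
    unfolding split[of i] split[of "i \<circ> Transposition.transpose j k"]
    by (simp add: monomial_add Var_def algebra_simps)
  moreover have "(monomial (column_monom ?B i) :: 'a pol) \<in> Polys (matrix_vars m n)"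
    by (intro Polys_monomial column_monom_in_Monoms) (use A i in auto)
  moreover have "X (i j) j * X (i k) k - X (i k) j * X (i j) k \<in> (binomial_edge_ideal m n E :: 'a pol set)"
    using minor_in_binomial_edge_ideal[OF G jk(3)] i jk by auto
  ultimately show ?thesis
    using ideal_binomial_edge_ideal[OF G, of m, where 'a = 'a] by (simp add: ideal_S_ring_iff)
qed

text \<open>Along a path, the transposition of \<open>u\<close> and \<open>z\<close> is the one of
  \<open>y\<close> and \<open>z\<close> conjugated by the one of \<open>u\<close> and
  \<open>y\<close>. The family \<open>i\<close> stays arbitrary in the induction, since the
  hypothesis is applied to permuted families too.\<close>

lemma swap_connected_in_ideal:
  assumes G: "simple_graph {1..n} E" and A: "A \<subseteq> {1..n}" and u: "u \<in> A"
    and path: "(u, v) \<in> (adjacent E A)\<^sup>*" and i: "\<forall>l\<in>A. i l \<in> {1..m}"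
  shows "monomial (column_monom A i) - monomial (column_monom A (i \<circ> Transposition.transpose u v))
    \<in> (binomial_edge_ideal m n E :: 'a::field pol set)"
  using path i
proof (induction arbitrary: i rule: rtrancl_induct)
  case base
  then show ?case
    using pol_vs.subspace_0[OF ideal_subspace[OF ideal_binomial_edge_ideal[OF G]]] by simp
next
  case (step y z)
  let ?T = Transposition.transpose
  let ?M = "\<lambda>i. monomial (column_monom A i) :: 'a pol"
  have sub: "pol_vs.subspace (binomial_edge_ideal m n E :: 'a pol set)"
    using ideal_binomial_edge_ideal[OF G] by (rule ideal_subspace)
  have yz: "{y, z} \<in> E" "y \<in> A" "z \<in> A"
    using step.hyps(2) by (auto simp: adjacent_def induced_edges_def)
  then have "y \<noteq> z" using simple_graph_edge[OF G] by auto
  have range: "\<forall>l\<in>A. (i \<circ> ?T a b) l \<in> {1..m}" if "\<forall>l\<in>A. i l \<in> {1..m}" "a \<in> A" "b \<in> A" for i a b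
    using that by (auto simp: transpose_def)
  show ?case
  proof (cases "u = z")
    case True
    then show ?thesis using pol_vs.subspace_0[OF sub] by simp
  next
    case False
    let ?i1 = "i \<circ> ?T u y"
    let ?i2 = "?i1 \<circ> ?T y z"
    let ?i3 = "?i2 \<circ> ?T u y"
    note i = step.prems
    have r1: "\<forall>l\<in>A. ?i1 l \<in> {1..m}" by (rule range[OF i u yz(2)])
    have r2: "\<forall>l\<in>A. ?i2 l \<in> {1..m}" by (rule range[OF r1 yz(2,3)])
    have "?M i - ?M ?i1 \<in> binomial_edge_ideal m n E" by (rule step.IH[OF i])
    moreover have "?M ?i1 - ?M ?i2 \<in> binomial_edge_ideal m n E"
      by (rule swap_edge_in_ideal[OF G A yz(2,3,1) r1])
    moreover have "?M ?i2 - ?M ?i3 \<in> binomial_edge_ideal m n E" by (rule step.IH[OF r2])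
    ultimately have "(?M i - ?M ?i1) + (?M ?i1 - ?M ?i2) + (?M ?i2 - ?M ?i3) \<in> binomial_edge_ideal m n E"
      by (intro pol_vs.subspace_add[OF sub])
    then have "?M i - ?M ?i3 \<in> binomial_edge_ideal m n E" by (simp only: diff_add_cancel diff_add_eq add_diff_eq)
    moreover have "?i3 = i \<circ> ?T u z"
      using transpose_comp_triple[of u z y] False \<open>y \<noteq> z\<close> by (simp add: comp_assoc)
    ultimately show ?thesis by (simp only:)
  qed
qed

lemma connected_graph_path:
  "connected_graph A (induced_edges E A) \<Longrightarrow> u \<in> A \<Longrightarrow> v \<in> A \<Longrightarrow> (u, v) \<in> (adjacent E A)\<^sup>*"
  by (simp add: connected_graph_def adjacent_def)

lemma permute_in_ideal:
  assumes G: "simple_graph {1..n} E" and A: "A \<subseteq> {1..n}" and conn: "connected_graph A (induced_edges E A)"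
    and p: "p permutes A" and i: "\<forall>l\<in>A. i l \<in> {1..m}"
  shows "monomial (column_monom A i) - monomial (column_monom A (i \<circ> p)) \<in> binomial_edge_ideal m n E"
proof -
  have fin: "finite A" using A by (rule finite_subset) simp
  have sub: "pol_vs.subspace (binomial_edge_ideal m n E :: 'a pol set)"
    using ideal_binomial_edge_ideal[OF G] by (rule ideal_subspace)
  let ?M = "\<lambda>i. monomial (column_monom A i) :: 'a pol"
  have "\<forall>i. (\<forall>l\<in>A. i l \<in> {1..m}) \<longrightarrow> ?M i - ?M (i \<circ> p) \<in> binomial_edge_ideal m n E"
    using p fin
  proof (induction rule: permutes_induct)
    case id
    show ?case using pol_vs.subspace_0[OF sub] by simp
  next
    case (swap a b p)
    show ?case
    proof (intro allI impI)
      fix i assume i: "\<forall>l\<in>A. i l \<in> {1..m}"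
      let ?i1 = "i \<circ> Transposition.transpose a b"
      have "\<forall>l\<in>A. ?i1 l \<in> {1..m}" using i swap.hyps by (auto simp: transpose_def)
      then have "?M ?i1 - ?M (?i1 \<circ> p) \<in> binomial_edge_ideal m n E" using swap.IH by blast
      moreover have "?M i - ?M ?i1 \<in> binomial_edge_ideal m n E"
        using swap_connected_in_ideal[OF G A swap.hyps(1) connected_graph_path[OF conn swap.hyps(1,2)] i] .
      ultimately have "(?M i - ?M ?i1) + (?M ?i1 - ?M (?i1 \<circ> p)) \<in> binomial_edge_ideal m n E"
        by (intro pol_vs.subspace_add[OF sub])
      then show "?M i - ?M (i \<circ> (Transposition.transpose a b \<circ> p)) \<in> binomial_edge_ideal m n E"
        by (simp add: comp_assoc)
    qed
  qed
  then show ?thesis using i by blast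
qed

text \<open>Equal row content means that the two families use each row equally often, hence differ
  by a permutation of \<open>A\<close>.\<close>

lemma same_rows_in_ideal:
  assumes G: "simple_graph {1..n} E" and A: "A \<subseteq> {1..n}" and conn: "connected_graph A (induced_edges E A)"
    and i: "\<forall>l\<in>A. i l \<in> {1..m}" and i': "\<forall>l\<in>A. i' l \<in> {1..m}"
    and eq: "push_forward fst (column_monom A i) = push_forward fst (column_monom A i')"
  shows "monomial (column_monom A i) - monomial (column_monom A i') \<in> binomial_edge_ideal m n E"
proof -
  have fin: "finite A" using A by (rule finite_subset) simp
  have pf: "Poly_Mapping.lookup (push_forward fst (column_monom A f)) c = card {j \<in> A. f j = c}" for f c
  proof -
    have "Poly_Mapping.lookup (push_forward fst (column_monom A f)) c = (\<Sum>j\<in>A. if f j = c then 1 else 0 :: nat)"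
      by (simp add: column_monom_def push_forward_sum lookup_sum lookup_single when_def cong: if_cong)
    also have "\<dots> = card {j \<in> A. f j = c}"
      using fin by (simp add: sum.If_cases Int_def)
    finally show ?thesis .
  qed
  have "image_mset i' (mset_set A) = image_mset i (mset_set A)"
  proof (rule multiset_eqI)
    fix c
    have "count (image_mset f (mset_set A)) c = card {j \<in> A. f j = c}" for f :: "nat \<Rightarrow> nat"
      using fin by (simp add: count_image_mset' conj_commute eq_commute)
    then show "count (image_mset i' (mset_set A)) c = count (image_mset i (mset_set A)) c"
      by (simp add: pf[symmetric] eq)
  qed
  then obtain p where p: "p permutes A" "\<forall>x\<in>A. i' x = i (p x)"
    using image_mset_eq_implies_permutes[OF fin] by blast
  then have "column_monom A i' = column_monom A (i \<circ> p)"
    by (intro column_monom_cong) simp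
  then show ?thesis using permute_in_ideal[OF G A conn p(1) i] by simp
qed

section \<open>The ideal and the kernels of merging substitutions\<close>

lemma fibre_sums_zero_in_subspace:
  fixes p :: "'k::field pol"
  assumes W: "pol_vs.subspace W"
    and diff: "\<And>s t. s \<in> Poly_Mapping.keys p \<Longrightarrow> t \<in> Poly_Mapping.keys p \<Longrightarrow> h s = h t \<Longrightarrow>
      monomial s - monomial t \<in> W"
    and sum: "(\<Sum>t\<in>Poly_Mapping.keys p. Poly_Mapping.single (h t) (Poly_Mapping.lookup p t)) = 0"
  shows "p \<in> W"
proof -
  let ?K = "Poly_Mapping.keys p" and ?c = "Poly_Mapping.lookup p"
  \<comment> \<open>One representative per fibre. Replacing each monomial of \<open>p\<close> by its
    representative gives 0, so \<open>p\<close> is a combination of differences within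
    fibres.\<close>
  define rep where "rep y = (SOME t. t \<in> ?K \<and> h t = y)" for y
  have rep: "rep (h t) \<in> ?K \<and> h (rep (h t)) = h t" if "t \<in> ?K" for t
    unfolding rep_def by (rule someI[of _ t]) (use that in simp)
  have "(\<Sum>t\<in>?K. pol_scale (?c t) (monomial (rep (h t)))) = 0"
  proof (rule poly_mapping_eqI)
    fix s
    have "Poly_Mapping.lookup (\<Sum>t\<in>?K. pol_scale (?c t) (monomial (rep (h t)))) s
        = (\<Sum>t\<in>?K. if rep (h t) = s then ?c t else 0)"
      by (simp add: lookup_sum lookup_pol_scale lookup_monomial eq_commute if_distrib cong: if_cong)
    also have "\<dots> = (\<Sum>t\<in>?K. if rep (h s) = s \<and> h t = h s then ?c t else 0)"
      by (rule sum.cong) (use rep in auto)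
    also have "\<dots> = (if rep (h s) = s then Poly_Mapping.lookup (\<Sum>t\<in>?K. Poly_Mapping.single (h t) (?c t)) (h s) else 0)"
      by (simp add: lookup_sum lookup_single when_def)
    also have "\<dots> = 0" by (simp add: sum)
    finally show "Poly_Mapping.lookup (\<Sum>t\<in>?K. pol_scale (?c t) (monomial (rep (h t)))) s = Poly_Mapping.lookup 0 s"
      by simp
  qed
  then have "p = (\<Sum>t\<in>?K. pol_scale (?c t) (monomial t - monomial (rep (h t))))"
    by (simp add: pol_vs.scale_right_diff_distrib sum_subtractf sum_pol_scale_monomial)
  also have "\<dots> \<in> W"
    by (intro pol_vs.subspace_sum[OF W] pol_vs.subspace_scale[OF W] diff) (use rep in auto)
  finally show ?thesis .
qed

lemma peval_Var_comp:
  assumes "\<And>t v. t \<in> Poly_Mapping.keys p \<Longrightarrow> v \<in> Poly_Mapping.keys t \<Longrightarrow> f v = Var (h v)"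
  shows "peval Const f p = (\<Sum>t\<in>Poly_Mapping.keys p. Poly_Mapping.single (push_forward h t)
    (Poly_Mapping.lookup p t :: 'a::comm_ring_1))"
  unfolding peval_def mev_def[symmetric]
  by (intro sum.cong refl) (simp add: mev_Var_comp[OF assms] Const_mult_monomial)

text \<open>A partial converse of \<open>binomial_edge_ideal_kernel\<close>. Since \<open>A\<close>
  is connected and each of its columns is used once, monomials with the same image are congruent
  modulo the ideal.\<close>

lemma kernel_in_ideal:
  fixes p :: "'k::field pol"
  assumes G: "simple_graph {1..n} E" and A: "A \<subseteq> {1..n}" and conn: "connected_graph A (induced_edges E A)"
    and keys: "Poly_Mapping.keys p \<subseteq> {column_monom A i |i. \<forall>l\<in>A. i l \<in> {1..m}}"
    and ker: "peval Const (\<lambda>v. Var (fst v)) p = 0"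
  shows "p \<in> binomial_edge_ideal m n E"
proof (rule fibre_sums_zero_in_subspace[where h = "push_forward fst"])
  show "pol_vs.subspace (binomial_edge_ideal m n E :: 'k pol set)"
    using ideal_binomial_edge_ideal[OF G] by (rule ideal_subspace)
  fix s t assume "s \<in> Poly_Mapping.keys p" "t \<in> Poly_Mapping.keys p" "push_forward fst s = push_forward fst t"
  then show "monomial s - monomial t \<in> (binomial_edge_ideal m n E :: 'k pol set)"
    using keys same_rows_in_ideal[OF G A conn] by blast
next
  show "(\<Sum>t\<in>Poly_Mapping.keys p. Poly_Mapping.single (push_forward fst t) (Poly_Mapping.lookup p t)) = 0"
    using ker peval_Var_comp[of p "\<lambda>v. Var (fst v)" fst] by simp
qed

text \<open>An edge inside \<open>A\<close> joins columns that become equal, so its minors vanish;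
  an edge leaving \<open>A\<close> has a column sent to 0, which kills both terms of its
  minors.\<close>

lemma binomial_edge_ideal_kernel:
  fixes p :: "'k::field pol"
  assumes G: "simple_graph {1..n} E" and p: "p \<in> binomial_edge_ideal m n E"
  shows "peval Const (\<lambda>(i, j). if j \<in> A then Var (i, component E A j) else 0) p = 0" (is "?\<phi> p = 0")
proof -
  interpret \<phi>: comm_ring_hom ?\<phi> by (rule peval_hom[OF comm_ring_hom_Const])
  have V: "?\<phi> (X i j) = (if j \<in> A then Var (i, component E A j) else 0)" for i j
    by (simp add: peval_Var[OF comm_ring_hom_Const])
  have "p \<in> pol_vs.span (mult_gens m n (minors m E))"
    using p by (simp only: binomial_edge_ideal_def genideal_eq_span[OF minors_in_Polys[OF G]])
  then show ?thesis
  proof (induction rule: pol_vs.span_induct)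
    case base
    show ?case
      by (simp add: pol_vs.subspace_def \<phi>.hom_add \<phi>.hom_mult pol_scale_def)
  next
    case (step p)
    then obtain w a b j k where p: "p = monomial w * (X a j * X b k - X a k * X b j)" and e: "{j, k} \<in> E"
      by (auto simp: mult_gens_def)
    have "component E A j = component E A k" if "j \<in> A" "k \<in> A"
    proof -
      have "(j, k) \<in> adjacent E A" using e that by (simp add: adjacent_def induced_edges_def)
      then have "k \<in> component E A j" by (auto simp: component_def)
      then show ?thesis by (simp add: component_eq)
    qed
    then have "?\<phi> (X a j * X b k - X a k * X b j) = 0"
      by (simp add: \<phi>.hom_minus \<phi>.hom_mult V)
    then show ?case unfolding p by (simp add: \<phi>.hom_mult)
  qed
qed

text \<open>With \<open>A\<close> the support of the degree, every column in use lies in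
  \<open>A\<close>, so the substitution acts on exponents as \<open>merge_columns\<close>; the sum
  is the coefficient at \<open>y\<close> of the image.\<close>

lemma binomial_edge_ideal_fibre_sum:
  fixes p :: "'k::field pol"
  assumes G: "simple_graph {1..n} E" and p: "p \<in> graded_piece (binomial_edge_ideal m n E) a"
  shows "(\<Sum>t | t \<in> Poly_Mapping.keys p \<and> merge_columns E (Poly_Mapping.keys a) t = y. Poly_Mapping.lookup p t) = 0"
proof -
  let ?A = "Poly_Mapping.keys a"
  have "peval Const (\<lambda>(i, j). if j \<in> ?A then Var (i, component E ?A j) else 0) p
    = (\<Sum>t\<in>Poly_Mapping.keys p. Poly_Mapping.single (merge_columns E ?A t) (Poly_Mapping.lookup p t))"
    unfolding merge_columns_def
  proof (rule peval_Var_comp)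
    fix t v assume t: "t \<in> Poly_Mapping.keys p" and v: "v \<in> Poly_Mapping.keys t"
    obtain i j where [simp]: "v = (i, j)" by force
    have "multideg t = a" using p t by (auto simp: graded_piece_def)
    then have "j \<in> ?A" using keys_multideg[of i j t] v by simp
    then show "(case v of (i, j) \<Rightarrow> if j \<in> ?A then Var (i, component E ?A j) else 0)
      = Var (case v of (i, j) \<Rightarrow> (i, component E ?A j))"
      by simp
  qed
  moreover have "peval Const (\<lambda>(i, j). if j \<in> ?A then Var (i, component E ?A j) else 0) p = 0"
    by (rule binomial_edge_ideal_kernel[OF G, of p m ?A]) (use p in \<open>simp add: graded_piece_def\<close>)
  ultimately have "(\<Sum>t\<in>Poly_Mapping.keys p. Poly_Mapping.single (merge_columns E ?A t) (Poly_Mapping.lookup p t)) = 0"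
    by simp
  from arg_cong[OF this, of "\<lambda>q. Poly_Mapping.lookup q y"]
  show ?thesis
    by (simp add: lookup_sum lookup_single when_def sum.inter_filter[symmetric])
qed

section \<open>A determinantal element of the ideal\<close>

lemma det_linforms:
  "det (mat k k (\<lambda>(p, q). linform m (c p q) (e q)) :: 'k::field pol mat) =
    (\<Sum>f\<in>PiE {..<k} (\<lambda>_. {1..m}). Const (det (mat k k (\<lambda>(p, q). c p q (f q)))) *
      monomial (\<Sum>q<k. Poly_Mapping.single (f q, e q) 1))" (is "?L = ?R")
proof -
  interpret C: comm_ring_hom "Const :: 'k \<Rightarrow> 'k pol" by (rule comm_ring_hom_Const)
  let ?F = "PiE {..<k} (\<lambda>_. {1..m})" and ?P = "{\<sigma>. \<sigma> permutes {0..<k}}"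
  let ?t = "\<lambda>f. monomial (\<Sum>q<k. Poly_Mapping.single (f q, e q) 1) :: 'k pol"
  \<comment> \<open>Multilinearity in the columns: all entries of column \<open>q\<close> are forms
    in the same variables, so choosing a row \<open>f q\<close> in each column splits off a monomial
    that does not depend on the permutation.\<close>
  have prod: "(\<Prod>j<k. linform m (c (\<sigma> j) j) (e j)) = (\<Sum>f\<in>?F. Const (\<Prod>j<k. c (\<sigma> j) j (f j)) * ?t f)" for \<sigma>
    unfolding linform_def
    by (subst prod_sum_PiE) (simp_all add: prod.distrib C.hom_prod monomial_sum Var_def)
  have "?L = (\<Sum>\<sigma>\<in>?P. signof \<sigma> * (\<Prod>j<k. linform m (c (\<sigma> j) j) (e j)))"
    by (subst det_col[of _ k]) (auto intro!: sum.cong prod.cong simp: permutes_in_image[of _ "{0..<k}", simplified])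
  also have "\<dots> = (\<Sum>\<sigma>\<in>?P. \<Sum>f\<in>?F. Const (signof \<sigma> * (\<Prod>j<k. c (\<sigma> j) j (f j))) * ?t f)"
    by (simp add: prod sum_distrib_left C.hom_mult mult.assoc)
  also have "\<dots> = (\<Sum>f\<in>?F. \<Sum>\<sigma>\<in>?P. Const (signof \<sigma> * (\<Prod>j<k. c (\<sigma> j) j (f j))) * ?t f)"
    by (rule sum.swap)
  also have "\<dots> = (\<Sum>f\<in>?F. Const (\<Sum>\<sigma>\<in>?P. signof \<sigma> * (\<Prod>j<k. c (\<sigma> j) j (f j))) * ?t f)"
    by (simp add: C.hom_sum sum_distrib_right)
  also have "\<dots> = ?R"
    by (intro sum.cong refl arg_cong2[where f = "(*)"] arg_cong[where f = Const], subst det_col[of _ k])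
      (auto intro!: sum.cong prod.cong simp: permutes_in_image[of _ "{0..<k}", simplified])
  finally show ?thesis .
qed

lemma det_zero_column:
  assumes "q < k" "\<And>p. p < k \<Longrightarrow> B $$ (p, q) = 0" "B \<in> carrier_mat k k"
  shows "det B = 0"
proof -
  have "(\<Prod>j<k. B $$ (\<sigma> j, j)) = 0" if "\<sigma> permutes {0..<k}" for \<sigma>
  proof (rule prod_zero)
    have "\<sigma> q < k" using permutes_in_image[OF that, of q] assms(1) by simp
    then show "\<exists>j\<in>{..<k}. B $$ (\<sigma> j, j) = 0" using assms(1,2) by auto
  qed simp
  then show ?thesis by (simp add: det_col[OF assms(3)])
qed

lemma solve_nonsingular:
  fixes B :: "'k::field mat"
  assumes B: "B \<in> carrier_mat m m" "det B \<noteq> 0"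
  shows "\<exists>x. \<forall>r<m. (\<Sum>c<m. x c * B $$ (r, c)) = v r"
proof -
  let ?w = "vec m v"
  define y where "y = (1 / det B) \<cdot>\<^sub>v (adj_mat B *\<^sub>v ?w)"
  have adj: "adj_mat B \<in> carrier_mat m m" "B * adj_mat B = det B \<cdot>\<^sub>m 1\<^sub>m m" using adj_mat[OF B(1)] by auto
  have dimy: "y \<in> carrier_vec m" using adj(1) by (auto simp: y_def)
  have "B *\<^sub>v y = (1 / det B) \<cdot>\<^sub>v (B *\<^sub>v (adj_mat B *\<^sub>v ?w))"
    unfolding y_def using B(1) adj(1) by (intro mult_mat_vec) auto
  also have "B *\<^sub>v (adj_mat B *\<^sub>v ?w) = (B * adj_mat B) *\<^sub>v ?w"
    using B(1) adj(1) by (intro assoc_mult_mat_vec[symmetric]) auto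
  also have "\<dots> = det B \<cdot>\<^sub>v ?w"
  proof (rule eq_vecI)
    fix r assume "r < dim_vec (det B \<cdot>\<^sub>v ?w)"
    then have r: "r < m" by simp
    have "((det B \<cdot>\<^sub>m 1\<^sub>m m) *\<^sub>v ?w) $ r = (\<Sum>c<m. det B * (if c = r then 1 else 0) * v c)"
      using r by (simp add: scalar_prod_def atLeast0LessThan)
    also have "\<dots> = (\<Sum>c<m. if c = r then det B * v r else 0)"
      by (rule sum.cong) auto
    finally show "(B * adj_mat B *\<^sub>v ?w) $ r = (det B \<cdot>\<^sub>v ?w) $ r"
      using r by (simp add: adj(2))
  qed (simp add: B(1)[THEN carrier_matD(1)])
  finally have By: "B *\<^sub>v y = ?w" using B(2) by (simp add: smult_smult_assoc)
  have "(\<Sum>c<m. y $ c * B $$ (r, c)) = v r" if "r < m" for r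
  proof -
    have "(B *\<^sub>v y) $ r = (\<Sum>c<m. B $$ (r, c) * y $ c)"
      using B(1) dimy that by (auto simp: scalar_prod_def atLeast0LessThan)
    then show ?thesis using that by (simp add: By mult.commute)
  qed
  then show ?thesis by blast
qed

text \<open>The adjugate takes the place of the inverse because its entries are polynomials in the
  entries of \<open>g j\<close>. The index \<open>r\<close> counts from 1, like the rows of the
  variables.\<close>

definition adj_col :: "(nat \<Rightarrow> 'k::field mat) \<Rightarrow> nat \<times> nat \<Rightarrow> nat \<Rightarrow> 'k" where
  "adj_col g = (\<lambda>(j, i) r. adj_mat (g j) $$ (r - 1, i - 1))"

text \<open>Consequently the linear form with these coefficients is sent by \<open>g\<close> to
  \<open>det (g j)\<close> times the single variable \<open>X i j\<close>.\<close>

lemma mat_times_adj_col: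
  fixes B :: "nat \<Rightarrow> 'k::field mat"
  assumes "B j \<in> carrier_mat m m" "l \<in> {1..m}" "i \<in> {1..m}"
  shows "(\<Sum>r=1..m. B j $$ (l - 1, r - 1) * adj_col B (j, i) r) = (if l = i then det (B j) else 0)"
proof -
  have "(\<Sum>r=1..m. B j $$ (l - 1, r - 1) * adj_col B (j, i) r) = (B j * adj_mat (B j)) $$ (l - 1, i - 1)"
    using index_mult_mat_pred[OF assms(1) adj_mat(1)[OF assms(1)] assms(2,3)] by (simp add: adj_col_def)
  then show ?thesis
    using assms by (auto simp: adj_mat(2)[OF assms(1)])
qed

text \<open>The columns of all adjugates together are in general position. The condition mentions
  neither the graph nor a particular \<open>A\<close> and \<open>i\<close>, so one open set serves
  every generator.\<close>

definition generic :: "nat \<Rightarrow> nat \<Rightarrow> (nat \<Rightarrow> 'k::field mat) \<Rightarrow> bool" where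
  "generic m n g \<longleftrightarrow> (\<forall>s\<in>PiE {..<m} (\<lambda>_. {1..n} \<times> {1..m}). inj_on s {..<m} \<longrightarrow>
     det (mat m m (\<lambda>(r, c). adj_col g (s c) (Suc r))) \<noteq> 0)"

lemma det_GL_nonzero:
  assumes "g \<in> GL_prod m n" "j \<in> {1..n}"
  shows "g j \<in> carrier_mat m m" "det (g j) \<noteq> 0"
proof -
  obtain h where h: "g j \<in> carrier_mat m m" "h j \<in> carrier_mat m m" "g j * h j = 1\<^sub>m m"
    using GL_prod_inverse[OF assms(1)] assms(2) by metis
  show "g j \<in> carrier_mat m m" by (rule h(1))
  have "det (g j) * det (h j) = 1" using h by (simp flip: det_mult)
  then show "det (g j) \<noteq> 0" by auto
qed

text \<open>The conclusion does not mention a term order: it says that every monomial of the image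
  uses rows at least as large as \<open>i\<close>, so \<open>column_monom A i\<close> leads for each
  order in which larger rows give smaller variables.\<close>

lemma exists_leading_element:
  fixes g :: "nat \<Rightarrow> 'k::field mat"
  assumes G: "simple_graph {1..n} E" and g: "g \<in> GL_prod m n" and gen: "generic m n g"
    and A: "A \<subseteq> {1..n}" and conn: "connected_graph A (induced_edges E A)"
    and i: "\<forall>j\<in>A. i j \<in> {1..m}" and le: "(\<Sum>j\<in>A. int (i j)) \<le> int m * (int (card A) - 1)"
  shows "\<exists>P\<in>binomial_edge_ideal m n E. Poly_Mapping.lookup (act m g P) (column_monom A i) \<noteq> 0 \<and>
    Poly_Mapping.keys (act m g P) \<subseteq> {column_monom A i' |i'. \<forall>j\<in>A. i j \<le> i' j \<and> i' j \<le> m}"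
proof -
  have fin: "finite A" using A by (rule finite_subset) simp
  have "A \<noteq> {}" using conn by (simp add: connected_graph_def)
  define k where "k = card A"
  have "k > 0" using fin \<open>A \<noteq> {}\<close> by (simp add: k_def card_gt_0_iff)
  obtain e where e: "bij_betw e {..<k} A"
    using ex_bij_betw_nat_finite[OF fin] by (auto simp: k_def atLeast0LessThan)
  have eA: "e q \<in> A" if "q < k" for q using bij_betwE[OF e] that by auto
  have einj: "e p = e q \<longleftrightarrow> p = q" if "p < k" "q < k" for p q
    using e that by (auto simp: bij_betw_def inj_on_def)
  have gj: "g j \<in> carrier_mat m m" "det (g j) \<noteq> 0" if "j \<in> A" for j
    using det_GL_nonzero[OF g] A that by auto
  let ?\<Sigma> = "SIGMA j:A. {i j<..m}"
  have "int (card ?\<Sigma>) = (\<Sum>j\<in>A. int m - int (i j))"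
    using fin i by (simp add: of_nat_diff)
  also have "\<dots> = int m * int (card A) - (\<Sum>j\<in>A. int (i j))"
    by (simp add: sum_subtractf)
  also have "\<dots> \<ge> int m" using le by (simp add: algebra_simps)
  finally have "card {..<m} \<le> card ?\<Sigma>" by simp
  then obtain s0 where s0: "s0 ` {..<m} \<subseteq> ?\<Sigma>" "inj_on s0 {..<m}"
    using card_le_inj[of "{..<m}" ?\<Sigma>] fin by auto
  \<comment> \<open>Restricting makes \<open>s\<close> extensional, as the function space in
    \<open>generic\<close> requires.\<close>
  define s where "s = restrict s0 {..<m}"
  have s\<Sigma>: "s c \<in> ?\<Sigma>" if "c < m" for c
    using s0(1) that by (auto simp: s_def)
  have s: "fst (s c) \<in> A" "i (fst (s c)) < snd (s c)" "snd (s c) \<le> m" if "c < m" for c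
    using s\<Sigma>[OF that] by auto
  have snd_s: "snd (s c) \<in> {1..m}" if "c < m" for c
    using s[OF that] by auto
  define B where "B = mat m m (\<lambda>(r, c). adj_col g (s c) (Suc r))"
  have "s \<in> PiE {..<m} (\<lambda>_. {1..n} \<times> {1..m})"
  proof (rule PiE_I)
    fix c assume "c \<in> {..<m}"
    then show "s c \<in> {1..n} \<times> {1..m}" using s[of c] snd_s[of c] A by (cases "s c") auto
  qed (simp add: s_def)
  moreover have "inj_on s {..<m}" using s0(2) by (simp add: s_def inj_on_def)
  ultimately have "det B \<noteq> 0" using gen by (simp add: generic_def B_def)
  moreover have "B \<in> carrier_mat m m" by (simp add: B_def)
  ultimately have "\<forall>p. \<exists>x. \<forall>r<m. (\<Sum>c<m. x c * B $$ (r, c)) = adj_col g (e p, i (e p)) (Suc r)"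
    by (intro allI solve_nonsingular)
  from choice[OF this] obtain \<alpha> where
    "\<forall>p. \<forall>r<m. (\<Sum>c<m. \<alpha> p c * B $$ (r, c)) = adj_col g (e p, i (e p)) (Suc r)" by blast
  then have \<alpha>: "(\<Sum>c<m. \<alpha> p c * B $$ (r, c)) = adj_col g (e p, i (e p)) (Suc r)" if "r < m" for p r
    using that by blast
  have \<alpha>': "(\<Sum>c<m. \<alpha> p c * adj_col g (s c) r) = adj_col g (e p, i (e p)) r" if "r \<in> {1..m}" for p r
    using \<alpha>[of "r - 1" p] that by (auto simp: B_def)
  \<comment> \<open>Coefficient of \<open>X r (e q)\<close> in entry \<open>(p, q)\<close>. The
    vector belonging to row \<open>p\<close> is expanded in the columns of \<open>B\<close>, and the
    terms coming from the adjugate of \<open>g (e q)\<close> are subtracted in column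
    \<open>q\<close>.\<close>
  define M where "M p q r = (if p = q then adj_col g (e p, i (e p)) r else 0) -
    (\<Sum>c<m. if fst (s c) = e q then \<alpha> p c * adj_col g (s c) r else 0)" for p q r
  \<comment> \<open>Each \<open>c\<close> belongs to exactly one column \<open>e q\<close>, so
    summing over \<open>q\<close> restores the full expansion, which cancels the diagonal
    term.\<close>
  have row: "(\<Sum>q<k. M p q r) = 0" if "p < k" "r \<in> {1..m}" for p r
  proof -
    have "(\<Sum>q<k. \<Sum>c<m. if fst (s c) = e q then \<alpha> p c * adj_col g (s c) r else 0)
        = (\<Sum>c<m. \<Sum>q<k. if fst (s c) = e q then \<alpha> p c * adj_col g (s c) r else 0)"
      by (rule sum.swap)
    also have "\<dots> = (\<Sum>c<m. \<alpha> p c * adj_col g (s c) r)"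
    proof (rule sum.cong[OF refl])
      fix c assume "c \<in> {..<m}"
      then obtain q0 where q0: "q0 < k" "fst (s c) = e q0"
        using s(1)[of c] e by (auto simp: bij_betw_def)
      have "(\<Sum>q<k. if fst (s c) = e q then \<alpha> p c * adj_col g (s c) r else 0)
        = (\<Sum>q<k. if q = q0 then \<alpha> p c * adj_col g (s c) r else 0)"
        by (rule sum.cong) (use q0 einj in auto)
      then show "(\<Sum>q<k. if fst (s c) = e q then \<alpha> p c * adj_col g (s c) r else 0) = \<alpha> p c * adj_col g (s c) r"
        using q0 by simp
    qed
    finally show ?thesis
      using \<alpha>'[OF that(2), of p] that(1) by (simp add: M_def sum_subtractf)
  qed
  \<comment> \<open>The coefficients after \<open>g\<close> has acted. Each column of an adjugate
    becomes a multiple of a unit vector, so \<open>N p q\<close> lives in the rows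
    \<open>snd (s c)\<close>, all larger than \<open>i (e q)\<close>, and for \<open>p = q\<close>
    also in row \<open>i (e q)\<close> itself.\<close>
  define N where "N p q l = (\<Sum>r=1..m. g (e q) $$ (l - 1, r - 1) * M p q r)" for p q l
  have N: "N p q l = (if p = q \<and> l = i (e q) then det (g (e q)) else 0) -
      (\<Sum>c<m. if fst (s c) = e q \<and> l = snd (s c) then \<alpha> p c * det (g (e q)) else 0)"
    if "q < k" "l \<in> {1..m}" for p q l
  proof -
    have "N p q l = (if p = q then \<Sum>r=1..m. g (e q) $$ (l - 1, r - 1) * adj_col g (e q, i (e q)) r else 0) -
        (\<Sum>r=1..m. \<Sum>c<m. if fst (s c) = e q then \<alpha> p c * (g (e q) $$ (l - 1, r - 1) * adj_col g (s c) r) else 0)"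
      unfolding N_def M_def right_diff_distrib sum_subtractf
      by (intro arg_cong2[where f = "(-)"] sum.cong refl)
        (auto simp: sum_distrib_left mult_ac intro!: sum.cong)
    also have "(\<Sum>r=1..m. \<Sum>c<m. if fst (s c) = e q then \<alpha> p c * (g (e q) $$ (l - 1, r - 1) * adj_col g (s c) r) else 0)
       = (\<Sum>c<m. \<Sum>r=1..m. if fst (s c) = e q then \<alpha> p c * (g (e q) $$ (l - 1, r - 1) * adj_col g (s c) r) else 0)"
      by (rule sum.swap)
    also have "\<dots> = (\<Sum>c<m. if fst (s c) = e q \<and> l = snd (s c) then \<alpha> p c * det (g (e q)) else 0)"
    proof (rule sum.cong[OF refl])
      fix c assume c: "c \<in> {..<m}"
      show "(\<Sum>r=1..m. if fst (s c) = e q then \<alpha> p c * (g (e q) $$ (l - 1, r - 1) * adj_col g (s c) r) else 0)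
        = (if fst (s c) = e q \<and> l = snd (s c) then \<alpha> p c * det (g (e q)) else 0)"
      proof (cases "fst (s c) = e q")
        case True
        then have sc: "s c = (e q, snd (s c))" by (simp add: prod_eq_iff)
        have "(\<Sum>r=1..m. g (e q) $$ (l - 1, r - 1) * adj_col g (s c) r) = (if l = snd (s c) then det (g (e q)) else 0)"
          by (subst sc) (rule mat_times_adj_col[where B = g and j = "e q", OF gj(1)[OF eA[OF that(1)]] that(2)], use snd_s[of c] c in auto)
        then show ?thesis using True by (simp add: sum_distrib_left[symmetric] del: One_nat_def)
      qed simp
    qed
    also have "(\<Sum>r=1..m. g (e q) $$ (l - 1, r - 1) * adj_col g (e q, i (e q)) r) = (if l = i (e q) then det (g (e q)) else 0)"
      using mat_times_adj_col[where B = g and j = "e q", OF gj(1)[OF eA[OF that(1)]] that(2), of "i (e q)"] i eA[OF that(1)] by auto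
    finally show ?thesis by auto
  qed
  have N_below: "N p q l = 0" if "q < k" "l \<in> {1..m}" "l < i (e q)" for p q l
  proof -
    have "(\<Sum>c<m. if fst (s c) = e q \<and> l = snd (s c) then \<alpha> p c * det (g (e q)) else 0) = 0"
      by (rule sum.neutral) (use s(2) that(3) in force)
    then show ?thesis using N[OF that(1,2)] that(3) by simp
  qed
  have N_diag: "N p q (i (e q)) = (if p = q then det (g (e q)) else 0)" if "q < k" for p q
  proof -
    have "(\<Sum>c<m. if fst (s c) = e q \<and> i (e q) = snd (s c) then \<alpha> p c * det (g (e q)) else 0) = 0"
      by (rule sum.neutral) (use s(2) in force)
    then show ?thesis using N[OF that, of "i (e q)"] i eA[OF that] by simp
  qed
  define P where "P = det (mat k k (\<lambda>(p, q). linform m (M p q) (e q)))"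
  define t where "t f = (\<Sum>q<k. Poly_Mapping.single (f q, e q) (1::nat))" for f :: "nat \<Rightarrow> nat"
  let ?F = "PiE {..<k} (\<lambda>_. {1..m})"
  define inv_e where "inv_e = the_inv_into {..<k} e"
  have inv_e: "inv_e (e q) = q" if "q < k" for q
    unfolding inv_e_def using e that by (intro the_inv_into_f_f) (auto simp: bij_betw_def)
  have t_eq: "t f = column_monom A (\<lambda>j. f (inv_e j))" for f
  proof -
    have "column_monom A (\<lambda>j. f (inv_e j)) = (\<Sum>q<k. Poly_Mapping.single (f (inv_e (e q)), e q) 1)"
      unfolding column_monom_def by (rule sum.reindex_bij_betw[OF e, symmetric])
    then show ?thesis by (simp add: t_def inv_e cong: sum.cong_simp)
  qed
  have t_rows: "\<exists>i'. t f = column_monom A i' \<and> (\<forall>q<k. i' (e q) = f q)" for f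
    using t_eq inv_e by (intro exI[of _ "\<lambda>j. f (inv_e j)"]) auto
  have all_A: "(\<forall>q<k. Q (e q)) \<longleftrightarrow> (\<forall>j\<in>A. Q j)" for Q
    using e by (auto simp: bij_betw_def)
  have keys_sum: "\<exists>f\<in>?F. d f \<noteq> 0 \<and> u = t f"
    if "u \<in> Poly_Mapping.keys (\<Sum>f\<in>?F. Const (d f) * monomial (t f) :: 'k pol)" for d u
  proof (rule ccontr)
    assume *: "\<not> ?thesis"
    have "Poly_Mapping.lookup (\<Sum>f\<in>?F. Const (d f) * monomial (t f) :: 'k pol) u = 0"
      unfolding lookup_sum by (rule sum.neutral) (use * in \<open>auto simp: lookup_Const_mult lookup_monomial\<close>)
    with that show False by (simp add: in_keys_iff)
  qed
  have P: "P = (\<Sum>f\<in>?F. Const (det (mat k k (\<lambda>(p, q). M p q (f q)))) * monomial (t f))"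
    unfolding P_def t_def by (rule det_linforms)
  have P_in: "P \<in> binomial_edge_ideal m n E"
  proof (rule kernel_in_ideal[OF G A conn])
    show "Poly_Mapping.keys P \<subseteq> {column_monom A i |i. \<forall>l\<in>A. i l \<in> {1..m}}"
    proof
      fix u assume "u \<in> Poly_Mapping.keys P"
      then have "\<exists>f\<in>?F. det (mat k k (\<lambda>(p, q). M p q (f q))) \<noteq> 0 \<and> u = t f"
        unfolding P by (rule keys_sum)
      then obtain f where f: "f \<in> ?F" "u = t f" by (elim bexE conjE)
      obtain i' where "t f = column_monom A i'" "\<forall>q<k. i' (e q) = f q" using t_rows by blast
      moreover from this have "\<forall>l\<in>A. i' l \<in> {1..m}" using f(1) by (subst all_A[symmetric]) (auto simp: PiE_iff)
      ultimately show "u \<in> {column_monom A i |i. \<forall>l\<in>A. i l \<in> {1..m}}" using f(2) by blast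
    qed
    let ?\<phi> = "peval Const (\<lambda>v. Var (fst v)) :: 'k pol \<Rightarrow> (nat, 'k) mpol"
    interpret \<phi>: comm_ring_hom ?\<phi> by (rule peval_hom[OF comm_ring_hom_Const])
    interpret C: comm_ring_hom "Const :: 'k \<Rightarrow> (nat, 'k) mpol" by (rule comm_ring_hom_Const)
    have lin: "?\<phi> (linform m v j) = (\<Sum>r=1..m. Const (v r) * Var r)" for v j
      by (simp add: linform_def \<phi>.hom_sum \<phi>.hom_mult peval_Const[OF comm_ring_hom_Const] peval_Var[OF comm_ring_hom_Const])
    let ?B = "map_mat ?\<phi> (mat k k (\<lambda>(p, q). linform m (M p q) (e q)))"
    \<comment> \<open>Once the columns are merged, the rows of the matrix sum to zero: the all-ones
      vector is in the kernel.\<close>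
    have "?B *\<^sub>v vec k (\<lambda>_. 1) = 0\<^sub>v k"
    proof (rule eq_vecI)
      fix p assume "p < dim_vec (0\<^sub>v k :: (nat, 'k) mpol vec)"
      then have p: "p < k" by simp
      have "(?B *\<^sub>v vec k (\<lambda>_. 1)) $ p = (\<Sum>q<k. \<Sum>r=1..m. Const (M p q r) * Var r)"
        using p by (simp add: scalar_prod_def lin atLeast0LessThan)
      also have "\<dots> = (\<Sum>r=1..m. \<Sum>q<k. Const (M p q r) * Var r)"
        by (rule sum.swap)
      also have "\<dots> = (\<Sum>r=1..m. Const (\<Sum>q<k. M p q r) * Var r)"
        by (simp add: C.hom_sum sum_distrib_right)
      also have "\<dots> = 0" using row[OF p] by (intro sum.neutral) auto
      finally show "(?B *\<^sub>v vec k (\<lambda>_. 1)) $ p = 0\<^sub>v k $ p" using p by simp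
    qed simp
    moreover have "vec k (\<lambda>_. 1 :: (nat, 'k) mpol) \<noteq> 0\<^sub>v k"
      using \<open>k > 0\<close> by (auto simp: vec_eq_iff)
    ultimately have "det ?B = 0"
      by (subst det_0_iff_vec_prod_zero[of _ k]) (auto intro!: exI[of _ "vec k (\<lambda>_. 1)"])
    then show "?\<phi> P = 0" by (simp add: P_def)
  qed
  interpret act: comm_ring_hom "act m g" by (rule act_hom)
  have "act m g P = det (map_mat (act m g) (mat k k (\<lambda>(p, q). linform m (M p q) (e q))))"
    by (simp add: P_def)
  also have "map_mat (act m g) (mat k k (\<lambda>(p, q). linform m (M p q) (e q))) = mat k k (\<lambda>(p, q). linform m (N p q) (e q))"
    by (rule eq_matI) (simp_all add: act_linform N_def[abs_def])
  also have "det \<dots> = (\<Sum>f\<in>?F. Const (det (mat k k (\<lambda>(p, q). N p q (f q)))) * monomial (t f))"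
    unfolding t_def by (rule det_linforms)
  finally have actP: "act m g P = (\<Sum>f\<in>?F. Const (det (mat k k (\<lambda>(p, q). N p q (f q)))) * monomial (t f))" .
  have "Poly_Mapping.keys (act m g P) \<subseteq> {column_monom A i' |i'. \<forall>j\<in>A. i j \<le> i' j \<and> i' j \<le> m}"
  proof
    fix u assume "u \<in> Poly_Mapping.keys (act m g P)"
    then have "\<exists>f\<in>?F. det (mat k k (\<lambda>(p, q). N p q (f q))) \<noteq> 0 \<and> u = t f"
      unfolding actP by (rule keys_sum)
    then obtain f where f: "f \<in> ?F" "u = t f" and nz: "det (mat k k (\<lambda>(p, q). N p q (f q))) \<noteq> 0"
      by (elim bexE conjE)
    have fq: "f q \<in> {1..m}" if "q < k" for q using PiE_mem[OF f(1)] that by blast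
    \<comment> \<open>A choice with \<open>f q < i (e q)\<close> makes column \<open>q\<close> of
      the scalar matrix zero, so its coefficient vanishes.\<close>
    have ge: "i (e q) \<le> f q" if "q < k" for q
    proof (rule ccontr)
      assume "\<not> i (e q) \<le> f q"
      then have "N p q (f q) = 0" for p using N_below[OF that fq[OF that]] by simp
      then have "det (mat k k (\<lambda>(p, q). N p q (f q))) = 0"
        using that by (intro det_zero_column[of q k]) auto
      with nz show False by simp
    qed
    obtain i' where i': "t f = column_monom A i'" "\<forall>q<k. i' (e q) = f q" using t_rows by blast
    have "\<forall>j\<in>A. i j \<le> i' j \<and> i' j \<le> m"
      using i'(2) ge fq by (subst all_A[symmetric]) auto
    then show "u \<in> {column_monom A i' |i'. \<forall>j\<in>A. i j \<le> i' j \<and> i' j \<le> m}"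
      using i'(1) f(2) by blast
  qed
  moreover have "Poly_Mapping.lookup (act m g P) (column_monom A i) \<noteq> 0"
  proof -
    \<comment> \<open>The one choice of rows that yields \<open>column_monom A i\<close>. By
      \<open>N_diag\<close> its coefficient is the determinant of a diagonal matrix with the entries
      \<open>det (g (e q))\<close>.\<close>
    define f0 where "f0 = restrict (i \<circ> e) {..<k}"
    have f0: "f0 \<in> ?F" using i eA by (auto simp: f0_def)
    have t_inj: "f = f0" if f: "f \<in> ?F" and eq: "t f = column_monom A i" for f
    proof (rule PiE_ext[OF f f0])
      fix q assume "q \<in> {..<k}"
      then have q: "q < k" by simp
      obtain i' where i': "t f = column_monom A i'" "\<forall>q<k. i' (e q) = f q" using t_rows by blast
      then have "column_monom A i' = column_monom A i" using eq by simp
      then have "Poly_Mapping.lookup (column_monom A i') (i (e q), e q) = Poly_Mapping.lookup (column_monom A i) (i (e q), e q)"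
        by simp
      then have "i' (e q) = i (e q)"
        using eA[OF q] by (simp add: lookup_column_monom[OF fin] split: if_splits)
      then show "f q = f0 q" using i'(2) q by (simp add: f0_def)
    qed
    have "t f0 = column_monom A i"
      unfolding t_eq
    proof (rule column_monom_cong)
      fix j assume "j \<in> A"
      then obtain q where "q < k" "j = e q" using e by (auto simp: bij_betw_def)
      then show "f0 (inv_e j) = i j" by (simp add: inv_e f0_def)
    qed
    then have iff: "column_monom A i = t f \<longleftrightarrow> f = f0" if "f \<in> ?F" for f
      using t_inj[OF that] by auto
    have "Poly_Mapping.lookup (act m g P) (column_monom A i)
      = (\<Sum>f\<in>?F. if f = f0 then det (mat k k (\<lambda>(p, q). N p q (f q))) else 0)"
      unfolding actP lookup_sum
      by (rule sum.cong) (use iff in \<open>auto simp: lookup_Const_mult lookup_monomial\<close>)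
    also have "\<dots> = det (mat k k (\<lambda>(p, q). N p q (f0 q)))"
      using f0 by (simp add: finite_PiE)
    also have "mat k k (\<lambda>(p, q). N p q (f0 q)) = mat k k (\<lambda>(p, q). if p = q then det (g (e q)) else 0)" (is "_ = ?D")
      by (rule eq_matI) (simp_all add: f0_def N_diag)
    also have "det ?D = prod_list (diag_mat ?D)"
      by (rule det_upper_triangular[of _ k]) auto
    also have "\<dots> \<noteq> 0"
      using gj(2)[OF eA] by (auto simp: prod_list_zero_iff diag_mat_def)
    finally show ?thesis .
  qed
  ultimately show ?thesis using P_in by blast
qed

section \<open>Genericity\<close>

definition poly_fun :: "nat \<Rightarrow> nat \<Rightarrow> ((nat \<Rightarrow> 'k::field mat) \<Rightarrow> 'k) \<Rightarrow> bool" where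
  "poly_fun m n F \<longleftrightarrow> (\<exists>p\<in>Polys ({1..n} \<times> {1..m} \<times> {1..m}).
     \<forall>g\<in>GL_prod m n. peval id (\<lambda>(j, i, k). g j $$ (i - 1, k - 1)) p = F g)"

lemma poly_fun_cong:
  assumes "poly_fun m n F" "\<And>g. g \<in> GL_prod m n \<Longrightarrow> F g = F' g"
  shows "poly_fun m n F'"
  using assms by (auto simp: poly_fun_def)

lemma poly_fun_const: "poly_fun m n (\<lambda>_. a)"
  unfolding poly_fun_def by (intro bexI[of _ "Const a"]) (simp_all add: peval_Const[OF comm_ring_hom_id])

lemma poly_fun_entry:
  assumes "j \<in> {1..n}" "i < m" "k < m"
  shows "poly_fun m n (\<lambda>g. g j $$ (i, k))"
  unfolding poly_fun_def using assms
  by (intro bexI[of _ "Var (j, Suc i, Suc k)"]) (auto simp: peval_Var[OF comm_ring_hom_id] intro!: Polys_Var)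

lemma poly_fun_add:
  assumes "poly_fun m n F" "poly_fun m n F'"
  shows "poly_fun m n (\<lambda>g. F g + F' g)"
proof -
  obtain p q where "p \<in> Polys ({1..n} \<times> {1..m} \<times> {1..m})" "q \<in> Polys ({1..n} \<times> {1..m} \<times> {1..m})"
    "\<forall>g\<in>GL_prod m n. peval id (\<lambda>(j, i, k). g j $$ (i - 1, k - 1)) p = F g"
    "\<forall>g\<in>GL_prod m n. peval id (\<lambda>(j, i, k). g j $$ (i - 1, k - 1)) q = F' g"
    using assms by (auto simp: poly_fun_def)
  then show ?thesis
    unfolding poly_fun_def by (intro bexI[of _ "p + q"]) (simp_all add: peval_add Polys_add)
qed

lemma poly_fun_mult:
  assumes "poly_fun m n F" "poly_fun m n F'"
  shows "poly_fun m n (\<lambda>g. F g * F' g)"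
proof -
  obtain p q where "p \<in> Polys ({1..n} \<times> {1..m} \<times> {1..m})" "q \<in> Polys ({1..n} \<times> {1..m} \<times> {1..m})"
    "\<forall>g\<in>GL_prod m n. peval id (\<lambda>(j, i, k). g j $$ (i - 1, k - 1)) p = F g"
    "\<forall>g\<in>GL_prod m n. peval id (\<lambda>(j, i, k). g j $$ (i - 1, k - 1)) q = F' g"
    using assms by (auto simp: poly_fun_def)
  then show ?thesis
    unfolding poly_fun_def
    by (intro bexI[of _ "p * q"]) (simp_all add: peval_mult[OF comm_ring_hom_id] Polys_mult)
qed

lemma poly_fun_sum: "(\<And>x. x \<in> B \<Longrightarrow> poly_fun m n (F x)) \<Longrightarrow> poly_fun m n (\<lambda>g. \<Sum>x\<in>B. F x g)"
  by (induction B rule: infinite_finite_induct) (simp_all add: poly_fun_const poly_fun_add)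

lemma poly_fun_prod: "(\<And>x. x \<in> B \<Longrightarrow> poly_fun m n (F x)) \<Longrightarrow> poly_fun m n (\<lambda>g. \<Prod>x\<in>B. F x g)"
  by (induction B rule: infinite_finite_induct) (simp_all add: poly_fun_const poly_fun_mult)

lemma poly_fun_det:
  assumes entries: "\<And>r c. r < k \<Longrightarrow> c < k \<Longrightarrow> poly_fun m n (\<lambda>g. B g $$ (r, c))"
    and dims: "\<And>g. g \<in> GL_prod m n \<Longrightarrow> B g \<in> carrier_mat k k"
  shows "poly_fun m n (\<lambda>g. det (B g))"
proof (rule poly_fun_cong)
  show "poly_fun m n (\<lambda>g. \<Sum>\<sigma> | \<sigma> permutes {0..<k}. signof \<sigma> * (\<Prod>r = 0..<k. B g $$ (r, \<sigma> r)))"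
  proof (intro poly_fun_sum poly_fun_mult poly_fun_const poly_fun_prod)
    fix \<sigma> r assume "\<sigma> \<in> {\<sigma>. \<sigma> permutes {0..<k}}" "r \<in> {0..<k}"
    then show "poly_fun m n (\<lambda>g. B g $$ (r, \<sigma> r))"
      using permutes_in_image[of \<sigma> "{0..<k}" r] by (intro entries) auto
  qed
qed (simp add: det_def'[OF dims])

lemma GL_prod_carrier: "g \<in> GL_prod m n \<Longrightarrow> j \<in> {1..n} \<Longrightarrow> g j \<in> carrier_mat m m"
  by (auto simp: GL_prod_def GL_def)

lemma poly_fun_adj:
  assumes "j \<in> {1..n}" "r < m" "c < m"
  shows "poly_fun m n (\<lambda>g :: nat \<Rightarrow> 'k::field mat. adj_mat (g j) $$ (r, c))"
proof (rule poly_fun_cong)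
  \<comment> \<open>The indices are swapped since the adjugate is the transpose of the cofactor
    matrix.\<close>
  show "poly_fun m n (\<lambda>g :: nat \<Rightarrow> 'k mat. (- 1) ^ (c + r) * det (mat_delete (g j) c r))"
  proof (intro poly_fun_mult poly_fun_const poly_fun_det[of "m - 1"])
    fix a b assume ab: "a < m - 1" "b < m - 1"
    show "poly_fun m n (\<lambda>g :: nat \<Rightarrow> 'k mat. mat_delete (g j) c r $$ (a, b))"
    proof (rule poly_fun_cong)
      show "poly_fun m n (\<lambda>g :: nat \<Rightarrow> 'k mat. g j $$ (if a < c then a else Suc a, if b < r then b else Suc b))"
        by (rule poly_fun_entry) (use assms ab in auto)
      fix g :: "nat \<Rightarrow> 'k mat" assume "g \<in> GL_prod m n"
      then show "g j $$ (if a < c then a else Suc a, if b < r then b else Suc b) = mat_delete (g j) c r $$ (a, b)"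
        using GL_prod_carrier[of g m n j] assms(1) ab by (auto simp: mat_delete_def)
    qed
  qed (use GL_prod_carrier assms(1) in \<open>blast intro: mat_delete_carrier\<close>)
  fix g :: "nat \<Rightarrow> 'k mat" assume "g \<in> GL_prod m n"
  then show "(- 1) ^ (c + r) * det (mat_delete (g j) c r) = adj_mat (g j) $$ (r, c)"
    using GL_prod_carrier[of g m n j] assms by (auto simp: adj_mat_def cofactor_def)
qed

text \<open>There are finitely many determinants, and they are all nonzero if and only if their
  product is, which is a single polynomial in the entries.\<close>

lemma zariski_open_generic: "zariski_open m n {g \<in> GL_prod m n. generic m n (g :: nat \<Rightarrow> 'k::field mat)}"
proof -
  let ?S = "{s \<in> PiE {..<m} (\<lambda>_. {1..n} \<times> {1..m}). inj_on s {..<m}}"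
  have "poly_fun m n (\<lambda>g :: nat \<Rightarrow> 'k mat. \<Prod>s\<in>?S. det (mat m m (\<lambda>(r, c). adj_col g (s c) (Suc r))))"
  proof (intro poly_fun_prod poly_fun_det[of m])
    fix s r c assume s: "s \<in> ?S" and rc: "r < m" "c < m"
    then have sc: "s c \<in> {1..n} \<times> {1..m}" by auto
    then have "poly_fun m n (\<lambda>g :: nat \<Rightarrow> 'k mat. adj_mat (g (fst (s c))) $$ (r, snd (s c) - 1))"
      by (intro poly_fun_adj) (use rc in auto)
    then show "poly_fun m n (\<lambda>g :: nat \<Rightarrow> 'k mat. mat m m (\<lambda>(r, c). adj_col g (s c) (Suc r)) $$ (r, c))"
      by (rule poly_fun_cong) (use rc in \<open>simp add: adj_col_def case_prod_unfold\<close>)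
  qed simp
  then obtain p where p: "p \<in> Polys ({1..n} \<times> {1..m} \<times> {1..m})"
    "\<forall>g\<in>(GL_prod m n :: (nat \<Rightarrow> 'k mat) set). peval id (\<lambda>(j, i, k). g j $$ (i - 1, k - 1)) p =
      (\<Prod>s\<in>?S. det (mat m m (\<lambda>(r, c). adj_col g (s c) (Suc r))))"
    unfolding poly_fun_def by blast
  have "finite ?S" by (rule finite_subset[OF _ finite_PiE[of "{..<m}" "\<lambda>_. {1..n} \<times> {1..m}"]]) auto
  then have "{g \<in> GL_prod m n. generic m n g} =
      {g \<in> GL_prod m n. \<exists>q\<in>{p}. peval id (\<lambda>(j, i, k). g j $$ (i - 1, k - 1)) q \<noteq> 0}"
    using p(2) by (auto simp: generic_def)
  then show ?thesis
    unfolding zariski_open_def using p(1) by (intro exI[of _ "{p}"]) simp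
qed

text \<open>A dependency among the rows is a nonzero polynomial of degree less than \<open>m\<close>
  with the \<open>m\<close> distinct roots \<open>x c\<close>. The factors \<open>d c\<close>
  accommodate the determinants by which adjugates differ from inverses.\<close>

lemma det_vandermonde_nonzero:
  fixes x :: "nat \<Rightarrow> 'k::field"
  assumes inj: "inj_on x {..<m}" and d: "\<And>c. c < m \<Longrightarrow> d c \<noteq> 0"
  shows "det (mat m m (\<lambda>(r, c). d c * x c ^ r)) \<noteq> 0"
proof
  let ?B = "mat m m (\<lambda>(r, c). d c * x c ^ r)"
  assume "det ?B = 0"
  then have "det (transpose_mat ?B) = 0" by (subst det_transpose[of _ m]) auto
  then obtain v where v: "v \<in> carrier_vec m" "v \<noteq> 0\<^sub>v m" "transpose_mat ?B *\<^sub>v v = 0\<^sub>v m"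
    using det_0_iff_vec_prod_zero[of "transpose_mat ?B" m] by auto
  define q where "q = (\<Sum>r<m. Polynomial.monom (v $ r) r)"
  have coeff: "coeff q r = (if r < m then v $ r else 0)" for r
    by (simp add: q_def coeff_sum)
  obtain r where r: "r < m" "v $ r \<noteq> 0" using v(1,2) by (auto simp: vec_eq_iff)
  then have q0: "q \<noteq> 0" using coeff[of r] by auto
  have "degree q \<le> m - 1" by (rule degree_le) (auto simp: coeff)
  then have deg: "degree q < m" using r(1) by linarith
  have root: "poly q (x c) = 0" if "c < m" for c
  proof -
    have "0 = (transpose_mat ?B *\<^sub>v v) $ c" using v(3) that by simp
    also have "\<dots> = (\<Sum>r<m. d c * x c ^ r * v $ r)"
      using that v(1) by (simp add: scalar_prod_def atLeast0LessThan)
    also have "\<dots> = d c * poly q (x c)"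
      by (simp add: q_def poly_sum poly_monom sum_distrib_left mult_ac)
    finally show ?thesis using d[OF that] by simp
  qed
  have "m = card (x ` {..<m})" using card_image[OF inj] by simp
  also have "\<dots> \<le> card {y. poly q y = 0}"
    using root q0 by (intro card_mono poly_roots_finite) auto
  also have "\<dots> \<le> degree q" by (rule card_poly_roots_bound[OF q0])
  finally show False using deg by simp
qed

text \<open>The columns of the inverses of the \<open>g j\<close> are taken on the moment curve.\<close>

lemma exists_generic:
  assumes inf: "infinite (UNIV :: 'k::field set)"
  shows "\<exists>g :: nat \<Rightarrow> 'k mat. g \<in> GL_prod m n \<and> generic m n g"
proof -
  let ?V = "{1..n} \<times> {1..m}"
  \<comment> \<open>A separate parameter for each pair of a column and a row: distinct points are
    also needed between columns taken from different matrices.\<close>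
  obtain T where T: "finite T" "card T = card ?V" "T \<subseteq> (UNIV :: 'k set)"
    using infinite_arbitrarily_large[OF inf] by blast
  then obtain \<xi> where "bij_betw \<xi> ?V T"
    using finite_same_card_bij[of ?V T] by auto
  then have inj: "inj_on \<xi> ?V" by (simp add: bij_betw_def)
  define H where "H j = mat m m (\<lambda>(r, c). \<xi> (j, Suc c) ^ r)" for j
  have Hc: "H j \<in> carrier_mat m m" for j by (simp add: H_def)
  have "\<exists>B. B \<in> carrier_mat m m \<and> B * H j = 1\<^sub>m m \<and> H j * B = 1\<^sub>m m" if "j \<in> {1..n}" for j
  proof -
    have "inj_on (\<lambda>c. \<xi> (j, Suc c)) {..<m}"
    proof (rule inj_onI)
      fix a b assume "a \<in> {..<m}" "b \<in> {..<m}" "\<xi> (j, Suc a) = \<xi> (j, Suc b)"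
      then show "a = b" using inj_onD[OF inj, of "(j, Suc a)" "(j, Suc b)"] that by simp
    qed
    then have "det (H j) \<noteq> 0"
      using det_vandermonde_nonzero[of "\<lambda>c. \<xi> (j, Suc c)" m "\<lambda>_. 1"] by (simp add: H_def)
    then have "H j \<in> Units (ring_mat TYPE('k) m ())" by (rule det_non_zero_imp_unit[OF Hc])
    then show ?thesis by (auto simp: Units_def ring_mat_def)
  qed
  then obtain B where B: "\<And>j. j \<in> {1..n} \<Longrightarrow> B j \<in> carrier_mat m m \<and> B j * H j = 1\<^sub>m m \<and> H j * B j = 1\<^sub>m m"
    by metis
  define g where "g = restrict B {1..n}"
  have g: "g j \<in> carrier_mat m m" "g j * H j = 1\<^sub>m m" "H j * g j = 1\<^sub>m m" if "j \<in> {1..n}" for j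
    using B[OF that] that by (auto simp: g_def)
  have gGL: "g \<in> GL_prod m n"
    unfolding GL_prod_def
  proof (rule PiE_I)
    fix j assume "j \<in> {1..n}"
    then show "g j \<in> GL m"
      using g[of j] Hc[of j] by (auto simp: GL_def invertible_mat_def inverts_mat_def intro!: exI[of _ "H j"])
  qed (auto simp: g_def)
  \<comment> \<open>As \<open>H j\<close> inverts \<open>g j\<close>, the adjugate columns are
    points of the curve scaled by \<open>det (g j)\<close>.\<close>
  have adj: "adj_mat (g j) = det (g j) \<cdot>\<^sub>m H j" if j: "j \<in> {1..n}" for j
  proof -
    note a = adj_mat[OF g(1)[OF j]]
    have "adj_mat (g j) = adj_mat (g j) * (g j * H j)" using a(1) g(2)[OF j] by simp
    also have "\<dots> = (adj_mat (g j) * g j) * H j"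
      by (rule assoc_mult_mat[symmetric, OF a(1) g(1)[OF j] Hc])
    also have "\<dots> = det (g j) \<cdot>\<^sub>m H j"
      unfolding a(3) using Hc[of j] by (subst mult_smult_assoc_mat[of _ m m]) auto
    finally show ?thesis .
  qed
  have "generic m n g"
    unfolding generic_def
  proof (intro ballI impI)
    fix s assume s: "s \<in> PiE {..<m} (\<lambda>_. ?V)" and sinj: "inj_on s {..<m}"
    have "inj_on (\<lambda>c. \<xi> (s c)) {..<m}"
    proof -
      have "s ` {..<m} \<subseteq> ?V" using PiE_mem[OF s] by blast
      then show ?thesis using comp_inj_on[OF sinj inj_on_subset[OF inj]] by (simp add: comp_def)
    qed
    moreover have "det (g (fst (s c))) \<noteq> 0" if "c < m" for c
      using det_GL_nonzero(2)[OF gGL, of "fst (s c)"] PiE_mem[OF s, of c] that by (simp add: mem_Times_iff)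
    ultimately have "det (mat m m (\<lambda>(r, c). det (g (fst (s c))) * \<xi> (s c) ^ r)) \<noteq> 0"
      by (rule det_vandermonde_nonzero)
    also have "mat m m (\<lambda>(r, c). det (g (fst (s c))) * \<xi> (s c) ^ r) = mat m m (\<lambda>(r, c). adj_col g (s c) (Suc r))"
    proof (rule eq_matI)
      fix r c assume rc: "r < dim_row (mat m m (\<lambda>(r, c). adj_col g (s c) (Suc r)))"
        "c < dim_col (mat m m (\<lambda>(r, c). adj_col g (s c) (Suc r)))"
      obtain j i where sc: "s c = (j, i)" by force
      have "s c \<in> ?V" using PiE_mem[OF s, of c] rc by simp
      then have ji: "j \<in> {1..n}" "i \<in> {1..m}" by (simp_all add: sc)
      then have "i - 1 < m" "Suc (i - 1) = i" by auto
      then show "mat m m (\<lambda>(r, c). det (g (fst (s c))) * \<xi> (s c) ^ r) $$ (r, c) =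
        mat m m (\<lambda>(r, c). adj_col g (s c) (Suc r)) $$ (r, c)"
        using rc by (simp add: adj_col_def sc adj[OF ji(1)] H_def del: One_nat_def)
    qed simp_all
    finally show "det (mat m m (\<lambda>(r, c). adj_col g (s c) (Suc r))) \<noteq> 0" .
  qed
  with gGL show ?thesis by blast
qed

section \<open>The monomial ideal\<close>

definition gin_monoms :: "nat \<Rightarrow> nat \<Rightarrow> nat set set \<Rightarrow> (nat \<times> nat) monom set" where
  "gin_monoms m n E = {column_monom A i |A i. A \<subseteq> {1..n} \<and> connected_graph A (induced_edges E A) \<and>
     (\<forall>j\<in>A. i j \<in> {1..m}) \<and> (\<Sum>j\<in>A. int (i j)) \<le> int m * (int (card A) - 1)}"

lemma gin_monomsI:
  assumes "A \<subseteq> {1..n}" "connected_graph A (induced_edges E A)" "\<forall>j\<in>A. i j \<in> {1..m}"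
    "(\<Sum>j\<in>A. int (i j)) \<le> int m * (int (card A) - 1)"
  shows "column_monom A i \<in> gin_monoms m n E"
  using assms unfolding gin_monoms_def by blast

lemma gin_monomsE:
  assumes "s \<in> gin_monoms m n E"
  obtains A i where "s = column_monom A i" "finite A" "A \<subseteq> {1..n}" "connected_graph A (induced_edges E A)"
    "\<forall>j\<in>A. i j \<in> {1..m}" "(\<Sum>j\<in>A. int (i j)) \<le> int m * (int (card A) - 1)"
  using assms finite_subset[OF _ finite_atLeastAtMost] unfolding gin_monoms_def by blast

lemma gin_generators_eq: "gin_generators m n E = monomial ` gin_monoms m n E"
  unfolding gin_generators_def gin_monoms_def prod_X by blast

lemma gin_monoms_in_Monoms: "gin_monoms m n E \<subseteq> Monoms (matrix_vars m n)"
proof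
  fix s assume "s \<in> gin_monoms m n E"
  then show "s \<in> Monoms (matrix_vars m n)"
  proof (rule gin_monomsE)
    fix A i assume "s = column_monom A i" "A \<subseteq> {1..n}" "\<forall>j\<in>A. i j \<in> {1..m}"
    then show ?thesis using column_monom_in_Monoms[of A n i m] by blast
  qed
qed

abbreviation gin_multiples :: "nat \<Rightarrow> nat \<Rightarrow> nat set set \<Rightarrow> (nat \<times> nat) monom set" where
  "gin_multiples m n E \<equiv> monom_multiples m n (gin_monoms m n E)"

lemma gin_ideal_eq:
  "Idl\<^bsub>S_ring m n\<^esub> (gin_generators m n E) = {p :: 'k::field pol. Poly_Mapping.keys p \<subseteq> gin_multiples m n E}"
  unfolding gin_generators_eq by (rule genideal_monomials[OF gin_monoms_in_Monoms])

lemma gin_multiples_in_Monoms: "gin_multiples m n E \<subseteq> Monoms (matrix_vars m n)"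
  using gin_monoms_in_Monoms[of m n E] by (auto simp: monom_multiples_def intro!: Monoms_add)

lemma gin_ideal_ideal: "ideal (Idl\<^bsub>S_ring m n\<^esub> (gin_generators m n E :: 'k::field pol set)) (S_ring m n)"
  unfolding gin_generators_eq
  by (rule genideal_S_ring_ideal) (use gin_monoms_in_Monoms in \<open>auto intro!: Polys_monomial\<close>)

text \<open>The generator is squarefree, so divisibility is a matter of supports.\<close>

lemma gin_multiplesI:
  assumes t: "t \<in> Monoms (matrix_vars m n)" and fin: "finite A" and cm: "column_monom A i \<in> gin_monoms m n E"
    and sub: "\<And>j. j \<in> A \<Longrightarrow> (i j, j) \<in> Poly_Mapping.keys t"
  shows "t \<in> gin_multiples m n E"
proof -
  have "Poly_Mapping.lookup (column_monom A i) v \<le> Poly_Mapping.lookup t v" for v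
    using sub[of "snd v"] by (cases v) (auto simp: lookup_column_monom[OF fin] in_keys_iff)
  then have "t = (t - column_monom A i) + column_monom A i"
    by (intro poly_mapping_eqI) (simp add: lookup_add lookup_minus)
  moreover have "t - column_monom A i \<in> Monoms (matrix_vars m n)"
    using t by (auto simp: Monoms_def in_keys_iff lookup_minus)
  ultimately show ?thesis using cm unfolding monom_multiples_def by blast
qed

lemma monomial_ideal_gin: "monomial_ideal m n (Idl\<^bsub>S_ring m n\<^esub> (gin_generators m n E))"
  unfolding monomial_ideal_def gin_generators_eq using gin_monoms_in_Monoms by blast

text \<open>If \<open>p\<close> has a monomial \<open>t\<close> outside the ideal, setting the
  variables not in \<open>t\<close> to 0 kills the ideal: a surviving monomial would have a
  squarefree generator dividing \<open>t\<close>. The image of \<open>p ^ k\<close> is thus 0, and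
  so is that of \<open>p\<close> since there are no zero divisors, yet the term at \<open>t\<close>
  survives.\<close>

lemma radical_ideal_gin: "radical_ideal m n (Idl\<^bsub>S_ring m n\<^esub> (gin_generators m n E :: 'k::field pol set))"
proof -
  have "p \<in> Idl\<^bsub>S_ring m n\<^esub> (gin_generators m n E)"
    if p: "p \<in> Polys (matrix_vars m n)" and pk: "p ^ k \<in> Idl\<^bsub>S_ring m n\<^esub> (gin_generators m n E)"
    for p :: "'k pol" and k
  proof (rule ccontr)
    assume "p \<notin> Idl\<^bsub>S_ring m n\<^esub> (gin_generators m n E)"
    then obtain t where t: "t \<in> Poly_Mapping.keys p" "t \<notin> gin_multiples m n E"
      by (auto simp: gin_ideal_eq)
    have tM: "t \<in> Monoms (matrix_vars m n)" using p t(1) by (auto simp: Polys_def)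
    define f :: "nat \<times> nat \<Rightarrow> 'k pol" where "f v = (if v \<in> Poly_Mapping.keys t then Var v else 0)" for v
    interpret \<pi>: comm_ring_hom "peval Const f" by (rule peval_hom[OF comm_ring_hom_Const])
    have mev0: "mev f s = 0" if "\<not> Poly_Mapping.keys s \<subseteq> Poly_Mapping.keys t" for s
    proof -
      from that obtain v where v: "v \<in> Poly_Mapping.keys s" "v \<notin> Poly_Mapping.keys t" by blast
      then have "f v ^ Poly_Mapping.lookup s v = 0" by (simp add: f_def in_keys_iff)
      then show ?thesis unfolding mev_def using v(1) by (intro prod_zero) auto
    qed
    have mev1: "mev f s = monomial s" if "Poly_Mapping.keys s \<subseteq> Poly_Mapping.keys t" for s
      using that by (subst mev_Var_comp[where h = id]) (auto simp: f_def push_forward_def sum_single_lookup)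
    have "mev f s = 0" if s: "s \<in> gin_multiples m n E" for s
    proof (rule mev0, rule notI)
      assume sub: "Poly_Mapping.keys s \<subseteq> Poly_Mapping.keys t"
      obtain w u where s: "s = w + u" "u \<in> gin_monoms m n E" using s by (auto simp: monom_multiples_def)
      obtain A i where u: "u = column_monom A i" "finite A" using s(2) by (elim gin_monomsE)
      have "(i j, j) \<in> Poly_Mapping.keys s" if "j \<in> A" for j
        using that by (simp add: s(1) u in_keys_iff lookup_add lookup_column_monom[OF u(2)])
      then have "t \<in> gin_multiples m n E"
        using sub s(2) by (intro gin_multiplesI[OF tM u(2)]) (auto simp: u(1))
      with t(2) show False ..
    qed
    then have "peval Const f (p ^ k) = 0"
      using pk unfolding peval_def mev_def[symmetric]
      by (intro sum.neutral) (auto simp: gin_ideal_eq)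
    then have "peval Const f p ^ k = 0" by (simp add: \<pi>.hom_power)
    then have "peval Const f p = 0" by simp
    moreover have "Poly_Mapping.lookup (peval Const f p) t = Poly_Mapping.lookup p t"
    proof -
      have "Poly_Mapping.lookup (mev f s) t = (if s = t then 1 else 0)" for s
        by (cases "Poly_Mapping.keys s \<subseteq> Poly_Mapping.keys t") (auto simp: mev0 mev1 lookup_monomial)
      then have "Poly_Mapping.lookup (peval Const f p) t
          = (\<Sum>s\<in>Poly_Mapping.keys p. if s = t then Poly_Mapping.lookup p s else 0)"
        unfolding peval_def mev_def[symmetric] lookup_sum
        by (intro sum.cong) (auto simp: lookup_Const_mult)
      then show ?thesis using t(1) by simp
    qed
    ultimately show False using t(1) by (simp add: in_keys_iff)
  qed
  then show ?thesis using gin_ideal_ideal[of m n E] by (auto simp: radical_ideal_def)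
qed

section \<open>Borel-fixedness\<close>

lemma upper_triangular_left_inverse:
  fixes A :: "'k::field mat"
  assumes A: "A \<in> carrier_mat m m" "upper_triangular A" and B: "B \<in> carrier_mat m m" and BA: "B * A = 1\<^sub>m m"
  shows "upper_triangular B"
proof -
  have "det B * det A = 1" using A B BA by (simp flip: det_mult)
  then have "det A \<noteq> 0" by auto
  then have "prod_list (diag_mat A) \<noteq> 0" using det_upper_triangular[OF A(2,1)] by simp
  then have diag: "A $$ (j, j) \<noteq> 0" if "j < m" for j
    using A(1) that by (auto simp: prod_list_zero_iff diag_mat_def)
  \<comment> \<open>Columns from left to right: in entry \<open>(i, j)\<close> of
    \<open>B * A\<close> earlier columns of \<open>B\<close> give 0 by induction and later rows of
    \<open>A\<close> by triangularity, which leaves \<open>B (i, j)\<close> times a nonzero diagonal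
    entry.\<close>
  have "\<forall>i<m. j < i \<longrightarrow> B $$ (i, j) = 0" for j
  proof (induction j rule: less_induct)
    case (less j)
    show ?case
    proof (intro allI impI)
      fix i assume i: "i < m" "j < i"
      have "0 = (B * A) $$ (i, j)" using i by (simp add: BA)
      also have "\<dots> = (\<Sum>k<m. B $$ (i, k) * A $$ (k, j))"
        using A(1) B i by (auto simp: scalar_prod_def atLeast0LessThan)
      also have "\<dots> = (\<Sum>k<m. if k = j then B $$ (i, j) * A $$ (j, j) else 0)"
      proof (rule sum.cong[OF refl])
        fix k assume k: "k \<in> {..<m}"
        consider "k < j" | "k = j" | "j < k" by linarith
        then show "B $$ (i, k) * A $$ (k, j) = (if k = j then B $$ (i, j) * A $$ (j, j) else 0)"
        proof cases
          case 1
          then show ?thesis using less i by auto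
        next
          case 3
          then show ?thesis using A k by (auto simp: upper_triangular_def)
        qed simp
      qed
      finally show "B $$ (i, j) = 0" using diag[of j] i by simp
    qed
  qed
  then show ?thesis using B by (auto simp: upper_triangular_def)
qed

text \<open>Upper triangular matrices replace a row by rows with smaller or equal index. This can
  only decrease the sum of the rows, so the bound is kept.\<close>

lemma act_gin_ideal_subset:
  fixes g :: "nat \<Rightarrow> 'k::field mat"
  assumes g: "g \<in> Borel_prod m n" and p: "p \<in> Idl\<^bsub>S_ring m n\<^esub> (gin_generators m n E)"
  shows "act m g p \<in> Idl\<^bsub>S_ring m n\<^esub> (gin_generators m n E)"
proof -
  let ?J = "Idl\<^bsub>S_ring m n\<^esub> (gin_generators m n E) :: 'k pol set"
  interpret act: comm_ring_hom "act m g" by (rule act_hom)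
  interpret C: comm_ring_hom "Const :: 'k \<Rightarrow> 'k pol" by (rule comm_ring_hom_Const)
  have sub: "pol_vs.subspace ?J" by (rule ideal_subspace[OF gin_ideal_ideal])
  have gen: "act m g (monomial s) \<in> ?J" if s: "s \<in> gin_monoms m n E" for s
    using s
  proof (rule gin_monomsE)
    fix A i assume s: "s = column_monom A i" and fin: "finite A" and A: "A \<subseteq> {1..n}"
      and conn: "connected_graph A (induced_edges E A)" and i: "\<forall>j\<in>A. i j \<in> {1..m}"
      and le: "(\<Sum>j\<in>A. int (i j)) \<le> int m * (int (card A) - 1)"
    have "act m g (monomial s) = (\<Prod>j\<in>A. \<Sum>k=1..m. Const (g j $$ (k - 1, i j - 1)) * X k j)"
      by (simp add: s prod_X[symmetric] act.hom_prod act_X linform_def)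
    also have "\<dots> = (\<Sum>f\<in>PiE A (\<lambda>_. {1..m}). \<Prod>j\<in>A. Const (g j $$ (f j - 1, i j - 1)) * X (f j) j)"
      using fin by (intro prod_sum_PiE) auto
    also have "\<dots> = (\<Sum>f\<in>PiE A (\<lambda>_. {1..m}). pol_scale (\<Prod>j\<in>A. g j $$ (f j - 1, i j - 1)) (monomial (column_monom A f)))"
      by (simp add: prod.distrib prod_X C.hom_prod pol_scale_def)
    also have "\<dots> \<in> ?J"
    proof (rule pol_vs.subspace_sum[OF sub])
      fix f assume f: "f \<in> PiE A (\<lambda>_. {1..m})"
      show "pol_scale (\<Prod>j\<in>A. g j $$ (f j - 1, i j - 1)) (monomial (column_monom A f)) \<in> ?J"
      proof (cases "\<forall>j\<in>A. f j \<le> i j")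
        case True
        then have "(\<Sum>j\<in>A. int (f j)) \<le> (\<Sum>j\<in>A. int (i j))" by (intro sum_mono) simp
        then have "column_monom A f \<in> gin_monoms m n E"
          using A conn le PiE_mem[OF f] by (intro gin_monomsI) auto
        then have "monomial (column_monom A f) \<in> gin_generators m n E"
          by (simp add: gin_generators_eq)
        then have "monomial (column_monom A f) \<in> ?J"
          using genideal_S_ring_superset[of "gin_generators m n E :: 'k pol set" m n] gin_monoms_in_Monoms[of m n E]
          by (auto simp: gin_generators_eq intro: Polys_monomial)
        then show ?thesis by (rule pol_vs.subspace_scale[OF sub])
      next
        case False
        then obtain j where j: "j \<in> A" "i j < f j" by auto
        have "g j \<in> carrier_mat m m" "upper_triangular (g j)"
          using g j(1) A by (auto simp: Borel_prod_def GL_def)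
        moreover have "f j \<in> {1..m}" "i j \<in> {1..m}" using PiE_mem[OF f j(1)] i j(1) by auto
        ultimately have "g j $$ (f j - 1, i j - 1) = 0"
          using j(2) by (auto simp: upper_triangular_def)
        then have "(\<Prod>j\<in>A. g j $$ (f j - 1, i j - 1)) = 0"
          using fin j(1) by (intro prod_zero) auto
        then show ?thesis using pol_vs.subspace_0[OF sub] by simp
      qed
    qed
    finally show ?thesis .
  qed
  have mon: "act m g (monomial t) \<in> ?J" if t: "t \<in> gin_multiples m n E" for t
  proof -
    obtain w s where ws: "t = w + s" "w \<in> Monoms (matrix_vars m n)" "s \<in> gin_monoms m n E"
      using t by (auto simp: monom_multiples_def)
    have "act m g (monomial w) \<in> Polys (matrix_vars m n)"
      by (rule act_in_Polys[OF Polys_monomial[OF ws(2)]])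
    then show ?thesis
      using gen[OF ws(3)] gin_ideal_ideal[of m n E, where 'k = 'k]
      unfolding ws(1) monomial_add act_mult ideal_S_ring_iff by blast
  qed
  have "act m g p = (\<Sum>t\<in>Poly_Mapping.keys p. pol_scale (Poly_Mapping.lookup p t) (act m g (monomial t)))"
    by (subst sum_single_lookup[of p, symmetric]) (simp only: act.hom_sum act_single)
  also have "\<dots> \<in> ?J"
    using p by (intro pol_vs.subspace_sum[OF sub] pol_vs.subspace_scale[OF sub] mon) (auto simp: gin_ideal_eq)
  finally show ?thesis .
qed

lemma borel_fixed_gin: "borel_fixed m n (Idl\<^bsub>S_ring m n\<^esub> (gin_generators m n E :: 'k::field pol set))"
  unfolding borel_fixed_def
proof (intro ballI Set.equalityI)
  fix g :: "nat \<Rightarrow> 'k mat" assume g: "g \<in> Borel_prod m n"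
  let ?J = "Idl\<^bsub>S_ring m n\<^esub> (gin_generators m n E) :: 'k pol set"
  show "act m g ` ?J \<subseteq> ?J" using act_gin_ideal_subset[OF g] by blast
  have "g \<in> GL_prod m n" using g by (auto simp: Borel_prod_def GL_prod_def PiE_iff)
  then obtain h where h: "h \<in> GL_prod m n"
    "\<And>j. j \<in> {1..n} \<Longrightarrow> g j \<in> carrier_mat m m \<and> h j \<in> carrier_mat m m \<and> g j * h j = 1\<^sub>m m"
    "\<And>j. j \<in> {1..n} \<Longrightarrow> h j \<in> carrier_mat m m \<and> g j \<in> carrier_mat m m \<and> h j * g j = 1\<^sub>m m"
    using GL_prod_inverse by blast
  have "h \<in> Borel_prod m n"
    unfolding Borel_prod_def
  proof (rule PiE_I)
    fix j assume j: "j \<in> {1..n}"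
    then have "upper_triangular (g j)" using g by (auto simp: Borel_prod_def)
    then have "upper_triangular (h j)"
      using h(3)[OF j] upper_triangular_left_inverse[of "g j" m "h j"] by blast
    then show "h j \<in> {A \<in> GL m. upper_triangular A}" using h(1) j by (auto simp: GL_prod_def)
  qed (use h(1) in \<open>auto simp: GL_prod_def PiE_def extensional_def\<close>)
  note hJ = act_gin_ideal_subset[OF this]
  show "?J \<subseteq> act m g ` ?J"
  proof
    fix p assume p: "p \<in> ?J"
    then have "p \<in> Polys (matrix_vars m n)" using gin_ideal_ideal[of m n E] by (auto simp: ideal_S_ring_iff)
    then have "p = act m g (act m h p)"
      using act_inverse[where g = g and h = h and m = m and n = n and p = p] h(2) by auto
    then show "p \<in> act m g ` ?J" using hJ[OF p] by blast
  qed
qed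

section \<open>The generic initial ideal\<close>

lemma term_order_linear: "term_order m n r \<Longrightarrow> linear_order_on (Monoms (matrix_vars m n)) r"
  by (simp add: term_order_def)

lemma term_order_add:
  assumes r: "term_order m n r" and st: "(s, t) \<in> r" "(s', t') \<in> r"
  shows "(s + s', t + t') \<in> r"
proof -
  have M: "s' \<in> Monoms (matrix_vars m n)" "t \<in> Monoms (matrix_vars m n)"
    using term_order_linear[OF r] st by (auto simp: order_on_defs)
  have "(s + s', t + s') \<in> r" "(s' + t, t' + t) \<in> r"
    using r st M by (auto simp: term_order_def)
  moreover have "trans r" using term_order_linear[OF r] by (simp add: order_on_defs)
  ultimately show ?thesis by (auto simp: add.commute dest: transD)
qed

abbreviation rows_decreasing :: "nat \<Rightarrow> nat \<Rightarrow> (nat \<times> nat) monom rel \<Rightarrow> bool" where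
  "rows_decreasing m n r \<equiv> \<forall>j\<in>{1..n}. \<forall>i\<in>{1..<m}.
    (Poly_Mapping.single (i + 1, j) 1, Poly_Mapping.single (i, j) 1) \<in> r - Id"

lemma column_monom_le:
  assumes r: "term_order m n r" "rows_decreasing m n r" and fin: "finite A" and A: "A \<subseteq> {1..n}"
    and i: "\<forall>j\<in>A. 1 \<le> i j \<and> i j \<le> i' j \<and> i' j \<le> m"
  shows "(column_monom A i', column_monom A i) \<in> r"
proof -
  note lin = term_order_linear[OF r(1)]
  have refl: "(t, t) \<in> r" if "t \<in> Monoms (matrix_vars m n)" for t
    using lin that by (auto simp: order_on_defs refl_on_def)
  have trans: "trans r" using lin by (simp add: order_on_defs)
  have single: "(Poly_Mapping.single (b, j) 1, Poly_Mapping.single (a, j) 1) \<in> r"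
    if "j \<in> {1..n}" "1 \<le> a" "a \<le> b" "b \<le> m" for a b j
    using that(3,4)
  proof (induction b rule: dec_induct)
    case base
    then show ?case using that by (intro refl Monoms_single) (auto simp: matrix_vars_def)
  next
    case (step b)
    then have "(Poly_Mapping.single (b + 1, j) 1, Poly_Mapping.single (b, j) 1) \<in> r"
      using r(2) that by auto
    with step trans show ?case by (auto dest: transD)
  qed
  show ?thesis
    using fin A i
  proof (induction A rule: finite_induct)
    case empty
    then show ?case by (simp add: column_monom_def refl)
  next
    case (insert j A)
    have "column_monom (insert j A) f = Poly_Mapping.single (f j, j) 1 + column_monom A f" for f
      using insert.hyps by (simp add: column_monom_def)
    moreover have "(Poly_Mapping.single (i' j, j) 1, Poly_Mapping.single (i j, j) 1) \<in> r"
      using insert.prems by (intro single) auto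
    moreover have "(column_monom A i', column_monom A i) \<in> r"
      using insert by auto
    ultimately show ?case by (simp only: term_order_add[OF r(1)])
  qed
qed

lemma lookup_monomial_mult: "Poly_Mapping.lookup (monomial w * q) (w + s) = Poly_Mapping.lookup (q :: 'k::field pol) s"
proof (induction q rule: poly_mapping_single_induct)
  case (single t c)
  then show ?case by (simp add: monomial_def mult_single lookup_single when_def)
next
  case (add p q)
  then show ?case by (simp add: distrib_left lookup_add)
qed

text \<open>The witness for the dividing generator is multiplied by the cofactor \<open>w\<close>;
  it stays homogeneous because all its monomials have degree one in each column of \<open>A\<close>
  apart from \<open>w\<close>.\<close>

lemma gin_multiples_leading:
  fixes g :: "nat \<Rightarrow> 'k::field mat"
  assumes G: "simple_graph {1..n} E" and g: "g \<in> GL_prod m n" "generic m n g"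
    and r: "term_order m n r" "rows_decreasing m n r"
    and t: "t \<in> gin_multiples m n E"
  shows "t \<in> leads r (graded_piece (act m g ` binomial_edge_ideal m n E) (multideg t))"
proof -
  let ?gI = "act m g ` binomial_edge_ideal m n E :: 'k pol set"
  obtain w s where ws: "t = w + s" "w \<in> Monoms (matrix_vars m n)" "s \<in> gin_monoms m n E"
    using t by (auto simp: monom_multiples_def)
  obtain A i where A: "s = column_monom A i" "finite A" "A \<subseteq> {1..n}" "connected_graph A (induced_edges E A)"
    "\<forall>j\<in>A. i j \<in> {1..m}" "(\<Sum>j\<in>A. int (i j)) \<le> int m * (int (card A) - 1)"
    using ws(3) by (elim gin_monomsE)
  obtain P where P: "P \<in> binomial_edge_ideal m n E" "Poly_Mapping.lookup (act m g P) s \<noteq> 0"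
    "Poly_Mapping.keys (act m g P) \<subseteq> {column_monom A i' |i'. \<forall>j\<in>A. i j \<le> i' j \<and> i' j \<le> m}"
    using exists_leading_element[OF G g A(3-6)] unfolding A(1) by blast
  define Q where "Q = monomial w * act m g P"
  have "?gI \<subseteq> Polys (matrix_vars m n)" "Q \<in> ?gI"
    using graded_ideal_act[OF g(1) graded_binomial_edge_ideal[OF G]] P(1) Polys_monomial[OF ws(2)]
    by (auto simp: graded_ideal_def ideal_S_ring_iff Q_def)
  have tQ: "t \<in> Poly_Mapping.keys Q"
    using P(2) by (simp add: in_keys_iff Q_def ws(1) lookup_monomial_mult)
  have keysQ: "\<exists>i'. u = w + column_monom A i' \<and> (\<forall>j\<in>A. i j \<le> i' j \<and> i' j \<le> m)"
    if "u \<in> Poly_Mapping.keys Q" for u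
  proof -
    from that obtain v where "u = w + v" "v \<in> Poly_Mapping.keys (act m g P)"
      using keys_mult[of "monomial w" "act m g P"] by (auto simp: Q_def)
    then show ?thesis using P(3) by blast
  qed
  have deg: "multideg (w + column_monom A i') = multideg w + (\<Sum>j\<in>A. Poly_Mapping.single j 1)" for i'
    by (simp add: multideg_add column_monom_def multideg_sum)
  have lead: "lead_monom r Q = t"
  proof (rule lead_monom_eqI[OF _ tQ])
    show "antisym r" using term_order_linear[OF r(1)] by (simp add: order_on_defs)
    fix u assume "u \<in> Poly_Mapping.keys Q"
    then obtain i' where i': "u = w + column_monom A i'" "\<forall>j\<in>A. i j \<le> i' j \<and> i' j \<le> m"
      using keysQ by blast
    have "(column_monom A i', s) \<in> r"
      unfolding A(1) by (rule column_monom_le[OF r A(2,3)]) (use A(5) i'(2) in auto)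
    moreover have "(w, w) \<in> r"
      using term_order_linear[OF r(1)] ws(2) by (auto simp: order_on_defs refl_on_def)
    ultimately show "(u, t) \<in> r"
      unfolding i'(1) ws(1) by (intro term_order_add[OF r(1)])
  qed
  have "Q \<in> graded_piece ?gI (multideg t)"
    unfolding graded_piece_def
  proof (intro CollectI conjI ballI)
    fix u assume "u \<in> Poly_Mapping.keys Q"
    then show "multideg u = multideg t" using keysQ[of u] by (auto simp: ws(1) A(1) deg)
  qed (rule \<open>Q \<in> ?gI\<close>)
  moreover have "Q \<noteq> 0" using tQ by auto
  ultimately show ?thesis using lead by (rule leadsI)
qed

text \<open>If the inequality fails for a component, the product of its topmost entries is a
  generator that divides \<open>t\<close>; the component is connected as a generator
  requires.\<close>

lemma non_multiples_standard:
  assumes m: "t \<in> monoms_of_degree m n a" and nt: "t \<notin> gin_multiples m n E"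
  shows "t \<in> standard_monoms m n E a"
  unfolding standard_monoms_def
proof (intro CollectI conjI ballI)
  fix j assume j: "j \<in> Poly_Mapping.keys a"
  let ?C = "component E (Poly_Mapping.keys a) j"
  have tM: "t \<in> Monoms (matrix_vars m n)" and deg: "multideg t = a"
    using m by (auto simp: monoms_of_degree_def)
  have CA: "?C \<subseteq> Poly_Mapping.keys a" by (rule component_subset[OF j])
  then have fin: "finite ?C" by (rule finite_subset) simp
  have top: "(top_row t l, l) \<in> Poly_Mapping.keys t" if "l \<in> ?C" for l
    using top_row_in[of l t] CA that deg by auto
  have bounds: "l \<in> {1..n}" "top_row t l \<in> {1..m}" if "l \<in> ?C" for l
    using top[OF that] tM by (auto simp: Monoms_def matrix_vars_def)
  show "(\<Sum>l\<in>?C. m - top_row t l) < m"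
  proof (rule ccontr)
    assume "\<not> (\<Sum>l\<in>?C. m - top_row t l) < m"
    then have "int m \<le> int (\<Sum>l\<in>?C. m - top_row t l)" by (simp only: of_nat_le_iff not_less)
    also have "\<dots> = (\<Sum>l\<in>?C. int m - int (top_row t l))"
      unfolding of_nat_sum by (rule sum.cong) (use bounds in \<open>auto simp: of_nat_diff\<close>)
    also have "\<dots> = int m * int (card ?C) - (\<Sum>l\<in>?C. int (top_row t l))"
      by (simp add: sum_subtractf)
    finally have "column_monom ?C (top_row t) \<in> gin_monoms m n E"
      using bounds by (intro gin_monomsI connected_component[OF j]) (auto simp: algebra_simps)
    then have "t \<in> gin_multiples m n E" using top by (intro gin_multiplesI[OF tM fin])
    with nt show False ..
  qed
qed (rule m)

text \<open>A sandwich: the monomials of \<open>J\<close> in degree \<open>a\<close> lie among the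
  leading monomials, whose number is the dimension of the graded piece, and this dimension is at
  most the number of monomials of \<open>J\<close>.\<close>

lemma leads_graded_piece:
  fixes g :: "nat \<Rightarrow> 'k::field mat"
  assumes G: "simple_graph {1..n} E" and g: "g \<in> GL_prod m n" "generic m n g"
    and r: "term_order m n r" "rows_decreasing m n r"
  shows leads_graded_piece_eq: "leads r (graded_piece (act m g ` binomial_edge_ideal m n E) a)
      = gin_multiples m n E \<inter> monoms_of_degree m n a"
    and dim_graded_piece_eq: "pol_vs.dim (graded_piece (binomial_edge_ideal m n E :: 'k pol set) a)
      = card (gin_multiples m n E \<inter> monoms_of_degree m n a)"
proof -
  let ?I = "binomial_edge_ideal m n E :: 'k pol set"
  let ?T = "monoms_of_degree m n a"
  let ?J = "gin_multiples m n E \<inter> ?T"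
  note lin = term_order_linear[OF r(1)]
  have T: "?T \<subseteq> Monoms (matrix_vars m n)" "finite ?T"
    by (auto simp: monoms_of_degree_def finite_monoms_of_degree[unfolded monoms_of_degree_def])
  have pieces: "pol_vs.subspace (graded_piece I a)" "graded_piece I a \<subseteq> {p. Poly_Mapping.keys p \<subseteq> ?T}"
    if I: "graded_ideal m n I" for I :: "'k pol set"
  proof -
    have id: "ideal I (S_ring m n)" using I by (simp add: graded_ideal_def)
    show "pol_vs.subspace (graded_piece I a)"
      unfolding graded_piece_eq by (intro pol_vs.subspace_inter ideal_subspace[OF id] subspace_homogeneous)
    show "graded_piece I a \<subseteq> {p. Poly_Mapping.keys p \<subseteq> ?T}"
      using id by (auto simp: graded_piece_def ideal_S_ring_iff Polys_def monoms_of_degree_def)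
  qed
  have gr: "graded_ideal m n ?I" by (rule graded_binomial_edge_ideal[OF G])
  note grg = graded_ideal_act[OF g(1) gr]
  have "?I \<subseteq> Polys (matrix_vars m n)" using gr by (auto simp: graded_ideal_def ideal_S_ring_iff)
  then have "graded_piece ?I a \<subseteq> Polys (matrix_vars m n)" "graded_piece (act m g ` ?I) a = act m g ` graded_piece ?I a"
    by (simp_all only: graded_piece_act[OF g(1)]) (auto simp: graded_piece_def)
  then have "pol_vs.dim (graded_piece (act m g ` ?I) a) = pol_vs.dim (graded_piece ?I a)"
    using dim_act[OF g(1) pieces(1)[OF gr]] by simp
  then have card_eq: "card (leads r (graded_piece (act m g ` ?I) a)) = pol_vs.dim (graded_piece ?I a)"
    using card_leads_eq_dim[OF lin T pieces[OF grg]] by simp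
  have sub: "?J \<subseteq> leads r (graded_piece (act m g ` ?I) a)"
    using gin_multiples_leading[OF G g r] by (auto simp: monoms_of_degree_def)
  have fin: "finite (leads r (graded_piece (act m g ` ?I) a))"
    using leads_subset[OF lin T(1) pieces(2)[OF grg]] T(2) by (rule finite_subset)
  have le: "pol_vs.dim (graded_piece ?I a) \<le> card ?J"
  \<comment> \<open>For a degree without monomials, \<open>a\<close> may have support outside
    \<open>{1..n}\<close>, where the counting lemmas do not apply.\<close>
  proof (cases "?T = {}")
    case True
    then have "leads r (graded_piece ?I a) = {}"
      using leads_subset[OF lin T(1) pieces(2)[OF gr]] by auto
    then show ?thesis using card_leads_eq_dim[OF lin T pieces[OF gr]] by simp
  next
    case False
    then obtain t where "t \<in> Monoms (matrix_vars m n)" "multideg t = a" by (auto simp: monoms_of_degree_def)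
    then have keys: "Poly_Mapping.keys a \<subseteq> {1..n}"
      by (auto simp: Monoms_def matrix_vars_def elim!: keys_multideg_obtain)
    \<comment> \<open>With \<open>F\<close> the set of merged monomials,
      \<open>dim I_a \<le> |T| - |F|\<close>, while \<open>|T - J| \<le> |F|\<close> through the
      standard monomials; together \<open>dim I_a \<le> |J|\<close>.\<close>
    have "card (leads r (graded_piece ?I a)) + card (merge_columns E (Poly_Mapping.keys a) ` ?T) \<le> card ?T"
      by (rule card_leads_fibres[OF lin T pieces(2)[OF gr] binomial_edge_ideal_fibre_sum[OF G]])
    moreover have "card (?T - ?J) \<le> card (standard_monoms m n E a)"
    proof (rule card_mono)
      show "finite (standard_monoms m n E a)"
        by (rule finite_subset[OF _ T(2)]) (auto simp: standard_monoms_def)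
      show "?T - ?J \<subseteq> standard_monoms m n E a" using non_multiples_standard by blast
    qed
    moreover note card_standard_monoms_le[OF keys, of m E]
    moreover have "card (?T - ?J) = card ?T - card ?J"
      using T(2) by (intro card_Diff_subset) auto
    moreover have "card ?J \<le> card ?T" using T(2) by (intro card_mono) auto
    ultimately show ?thesis using card_leads_eq_dim[OF lin T pieces[OF gr]] by linarith
  qed
  have "leads r (graded_piece (act m g ` ?I) a) = ?J"
    using card_seteq[OF fin sub] card_eq le by simp
  then show "leads r (graded_piece (act m g ` ?I) a) = ?J" "pol_vs.dim (graded_piece ?I a) = card ?J"
    using card_eq by auto
qed

lemma initial_ideal_generic:
  fixes g :: "nat \<Rightarrow> 'k::field mat"
  assumes G: "simple_graph {1..n} E" and g: "g \<in> GL_prod m n" "generic m n g"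
    and r: "term_order m n r" "rows_decreasing m n r"
  shows "initial_ideal m n r (act m g ` binomial_edge_ideal m n E) = Idl\<^bsub>S_ring m n\<^esub> (gin_generators m n E)"
proof -
  let ?gI = "act m g ` binomial_edge_ideal m n E :: 'k pol set"
  note lin = term_order_linear[OF r(1)]
  have anti: "antisym r" using lin by (simp add: order_on_defs)
  have gr: "graded_ideal m n ?gI" by (rule graded_ideal_act[OF g(1) graded_binomial_edge_ideal[OF G]])
  have "leads r ?gI = gin_multiples m n E"
  proof
    show "leads r ?gI \<subseteq> gin_multiples m n E"
    proof
      fix t assume "t \<in> leads r ?gI"
      then obtain p where p: "p \<in> ?gI" "p \<noteq> 0" "t = lead_monom r p" unfolding leads_def by blast
      \<comment> \<open>The component in the degree of the leading monomial lies in the graded ideal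
        and has the same leading monomial, so the count by degrees applies.\<close>
      let ?q = "hom_component (multideg t) p"
      have keys: "Poly_Mapping.keys p \<subseteq> Monoms (matrix_vars m n)"
        using gr p(1) by (auto simp: graded_ideal_def ideal_S_ring_iff Polys_def)
      have tp: "t \<in> Poly_Mapping.keys p" using lead_monom_in_keys[OF lin keys p(2)] p(3) by simp
      then have tq: "t \<in> Poly_Mapping.keys ?q" by (simp add: keys_hom_component)
      have "lead_monom r ?q = t"
        by (rule lead_monom_eqI[OF anti tq])
          (use lead_monom_ge[OF lin keys p(2)] p(3) in \<open>auto simp: keys_hom_component\<close>)
      moreover have "?q \<in> graded_piece ?gI (multideg t)"
        using gr p(1) by (auto simp: graded_ideal_def graded_piece_def keys_hom_component)
      moreover have "?q \<noteq> 0" using tq by auto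
      ultimately have "t \<in> leads r (graded_piece ?gI (multideg t))" by (intro leadsI)
      then show "t \<in> gin_multiples m n E" by (simp add: leads_graded_piece_eq[OF G g r])
    qed
    show "gin_multiples m n E \<subseteq> leads r ?gI"
    proof
      fix t assume "t \<in> gin_multiples m n E"
      then have "t \<in> leads r (graded_piece ?gI (multideg t))" by (rule gin_multiples_leading[OF G g r])
      then show "t \<in> leads r ?gI" unfolding leads_def graded_piece_def by blast
    qed
  qed
  moreover have "{monomial (lead_monom r p) |p. p \<in> ?gI \<and> p \<noteq> 0} = (monomial ` leads r ?gI :: 'k pol set)"
    by (auto simp: leads_def)
  ultimately have "initial_ideal m n r ?gI = Idl\<^bsub>S_ring m n\<^esub> (monomial ` gin_multiples m n E)"
    by (simp add: initial_ideal_def)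
  also have "\<dots> = {p. Poly_Mapping.keys p \<subseteq> monom_multiples m n (gin_multiples m n E)}"
    by (rule genideal_monomials[OF gin_multiples_in_Monoms])
  also have "monom_multiples m n (gin_multiples m n E) = gin_multiples m n E"
  proof (rule Set.equalityI)
    show "monom_multiples m n (gin_multiples m n E) \<subseteq> gin_multiples m n E"
    proof
      fix t assume "t \<in> monom_multiples m n (gin_multiples m n E)"
      then obtain v w s where "t = v + (w + s)" "v \<in> Monoms (matrix_vars m n)" "w \<in> Monoms (matrix_vars m n)"
        "s \<in> gin_monoms m n E"
        unfolding monom_multiples_def by blast
      moreover have "v + (w + s) = (v + w) + s" by (rule add.assoc[symmetric])
      ultimately show "t \<in> gin_multiples m n E"
        unfolding monom_multiples_def using Monoms_add by blast
    qed
    show "gin_multiples m n E \<subseteq> monom_multiples m n (gin_multiples m n E)"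
    proof
      fix t assume "t \<in> gin_multiples m n E"
      then have "\<exists>s\<in>gin_multiples m n E. t = 0 + s" by simp
      then show "t \<in> monom_multiples m n (gin_multiples m n E)"
        unfolding monom_multiples_def[of m n "gin_multiples m n E"] using Monoms_zero by blast
    qed
  qed
  finally show ?thesis by (simp add: gin_ideal_eq)
qed

section \<open>A concrete term order and the Hilbert series\<close>

definition lex_order :: "nat \<Rightarrow> nat \<Rightarrow> (nat \<times> nat) monom rel" where
  "lex_order m n = {(s, t). s \<in> Monoms (matrix_vars m n) \<and> t \<in> Monoms (matrix_vars m n) \<and> s \<le> t}"

lemma monom_nonneg: "0 \<le> (t :: 'v::linorder monom)"
proof (rule ccontr)
  assume "\<not> 0 \<le> t"
  then have "t < 0" by simp
  then show False by (simp add: less_poly_mapping.rep_eq less_fun_def)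
qed

lemma term_order_lex: "term_order m n (lex_order m n)"
  unfolding term_order_def
proof (intro conjI allI ballI impI)
  show "linear_order_on (Monoms (matrix_vars m n)) (lex_order m n)"
    by (auto simp: order_on_defs lex_order_def refl_on_def trans_def antisym_def total_on_def)
  show "\<And>t. t \<in> Monoms (matrix_vars m n) \<Longrightarrow> (0, t) \<in> lex_order m n"
    by (simp add: lex_order_def monom_nonneg)
  fix s t u assume "u \<in> Monoms (matrix_vars m n)" "(s, t) \<in> lex_order m n"
  then show "(s + u, t + u) \<in> lex_order m n"
    by (auto simp: lex_order_def add_right_mono intro: Monoms_add)
qed

lemma rows_decreasing_lex: "rows_decreasing m n (lex_order m n)"
proof (intro ballI)
  fix i j assume ij: "j \<in> {1..n}" "i \<in> {1..<m}"
  have "Poly_Mapping.single (i + 1, j) (1::nat) < Poly_Mapping.single (i, j) 1"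
    unfolding less_poly_mapping.rep_eq less_fun_def
    by (intro exI[of _ "(i, j)"]) (auto simp: lookup_single when_def)
  then show "(Poly_Mapping.single (i + 1, j) 1, Poly_Mapping.single (i, j) 1) \<in> lex_order m n - Id"
    using ij by (auto simp: lex_order_def matrix_vars_def intro!: Monoms_single)
qed

text \<open>Neither side involves a term order or a group element; the lexicographic order and a
  generic \<open>g\<close> enter as auxiliary choices for counting. In a monomial ideal the leading
  monomials of a graded piece are all its monomials.\<close>

lemma hilbert_series_gin:
  assumes inf: "infinite (UNIV :: 'k::field set)" and G: "simple_graph {1..n} E"
  shows "hilbert_series (Idl\<^bsub>S_ring m n\<^esub> (gin_generators m n E :: 'k pol set))
    = hilbert_series (binomial_edge_ideal m n E :: 'k pol set)"
proof
  fix a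
  let ?J = "Idl\<^bsub>S_ring m n\<^esub> (gin_generators m n E) :: 'k pol set"
  let ?r = "lex_order m n" and ?T = "gin_multiples m n E \<inter> monoms_of_degree m n a"
  note lin = term_order_linear[OF term_order_lex[of m n]]
  obtain g :: "nat \<Rightarrow> 'k mat" where g: "g \<in> GL_prod m n" "generic m n g"
    using exists_generic[OF inf] by blast
  have T: "?T \<subseteq> Monoms (matrix_vars m n)" "finite ?T"
    using finite_monoms_of_degree by (auto simp: monoms_of_degree_def)
  have J: "graded_piece ?J a = {p. Poly_Mapping.keys p \<subseteq> ?T}"
    using gin_multiples_in_Monoms[of m n E]
    by (auto simp: graded_piece_def gin_ideal_eq monoms_of_degree_def)
  have "leads ?r (graded_piece ?J a) = ?T"
  proof (rule Set.equalityI)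
    show "leads ?r (graded_piece ?J a) \<subseteq> ?T"
      by (rule leads_subset[OF lin T(1)]) (simp add: J)
    show "?T \<subseteq> leads ?r (graded_piece ?J a)"
    proof
      fix t assume t: "t \<in> ?T"
      have "lead_monom ?r (monomial t :: 'k pol) = t"
        by (rule lead_monom_eqI) (use lin t T(1) in \<open>auto simp: order_on_defs refl_on_def\<close>)
      moreover have "(monomial t :: 'k pol) \<in> graded_piece ?J a" using t by (simp add: J)
      moreover have "(monomial t :: 'k pol) \<noteq> 0"
        using keys_monomial[of t, where 'a = 'k] by fastforce
      ultimately show "t \<in> leads ?r (graded_piece ?J a)" by (intro leadsI)
    qed
  qed
  moreover have "card (leads ?r (graded_piece ?J a)) = pol_vs.dim (graded_piece ?J a)"
    unfolding J by (rule card_leads_eq_dim[OF lin T subspace_keys subset_refl])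
  ultimately show "hilbert_series ?J a = hilbert_series (binomial_edge_ideal m n E :: 'k pol set) a"
    by (simp add: hilbert_series_def dim_graded_piece_eq[OF G g term_order_lex rows_decreasing_lex])
qed

theorem theorem5p1:
  fixes m n :: nat and E :: "nat set set"
  assumes "infinite (UNIV :: 'k::field set)"
    and "m \<ge> 1" and "n \<ge> 1"
    and "simple_graph {1..n} E"
  shows "cartwright_sturmfels m n (binomial_edge_ideal m n E :: 'k pol set) \<and>
    (\<forall>r. term_order m n r \<and>
        (\<forall>j\<in>{1..n}. \<forall>i\<in>{1..<m}.
          (Poly_Mapping.single (i + 1, j) 1, Poly_Mapping.single (i, j) 1) \<in> r - Id) \<longrightarrow>
      is_gin m n r (binomial_edge_ideal m n E :: 'k pol set)
        (Idl\<^bsub>S_ring m n\<^esub> (gin_generators m n E)))"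
proof (intro conjI allI impI)
  show "cartwright_sturmfels m n (binomial_edge_ideal m n E :: 'k pol set)"
    unfolding cartwright_sturmfels_def
    using graded_binomial_edge_ideal[OF assms(4)] monomial_ideal_gin radical_ideal_gin borel_fixed_gin
      hilbert_series_gin[OF assms(1,4)]
    by blast
next
  fix r assume r: "term_order m n r \<and> rows_decreasing m n r"
  \<comment> \<open>The same open set works for every admissible order \<open>r\<close>.\<close>
  let ?U = "{g \<in> GL_prod m n. generic m n (g :: nat \<Rightarrow> 'k mat)}"
  have "?U \<noteq> {}" using exists_generic[OF assms(1)] by blast
  moreover have "\<forall>g\<in>?U. initial_ideal m n r (act m g ` binomial_edge_ideal m n E)
      = Idl\<^bsub>S_ring m n\<^esub> (gin_generators m n E)"
    using initial_ideal_generic[OF assms(4)] r by blast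
  ultimately show "is_gin m n r (binomial_edge_ideal m n E :: 'k pol set)
      (Idl\<^bsub>S_ring m n\<^esub> (gin_generators m n E))"
    unfolding is_gin_def using zariski_open_generic[of m n, where 'k = 'k] by blast
qed

end
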